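(* Let $S$ be a semitopological semigroup. Then $AP(S)$ has a left invariant mean if and only if $S$ has the following fixed point property $(E)$: for every locally convex space $X$ whose topology is determined by a family $Q$ of continuous seminorms and every nonempty weakly compact convex subset $K$ of $X$, every $Q$-nonexpansive dynamical system $(S,(K,\mathrm{weak}))$ such that the family of translations $\lambda_s:K\to K$, $s\in S$, is equicontinuous in the weak topology has a fixed point.
   Context: A semitopological semigroup is a (nonempty) semigroup $S$ with a Hausdorff topology such that for each $t\in S$ the maps $s\mapsto ts$ and $s\mapsto st$ are continuous. $\ell^\infty(S)$ is the Banach space of bounded complex-valued functions on $S$ with the supremum norm; for $s\in S$, $L_sf(t)=f(st)$ and $R_sf(t)=f(ts)$. $C(S)$ is the closed subalgebra of bounded continuous functions. $AP(S)$ is the space of almost periodic functions: those $f\in C(S)$ for which $\{L_sf:s\in S\}$ is relatively compact in the norm topology of $C(S)$. If $Y$ is a closed linear subspace of $\ell^\infty(S)$ containing constants with $L_s(Y)\subset Y$, $R_s(Y)\subset Y$ for all $s$ (as is $AP(S)$), a left invariant mean on $Y$ is $\mu\in Y^*$ with $\|\mu\|=\mu(1)=1$ and $\mu(L_sf)=\mu(f)$ for all $s\in S$, $f\in Y$. Locally convex spaces are Hausdorff. A dynamical system $(S,K)$ consists of a semitopological semigroup $S$, a topological space $K$ and an action $S\times K\to K$, $(s,x)\mapsto sx$, with $s_1(s_2x)=(s_1s_2)x$, which is separately continuous (all maps $s\mapsto sx$ and all translations $\lambda_s:x\mapsto sx$ are continuous). $(S,(K,\mathrm{weak}))$ means that $K$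 carries the weak topology. For $K$ in a locally convex space with topology determined by the family $Q$ of seminorms, the system is $Q$-nonexpansive if $p(sx-sy)\le p(x-y)$ for all $p\in Q$, $s\in S$, $x,y\in K$. A fixed point is $x\in K$ with $sx=x$ for all $s\in S$. *)

theory Defs
  imports "HOL-Analysis.Analysis" "HOL-Library.Function_Algebras"
begin

class semitopological_semigroup = semigroup_mult + t2_space +
  assumes open_vimage_mult_left: "open U \<Longrightarrow> open ((\<lambda>s. t * s) -` U)"
    and open_vimage_mult_right: "open U \<Longrightarrow> open ((\<lambda>s. s * t) -` U)"

lemma continuous_mult_left:
  "continuous_on UNIV (\<lambda>s. t * s)" for t :: "'s::semitopological_semigroup"
  by (simp add: continuous_on_open_vimage open_vimage_mult_left)

lemma continuous_mult_right:
  "continuous_on UNIV (\<lambda>s. s * t)" for t :: "'s::semitopological_semigroup"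
  by (simp add: continuous_on_open_vimage open_vimage_mult_right)


subsection \<open>Almost periodic functions and invariant means\<close>

text \<open>The space \<open>C(S)\<close> is the library type \<open>'s \<Rightarrow>\<^sub>C complex\<close> of bounded continuous
  functions with the supremum norm.\<close>

definition left_translate ::
  "'s::semitopological_semigroup \<Rightarrow> ('s \<Rightarrow>\<^sub>C complex) \<Rightarrow> ('s \<Rightarrow>\<^sub>C complex)" where
  "left_translate s f = Bcontfun (\<lambda>t. apply_bcontfun f (s * t))"

lemma apply_left_translate [simp]:
  "apply_bcontfun (left_translate s f) t = apply_bcontfun f (s * t)"
proof -
  have "continuous_on UNIV (apply_bcontfun f \<circ> (\<lambda>t. s * t))"
    using apply_bcontfun[of f] by (intro continuous_on_compose continuous_mult_left)
      (auto simp: bcontfun_def intro: continuous_on_subset)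
  moreover have "bounded (range (\<lambda>t. apply_bcontfun f (s * t)))"
    by (rule bounded_subset[of "range (apply_bcontfun f)"])
       (use apply_bcontfun[of f] in \<open>auto simp: bcontfun_def\<close>)
  ultimately have "(\<lambda>t. apply_bcontfun f (s * t)) \<in> bcontfun"
    by (simp add: bcontfun_def o_def)
  then show ?thesis
    by (simp add: left_translate_def Bcontfun_inverse)
qed

text \<open>The library equips \<open>'s \<Rightarrow>\<^sub>C complex\<close> only with real scalars; complex functionals need
  complex ones.\<close>

definition cscale ::
  "complex \<Rightarrow> ('s::topological_space \<Rightarrow>\<^sub>C complex) \<Rightarrow> ('s \<Rightarrow>\<^sub>C complex)" where
  "cscale c f = Bcontfun (\<lambda>t. c * apply_bcontfun f t)"

lemma apply_cscale [simp]: "apply_bcontfun (cscale c f) t = c * apply_bcontfun f t"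
proof -
  have "bounded ((\<lambda>z. c * z) ` range (apply_bcontfun f))"
    using apply_bcontfun[of f]
    by (intro bounded_linear_image bounded_linear_mult_right) (auto simp: bcontfun_def)
  moreover have "continuous_on UNIV (apply_bcontfun f)"
    using apply_bcontfun[of f] by (simp add: bcontfun_def)
  ultimately have "(\<lambda>t. c * apply_bcontfun f t) \<in> bcontfun"
    by (auto simp: bcontfun_def image_image intro: continuous_on_mult_left)
  then show ?thesis
    by (simp add: cscale_def Bcontfun_inverse)
qed

definition almost_periodic :: "('s::semitopological_semigroup \<Rightarrow>\<^sub>C complex) set" where
  "almost_periodic = {f. compact (closure (range (\<lambda>s. left_translate s f)))}"

definition bounded_functional_on ::
  "('s::topological_space \<Rightarrow>\<^sub>C complex) set \<Rightarrow> (('s \<Rightarrow>\<^sub>C complex) \<Rightarrow> complex) \<Rightarrow> bool" where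
  "bounded_functional_on Y \<mu> \<longleftrightarrow>
     (\<forall>f\<in>Y. \<forall>g\<in>Y. \<mu> (f + g) = \<mu> f + \<mu> g) \<and>
     (\<forall>c. \<forall>f\<in>Y. \<mu> (cscale c f) = c * \<mu> f) \<and>
     (\<exists>B. \<forall>f\<in>Y. norm (\<mu> f) \<le> B * norm f)"

definition dual_norm ::
  "('s::topological_space \<Rightarrow>\<^sub>C complex) set \<Rightarrow> (('s \<Rightarrow>\<^sub>C complex) \<Rightarrow> complex) \<Rightarrow> real" where
  "dual_norm Y \<mu> = (SUP f\<in>{f \<in> Y. norm f \<le> 1}. norm (\<mu> f))"

definition left_invariant_mean ::
  "('s::semitopological_semigroup \<Rightarrow>\<^sub>C complex) set \<Rightarrow> (('s \<Rightarrow>\<^sub>C complex) \<Rightarrow> complex) \<Rightarrow> bool" where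
  "left_invariant_mean Y \<mu> \<longleftrightarrow>
     bounded_functional_on Y \<mu> \<and> dual_norm Y \<mu> = 1 \<and> \<mu> (const_bcontfun 1) = 1 \<and>
     (\<forall>s. \<forall>f\<in>Y. \<mu> (left_translate s f) = \<mu> f)"


subsection \<open>Locally convex spaces\<close>

text \<open>A locally convex space is a linear subspace \<open>X\<close> of a vector space (scalar multiplication
  \<open>smul\<close>) together with a family \<open>Q\<close> of seminorms on \<open>X\<close>, whose topology is required to be
  Hausdorff. Structure is carried by \<open>smul\<close>, \<open>X\<close> and \<open>Q\<close> rather than by type classes so that
  one can quantify over all locally convex spaces inside a formula. The scalars are
  used only for \<open>real\<close> and \<open>complex\<close>.\<close>

definition seminorm_on ::
  "('k::real_normed_field \<Rightarrow> 'x::ab_group_add \<Rightarrow> 'x) \<Rightarrow> 'x set \<Rightarrow> ('x \<Rightarrow> real) \<Rightarrow> bool" where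
  "seminorm_on smul X p \<longleftrightarrow>
     (\<forall>x\<in>X. 0 \<le> p x) \<and>
     (\<forall>x\<in>X. \<forall>y\<in>X. p (x + y) \<le> p x + p y) \<and>
     (\<forall>c. \<forall>x\<in>X. p (smul c x) = norm c * p x)"

text \<open>\<open>X\<close> itself is inserted because the family \<open>Q\<close> may be empty.\<close>

definition seminorm_topology :: "'x::ab_group_add set \<Rightarrow> ('x \<Rightarrow> real) set \<Rightarrow> 'x topology" where
  "seminorm_topology X Q = topology_generated_by
     (insert X {{y \<in> X. p (y - x) < r} | p x r. p \<in> Q \<and> x \<in> X \<and> 0 < r})"

definition locally_convex_space ::
  "('k::real_normed_field \<Rightarrow> 'x::ab_group_add \<Rightarrow> 'x) \<Rightarrow> 'x set \<Rightarrow> ('x \<Rightarrow> real) set \<Rightarrow> bool" where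
  "locally_convex_space smul X Q \<longleftrightarrow>
     vector_space smul \<and> module.subspace smul X \<and>
     (\<forall>p\<in>Q. seminorm_on smul X p) \<and>
     Hausdorff_space (seminorm_topology X Q)"

definition continuous_dual ::
  "('k::real_normed_field \<Rightarrow> 'x::ab_group_add \<Rightarrow> 'x) \<Rightarrow> 'x set \<Rightarrow> ('x \<Rightarrow> real) set \<Rightarrow> ('x \<Rightarrow> 'k) set" where
  "continuous_dual smul X Q =
     {\<phi>. (\<forall>x\<in>X. \<forall>y\<in>X. \<phi> (x + y) = \<phi> x + \<phi> y) \<and>
         (\<forall>c. \<forall>x\<in>X. \<phi> (smul c x) = c * \<phi> x) \<and>
         continuous_map (seminorm_topology X Q) euclidean \<phi>}"

definition weak_topology ::
  "('k::real_normed_field \<Rightarrow> 'x::ab_group_add \<Rightarrow> 'x) \<Rightarrow> 'x set \<Rightarrow> ('x \<Rightarrow> real) set \<Rightarrow> 'x topology" where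
  "weak_topology smul X Q = topology_generated_by
     {{x \<in> X. \<phi> x \<in> U} | \<phi> U. \<phi> \<in> continuous_dual smul X Q \<and> open U}"

definition convex_in :: "('k::real_normed_field \<Rightarrow> 'x::ab_group_add \<Rightarrow> 'x) \<Rightarrow> 'x set \<Rightarrow> bool" where
  "convex_in smul K \<longleftrightarrow>
     (\<forall>x\<in>K. \<forall>y\<in>K. \<forall>t\<in>{0..1}. smul (of_real (1 - t)) x + smul (of_real t) y \<in> K)"


subsection \<open>Dynamical systems and the fixed point property\<close>

definition dynamical_system ::
  "('s::semitopological_semigroup \<Rightarrow> 'x \<Rightarrow> 'x) \<Rightarrow> 'x topology \<Rightarrow> bool" where
  "dynamical_system act T \<longleftrightarrow>
     (\<forall>s. \<forall>x\<in>topspace T. act s x \<in> topspace T) \<and>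
     (\<forall>s t. \<forall>x\<in>topspace T. act s (act t x) = act (s * t) x) \<and>
     (\<forall>x\<in>topspace T. continuous_map euclidean T (\<lambda>s. act s x)) \<and>
     (\<forall>s. continuous_map T T (act s))"

definition nonexpansive_action ::
  "('x::ab_group_add \<Rightarrow> real) set \<Rightarrow> ('s \<Rightarrow> 'x \<Rightarrow> 'x) \<Rightarrow> 'x set \<Rightarrow> bool" where
  "nonexpansive_action Q act K \<longleftrightarrow>
     (\<forall>p\<in>Q. \<forall>s. \<forall>x\<in>K. \<forall>y\<in>K. p (act s x - act s y) \<le> p (x - y))"

text \<open>Equicontinuity on \<open>K\<close> of the translations with respect to the uniformity of the vector
  topology \<open>T\<close>, in which the entourages are given by neighbourhoods of \<open>0\<close>.\<close>

definition equicontinuous_action ::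
  "'x::ab_group_add topology \<Rightarrow> ('s \<Rightarrow> 'x \<Rightarrow> 'x) \<Rightarrow> 'x set \<Rightarrow> bool" where
  "equicontinuous_action T act K \<longleftrightarrow>
     (\<forall>x\<in>K. \<forall>U. openin T U \<and> 0 \<in> U \<longrightarrow>
        (\<exists>V. openin T V \<and> x \<in> V \<and> (\<forall>s. \<forall>y\<in>V \<inter> K. act s y - act s x \<in> U)))"

text \<open>The property \<open>(E)\<close> for \<open>'s\<close>, for all locally convex spaces over \<open>'k\<close> whose points are
  elements of \<open>'x\<close>.\<close>

definition fixed_point_property_E ::
  "'s::semitopological_semigroup itself \<Rightarrow> 'k::real_normed_field itself \<Rightarrow>
   'x::ab_group_add itself \<Rightarrow> bool" where
  "fixed_point_property_E TYPE('s) TYPE('k) TYPE('x) \<longleftrightarrow>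
     (\<forall>(smul :: 'k \<Rightarrow> 'x \<Rightarrow> 'x) X Q K (act :: 's \<Rightarrow> 'x \<Rightarrow> 'x).
        locally_convex_space smul X Q \<and>
        K \<noteq> {} \<and> K \<subseteq> X \<and> convex_in smul K \<and> compactin (weak_topology smul X Q) K \<and>
        dynamical_system act (subtopology (weak_topology smul X Q) K) \<and>
        nonexpansive_action Q act K \<and>
        equicontinuous_action (weak_topology smul X Q) act K \<longrightarrow>
        (\<exists>x\<in>K. \<forall>s. act s x = x))"

text \<open>HOL cannot quantify over types inside a formula. For the equivalence with a left invariant
  mean, a universe in which the dual space \<open>AP(S)\<^sup>*\<close> lives suffices.\<close>

type_synonym 's functional = "('s \<Rightarrow>\<^sub>C complex) \<Rightarrow> complex"

end

theory Submission
  imports Defs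
begin

text \<open>
  From a mean to a fixed point: Zorn's lemma gives a minimal closed convex invariant
  \<open>K0 \<subseteq> K\<close> and a minimal closed invariant \<open>F \<subseteq> K0\<close>. By equicontinuity, continuous functions along
  orbits are almost periodic; the mean and the minimality of \<open>F\<close> then force \<open>s F = F\<close> for every
  \<open>s\<close>. Some power of each translation is weakly close to the identity on \<open>F\<close>, so the translations
  are isometries of \<open>F\<close> for every \<open>p \<in> Q\<close>. Weakly compact sets have relatively open parts of small
  \<open>p\<close>-diameter, and finitely many translates of such a part cover \<open>F\<close>: \<open>F\<close> is \<open>p\<close>-totally
  bounded although it is only weakly compact. DeMarr's averaging argument and the minimality of
  \<open>K0\<close> now show that \<open>F\<close> is a single point.

  From fixed points to a mean: the means on \<open>AP(S)\<close> form a compact convex set for the topology of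
  uniform convergence on the orbits of almost periodic functions, on which this topology agrees with
  the weak and the pointwise ones; the dual translations are nonexpansive, and their fixed points
  are the left invariant means.
\<close>

section \<open>Dominated linear functionals and Hahn--Banach separation\<close>

text \<open>The obstacle is a mismatch: nonexpansiveness speaks of the seminorms, compactness and
  equicontinuity only of the weak topology, for which a seminorm is in general merely lower
  semicontinuous. The link is the set of real-linear functionals dominated by one \<open>p\<close>
  in \<open>Q\<close>. They are weakly continuous, they separate points, and \<open>p\<close> is
  their supremum. Hence Hahn-Banach comes before everything else, and the fixed point argument is
  phrased in terms of these functionals. A semigroup offers neither inverses nor an identity.
  Surjectivity on \<open>F\<close> replaces inverses: it turns the recurrence of powers into
  closeness to the identity, and it keeps the set of points near all of \<open>F\<close> invariant.
  In the converse, evaluation seminorms would give pointwise convergence at once, but a translation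
  carries the seminorm at \<open>f\<close> to the one at a translate of \<open>f\<close>. Suprema
  over whole orbits make every single seminorm nonexpansive, and almost periodicity is what keeps
  the topology on the means unchanged.\<close>

locale real_subspace = vector_space scale
  for scale :: "real \<Rightarrow> 'x::ab_group_add \<Rightarrow> 'x" +
  fixes X :: "'x set"
  assumes subspace_X: "subspace X"
begin

lemma X_zero [simp]: "0 \<in> X" and X_add [simp]: "x \<in> X \<Longrightarrow> y \<in> X \<Longrightarrow> x + y \<in> X"
  and X_scale [simp]: "x \<in> X \<Longrightarrow> scale c x \<in> X"
  and X_neg [simp]: "x \<in> X \<Longrightarrow> - x \<in> X"
  and X_diff [simp]: "x \<in> X \<Longrightarrow> y \<in> X \<Longrightarrow> x - y \<in> X"
  using subspace_0[OF subspace_X] subspace_add[OF subspace_X] subspace_scale[OF subspace_X]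
    subspace_neg[OF subspace_X] subspace_diff[OF subspace_X] by auto

definition sublinear_on :: "('x \<Rightarrow> real) \<Rightarrow> bool" where
  "sublinear_on q \<longleftrightarrow> (\<forall>x\<in>X. \<forall>y\<in>X. q (x + y) \<le> q x + q y) \<and>
     (\<forall>t\<ge>0. \<forall>x\<in>X. q (scale t x) = t * q x)"

definition linear_on :: "('x \<Rightarrow> real) \<Rightarrow> bool" where
  "linear_on \<phi> \<longleftrightarrow> (\<forall>x\<in>X. \<forall>y\<in>X. \<phi> (x + y) = \<phi> x + \<phi> y) \<and>
     (\<forall>c. \<forall>x\<in>X. \<phi> (scale c x) = c * \<phi> x)"

definition dominated :: "('x \<Rightarrow> real) \<Rightarrow> ('x \<Rightarrow> real) set" where
  "dominated p = {\<phi>. linear_on \<phi> \<and> (\<forall>x\<in>X. \<phi> x \<le> p x)}"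

lemma sublinear_onD:
  assumes "sublinear_on q"
  shows "x \<in> X \<Longrightarrow> y \<in> X \<Longrightarrow> q (x + y) \<le> q x + q y"
    and "0 \<le> t \<Longrightarrow> x \<in> X \<Longrightarrow> q (scale t x) = t * q x"
    and "q 0 = 0"
    and "x \<in> X \<Longrightarrow> - q (- x) \<le> q x"
proof -
  show *: "x \<in> X \<Longrightarrow> y \<in> X \<Longrightarrow> q (x + y) \<le> q x + q y"
    and **: "0 \<le> t \<Longrightarrow> x \<in> X \<Longrightarrow> q (scale t x) = t * q x" for x y t
    using assms by (auto simp: sublinear_on_def)
  show "q 0 = 0"
    using **[of 0 0] by simp
  then show "x \<in> X \<Longrightarrow> - q (- x) \<le> q x"
    using *[of x "- x"] by simp
qed

lemma linear_onD:
  assumes "linear_on \<phi>"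
  shows "x \<in> X \<Longrightarrow> y \<in> X \<Longrightarrow> \<phi> (x + y) = \<phi> x + \<phi> y"
    and "x \<in> X \<Longrightarrow> \<phi> (scale t x) = t * \<phi> x"
    and "\<phi> 0 = 0"
    and "x \<in> X \<Longrightarrow> \<phi> (- x) = - \<phi> x"
    and "x \<in> X \<Longrightarrow> y \<in> X \<Longrightarrow> \<phi> (x - y) = \<phi> x - \<phi> y"
proof -
  show *: "x \<in> X \<Longrightarrow> y \<in> X \<Longrightarrow> \<phi> (x + y) = \<phi> x + \<phi> y"
    and **: "x \<in> X \<Longrightarrow> \<phi> (scale t x) = t * \<phi> x" for x y t
    using assms by (auto simp: linear_on_def)
  show "\<phi> 0 = 0"
    using **[of 0 0] by simp
  show ***: "x \<in> X \<Longrightarrow> \<phi> (- x) = - \<phi> x" for x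
    using **[of x "-1"] by simp
  show "x \<in> X \<Longrightarrow> y \<in> X \<Longrightarrow> \<phi> (x - y) = \<phi> x - \<phi> y"
    using *[of x "- y"] ***[of y] by simp
qed

section \<open>Hahn-Banach by minimal sublinear functionals\<close>

text \<open>Subadditivity of an infimum asks for one member below two near-optimal ones;
  directedness supplies it. Chains, the case for Zorn's lemma, are directed.\<close>

lemma sublinear_on_inf:
  assumes ne: "\<C> \<noteq> {}" and sub: "\<And>q. q \<in> \<C> \<Longrightarrow> sublinear_on q"
    and bdd: "\<And>x. x \<in> X \<Longrightarrow> bdd_below ((\<lambda>q. q x) ` \<C>)"
    and dir: "\<And>q r. q \<in> \<C> \<Longrightarrow> r \<in> \<C> \<Longrightarrow> \<exists>u\<in>\<C>. \<forall>x\<in>X. u x \<le> q x \<and> u x \<le> r x"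
  shows "sublinear_on (\<lambda>x. INF q\<in>\<C>. q x)"
  unfolding sublinear_on_def
proof (intro conjI ballI allI impI)
  fix x y assume xy: "x \<in> X" "y \<in> X"
  let ?i = "\<lambda>x. INF q\<in>\<C>. q x"
  show "?i (x + y) \<le> ?i x + ?i y"
  proof (rule field_le_epsilon)
    fix e :: real assume e: "0 < e"
    obtain q where q: "q \<in> \<C>" "q x < ?i x + e/2"
      using cInf_lessD[of "(\<lambda>q. q x) ` \<C>" "?i x + e/2"] ne e by auto
    obtain r where r: "r \<in> \<C>" "r y < ?i y + e/2"
      using cInf_lessD[of "(\<lambda>q. q y) ` \<C>" "?i y + e/2"] ne e by auto
    obtain u where u: "u \<in> \<C>" "\<forall>x\<in>X. u x \<le> q x \<and> u x \<le> r x"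
      using dir q r by blast
    have "?i (x + y) \<le> u (x + y)"
      using bdd[of "x + y"] u xy by (intro cINF_lower) auto
    also have "\<dots> \<le> u x + u y"
      using sub[OF u(1)] xy by (simp add: sublinear_onD)
    also have "\<dots> \<le> q x + r y"
      using u xy by (intro add_mono) auto
    finally show "?i (x + y) \<le> ?i x + ?i y + e"
      using q r by simp
  qed
next
  fix t :: real and x assume t: "0 \<le> t" and x: "x \<in> X"
  have "(INF q\<in>\<C>. q (scale t x)) = (INF q\<in>\<C>. t * q x)"
    using sub t x by (intro INF_cong) (auto simp: sublinear_onD)
  also have "\<dots> = t * (INF q\<in>\<C>. q x)"
  proof (cases "t = 0")
    case True then show ?thesis using ne by simp
  next
    case False
    with t have tp: "t > 0" by simp
    show ?thesis
    proof (rule antisym)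
      have "(INF q\<in>\<C>. t * q x) / t \<le> (INF q\<in>\<C>. q x)"
      proof (rule cINF_greatest[OF ne])
        fix q assume q: "q \<in> \<C>"
        have "bdd_below ((\<lambda>q. t * q x) ` \<C>)"
        proof -
          obtain M where "\<And>q. q \<in> \<C> \<Longrightarrow> M \<le> q x"
            using bdd[OF x] unfolding bdd_below_def by auto
          then show ?thesis
            using tp by (intro bdd_belowI2[of _ "t * M"] mult_left_mono) auto
        qed
        then have "(INF q\<in>\<C>. t * q x) \<le> t * q x"
          using q by (rule cINF_lower)
        then show "(INF q\<in>\<C>. t * q x) / t \<le> q x"
          using tp by (simp add: field_simps)
      qed
      then show "(INF q\<in>\<C>. t * q x) \<le> t * (INF q\<in>\<C>. q x)"
        using tp by (simp add: field_simps)
      show "t * (INF q\<in>\<C>. q x) \<le> (INF q\<in>\<C>. t * q x)"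
        using tp bdd[OF x] by (intro cINF_greatest ne mult_left_mono cINF_lower) auto
    qed
  qed
  finally show "(INF q\<in>\<C>. q (scale t x)) = t * (INF q\<in>\<C>. q x)" .
qed

lemma minimal_sublinear_exists:
  assumes q0: "sublinear_on q0"
  obtains q where "sublinear_on q" "\<And>x. x \<in> X \<Longrightarrow> q x \<le> q0 x"
    "\<And>r x. sublinear_on r \<Longrightarrow> (\<And>x. x \<in> X \<Longrightarrow> r x \<le> q x) \<Longrightarrow> x \<in> X \<Longrightarrow> r x = q x"
proof -
  \<comment> \<open>Values off \<open>X\<close> are invisible to the order, so they are fixed as 0;
    this gives antisymmetry.\<close>
  define A where "A = {q. sublinear_on q \<and> (\<forall>x\<in>X. q x \<le> q0 x) \<and> (\<forall>x. x \<notin> X \<longrightarrow> q x = 0)}"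
  have ext: "(\<lambda>x. if x \<in> X then r x else 0) \<in> A"
    if "sublinear_on r" "\<And>x. x \<in> X \<Longrightarrow> r x \<le> q0 x" for r
    using that unfolding A_def sublinear_on_def by auto
  \<comment> \<open>The order is reversed: a Zorn-maximal element is a minimal functional.\<close>
  define R where "R = {(q, r). q \<in> A \<and> r \<in> A \<and> (\<forall>x\<in>X. r x \<le> q x)}"
  have A_eq: "q = r" if "q \<in> A" "r \<in> A" "\<And>x. x \<in> X \<Longrightarrow> q x = r x" for q r
  proof
    fix x show "q x = r x" using that by (cases "x \<in> X") (auto simp: A_def)
  qed
  have field: "Field R = A"
    by (auto simp: Field_def R_def)
  have po: "Partial_order R"
    unfolding partial_order_on_def preorder_on_def field
  proof (intro conjI)
    show "refl_on A R" "trans R"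
      by (force simp: refl_on_def trans_def R_def intro: order_trans)+
    show "antisym R"
    proof (rule antisymI)
      fix q r assume "(q, r) \<in> R" "(r, q) \<in> R"
      then show "q = r" by (intro A_eq) (auto simp: R_def intro: antisym)
    qed
  qed (auto simp: R_def)
  have "\<exists>u\<in>Field R. \<forall>q\<in>C. (q, u) \<in> R" if C: "C \<in> Chains R" for C
  proof (cases "C = {}")
    case True
    then show ?thesis unfolding field using ext[OF q0] by auto
  next
    case False
    have CA: "C \<subseteq> A" using C unfolding Chains_def R_def by blast
    have bdd: "bdd_below ((\<lambda>q. q x) ` C)" if x: "x \<in> X" for x
    proof (rule bdd_belowI2)
      fix q assume "q \<in> C"
      then have q: "sublinear_on q" "\<forall>x\<in>X. q x \<le> q0 x"
        using CA by (auto simp: A_def)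
      \<comment> \<open>Subadditivity bounds \<open>q x\<close> below by \<open>- q (- x)\<close>,
        hence by \<open>- q0 (- x)\<close>, uniformly along the chain.\<close>
      show "- q0 (- x) \<le> q x"
        using sublinear_onD(4)[OF q(1) x] q(2) x by (smt (verit) X_neg)
    qed
    let ?i = "\<lambda>x. INF q\<in>C. q x"
    have le: "?i x \<le> q x" if "q \<in> C" "x \<in> X" for q x
      using that bdd by (intro cINF_lower) auto
    have "sublinear_on ?i"
    proof (rule sublinear_on_inf[OF False _ bdd])
      show "sublinear_on q" if "q \<in> C" for q using that CA by (auto simp: A_def)
      show "\<exists>u\<in>C. \<forall>x\<in>X. u x \<le> q x \<and> u x \<le> r x" if "q \<in> C" "r \<in> C" for q r
        using that C unfolding Chains_def R_def by fastforce
    qed auto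
    moreover obtain q1 where "q1 \<in> C" using False by auto
    then have "?i x \<le> q0 x" if "x \<in> X" for x
      using le[of q1 x] that CA by (fastforce simp: A_def)
    ultimately have u: "(\<lambda>x. if x \<in> X then ?i x else 0) \<in> A"
      by (rule ext)
    show ?thesis unfolding field
      using CA le by (intro bexI[OF _ u]) (auto simp: R_def u)
  qed
  then obtain q where q: "q \<in> A" "\<And>r. r \<in> A \<Longrightarrow> (q, r) \<in> R \<Longrightarrow> r = q"
    using Zorns_po_lemma[OF po] unfolding field by metis
  show ?thesis
  proof (rule that)
    show "sublinear_on q" and q_le: "\<And>x. x \<in> X \<Longrightarrow> q x \<le> q0 x"
      using q by (auto simp: A_def)
    fix r x assume r: "sublinear_on r" "\<And>x. x \<in> X \<Longrightarrow> r x \<le> q x" and x: "x \<in> X"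
    have "(\<lambda>x. if x \<in> X then r x else 0) \<in> A"
      using r q_le by (intro ext) (auto intro: order_trans)
    moreover from this have "(q, \<lambda>x. if x \<in> X then r x else 0) \<in> R"
      using q r by (auto simp: R_def)
    ultimately have "(\<lambda>x. if x \<in> X then r x else 0) = q"
      by (rule q(2))
    from fun_cong[OF this, of x] show "r x = q x" using x by simp
  qed
qed

text \<open>The formula for \<open>r\<close> is forced: a sublinear \<open>r \<le> p\<close> with
  \<open>r (- v) \<le> - d\<close> satisfies
  \<open>r y \<le> r (y + t v) + t r (- v) \<le> p (y + t v) - t d\<close>, and the infimum of these
  bounds is the largest such \<open>r\<close>. A linear functional below it is dominated by
  \<open>p\<close> and at least \<open>d\<close> on \<open>V\<close>.\<close>

lemma sublinear_on_tilt:
  assumes p: "sublinear_on p" and V: "V \<subseteq> X" "V \<noteq> {}" "convex_in scale V"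
    and d: "\<And>v. v \<in> V \<Longrightarrow> d \<le> p v"
  obtains r where "sublinear_on r" "\<And>x. x \<in> X \<Longrightarrow> r x \<le> p x" "\<And>v. v \<in> V \<Longrightarrow> r (- v) \<le> - d"
proof -
  define A where "A = (\<lambda>y. {p (y + scale t v) - t * d | t v. 0 \<le> t \<and> v \<in> V})"
  define r where "r = (\<lambda>y. Inf (A y))"
  have A_ne: "A y \<noteq> {}" for y
    using V(2) unfolding A_def by (fastforce intro: exI[of _ "0::real"])
  have A_ge: "- p (- y) \<le> a" if y: "y \<in> X" and a: "a \<in> A y" for y a
  proof -
    obtain t v where tv: "0 \<le> t" "v \<in> V" "a = p (y + scale t v) - t * d"
      using a by (auto simp: A_def)
    have vX: "v \<in> X" using tv V by auto
    have "p (scale t v) \<le> p (y + scale t v) + p (- y)"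
      using sublinear_onD(1)[OF p, of "y + scale t v" "- y"] vX y by simp
    moreover have "p (scale t v) = t * p v"
      using p tv vX by (simp add: sublinear_onD)
    moreover have "t * d \<le> t * p v"
      using tv d by (intro mult_left_mono) auto
    ultimately show ?thesis using tv by simp
  qed
  have bdd: "bdd_below (A y)" if "y \<in> X" for y
    using A_ge[OF that] by (rule bdd_belowI)
  have r_le: "r y \<le> p (y + scale t v) - t * d" if "y \<in> X" "0 \<le> t" "v \<in> V" for y t v
    unfolding r_def using that by (intro cInf_lower bdd) (auto simp: A_def)
  have r_ge: "b \<le> r y" if "\<And>t v. 0 \<le> t \<Longrightarrow> v \<in> V \<Longrightarrow> b \<le> p (y + scale t v) - t * d" for b y
    unfolding r_def using that by (intro cInf_greatest A_ne) (auto simp: A_def)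
  obtain v0 where v0: "v0 \<in> V" using V by auto
  have r_p: "r y \<le> p y" if "y \<in> X" for y
    using r_le[OF that _ v0, of 0] by simp
  \<comment> \<open>Convexity of \<open>V\<close> enters here: sums of nonnegative multiples of
    points of \<open>V\<close> are again such multiples, and the factors add up.\<close>
  have comb: "\<exists>v\<in>V. scale t1 v1 + scale t2 v2 = scale (t1 + t2) v"
    if t: "0 \<le> t1" "0 \<le> t2" and v: "v1 \<in> V" "v2 \<in> V" for t1 t2 v1 v2
  proof (cases "t1 + t2 = 0")
    case True
    then have "t1 = 0" "t2 = 0" using t by auto
    then show ?thesis using v0 by auto
  next
    case False
    define u where "u = t2 / (t1 + t2)"
    have u: "u \<in> {0..1}" using t False by (auto simp: u_def divide_simps)
    have e: "(t1 + t2) * (1 - u) = t1" "(t1 + t2) * u = t2"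
      using False by (auto simp: u_def field_simps)
    have "scale (1 - u) v1 + scale u v2 \<in> V"
      using V(3) v u unfolding convex_in_def of_real_eq_id id_def by blast
    moreover have "scale (t1 + t2) (scale (1 - u) v1 + scale u v2) = scale t1 v1 + scale t2 v2"
      by (simp only: scale_right_distrib scale_scale e)
    ultimately show ?thesis by metis
  qed
  have add: "r (x + y) \<le> r x + r y" if xy: "x \<in> X" "y \<in> X" for x y
  proof -
    have "r (x + y) - (p (y + scale t2 v2) - t2 * d) \<le> r x" if t2: "0 \<le> t2" "v2 \<in> V" for t2 v2
    proof (rule r_ge)
      fix t1 v1 assume t1: "0 \<le> (t1::real)" "v1 \<in> V"
      obtain v where v: "v \<in> V" "scale t1 v1 + scale t2 v2 = scale (t1 + t2) v"
        using comb t1 t2 by blast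
      have "r (x + y) \<le> p (x + y + scale (t1 + t2) v) - (t1 + t2) * d"
        using r_le xy v t1 t2 by simp
      also have "x + y + scale (t1 + t2) v = (x + scale t1 v1) + (y + scale t2 v2)"
        using v(2) by (simp add: algebra_simps)
      also have "p \<dots> \<le> p (x + scale t1 v1) + p (y + scale t2 v2)"
        using xy t1 t2 V by (intro sublinear_onD[OF p]) auto
      finally show "r (x + y) - (p (y + scale t2 v2) - t2 * d) \<le> p (x + scale t1 v1) - t1 * d"
        by (simp add: algebra_simps)
    qed
    then have "r (x + y) - r x \<le> r y"
      by (intro r_ge) (simp add: algebra_simps)
    then show ?thesis by simp
  qed
  have scale_le: "r (scale s y) \<le> s * r y" if s: "0 < s" and y: "y \<in> X" for s y
  proof -
    have "r (scale s y) / s \<le> r y"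
    proof (rule r_ge)
      fix t v assume t: "0 \<le> (t::real)" "v \<in> V"
      have "r (scale s y) \<le> p (scale s y + scale (s * t) v) - (s * t) * d"
        using r_le[of "scale s y" "s * t" v] s t y by simp
      also have "scale s y + scale (s * t) v = scale s (y + scale t v)"
        by (simp add: scale_right_distrib)
      also have "p \<dots> = s * p (y + scale t v)"
        using s t y V by (intro sublinear_onD[OF p]) auto
      finally show "r (scale s y) / s \<le> p (y + scale t v) - t * d"
        using s by (simp add: field_simps)
    qed
    then show ?thesis using s by (simp add: field_simps)
  qed
  have "sublinear_on r"
    unfolding sublinear_on_def
  proof (intro conjI ballI allI impI)
    fix s :: real and y assume s: "0 \<le> s" and y: "y \<in> X"
    have p0: "p 0 = 0" using p by (rule sublinear_onD)
    show "r (scale s y) = s * r y"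
    proof (cases "s = 0")
      case True
      have "r 0 \<le> 0" using r_p[of 0] p0 by simp
      moreover have "0 \<le> r 0"
        using A_ge[of 0] p0 unfolding r_def by (intro cInf_greatest A_ne) auto
      ultimately show ?thesis using True by simp
    next
      case False
      with s have s': "0 < s" by simp
      have "r y \<le> (1/s) * r (scale s y)"
        using scale_le[of "1/s" "scale s y"] s' y by simp
      then show ?thesis
        using scale_le[OF s' y] s' by (intro antisym) (simp_all add: field_simps)
    qed
  qed (use add in auto)
  moreover have "r (- v) \<le> - d" if "v \<in> V" for v
    using r_le[of "- v" 1 v] that V sublinear_onD(3)[OF p] by auto
  ultimately show ?thesis using r_p that by blast
qed

text \<open>Tilting \<open>q\<close> at the singleton \<open>{x}\<close> with \<open>d = q x\<close>
  gives \<open>r \<le> q\<close> with \<open>r (- x) \<le> - q x\<close>. Minimality forces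
  \<open>r = q\<close> on \<open>X\<close>, so \<open>q\<close> is odd, and an odd sublinear
  functional is linear.\<close>

lemma minimal_sublinear_linear:
  assumes q: "sublinear_on q"
    and min: "\<And>r x. sublinear_on r \<Longrightarrow> (\<And>x. x \<in> X \<Longrightarrow> r x \<le> q x) \<Longrightarrow> x \<in> X \<Longrightarrow> r x = q x"
  shows "linear_on q"
proof -
  have neg: "q (- x) = - q x" if x: "x \<in> X" for x
  proof (rule antisym)
    have "convex_in scale {x}"
      by (simp add: convex_in_def flip: scale_left_distrib)
    then obtain r where r: "sublinear_on r" "\<And>x. x \<in> X \<Longrightarrow> r x \<le> q x" "r (- x) \<le> - q x"
      using sublinear_on_tilt[OF q, of "{x}" "q x"] x by auto
    then show "q (- x) \<le> - q x"
      using min[OF r(1,2), of "- x"] x by simp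
    show "- q x \<le> q (- x)"
      using sublinear_onD(4)[OF q x] by simp
  qed
  show ?thesis
    unfolding linear_on_def
  proof (intro conjI ballI allI)
    fix x y assume xy: "x \<in> X" "y \<in> X"
    have "q x \<le> q (x + y) + q (- y)"
      using sublinear_onD(1)[OF q, of "x + y" "- y"] xy by simp
    then show "q (x + y) = q x + q y"
      using sublinear_onD(1)[OF q xy] neg xy by simp
  next
    fix c x assume x: "x \<in> X"
    show "q (scale c x) = c * q x"
    proof (cases "0 \<le> c")
      case True then show ?thesis using q x by (simp add: sublinear_onD)
    next
      case False
      then have "q (scale (- c) x) = - c * q x"
        using q x by (intro sublinear_onD) auto
      moreover have "scale c x = - scale (- c) x" by simp
      ultimately show ?thesis using neg[of "scale (- c) x"] x by (simp del: scale_minus_left)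
    qed
  qed
qed

text \<open>A minimal sublinear functional below the tilt is linear. A singleton \<open>V\<close>
  yields norming functionals; the differences between a point and a span yield the distance to that
  span.\<close>

lemma separation:
  assumes p: "sublinear_on p" and V: "V \<subseteq> X" "V \<noteq> {}" "convex_in scale V"
    and d: "\<And>v. v \<in> V \<Longrightarrow> d \<le> p v"
  obtains \<phi> where "\<phi> \<in> dominated p" "\<And>v. v \<in> V \<Longrightarrow> d \<le> \<phi> v"
proof -
  obtain r where r: "sublinear_on r" "\<And>x. x \<in> X \<Longrightarrow> r x \<le> p x" "\<And>v. v \<in> V \<Longrightarrow> r (- v) \<le> - d"
    using sublinear_on_tilt[OF p V d] by blast
  obtain \<phi> where \<phi>: "sublinear_on \<phi>" "\<And>x. x \<in> X \<Longrightarrow> \<phi> x \<le> r x"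
    "\<And>q x. sublinear_on q \<Longrightarrow> (\<And>x. x \<in> X \<Longrightarrow> q x \<le> \<phi> x) \<Longrightarrow> x \<in> X \<Longrightarrow> q x = \<phi> x"
    using minimal_sublinear_exists[OF r(1)] by blast
  have lin: "linear_on \<phi>"
    using minimal_sublinear_linear \<phi>(1,3) by blast
  show ?thesis
  proof (rule that)
    show "\<phi> \<in> dominated p"
      using lin \<phi>(2) r(2) by (auto simp: dominated_def intro: order_trans)
    fix v assume "v \<in> V"
    then show "d \<le> \<phi> v"
      using r(3)[of v] \<phi>(2)[of "- v"] linear_onD(4)[OF lin, of v] V by fastforce
  qed
qed

section \<open>Seminorms as suprema of dominated functionals\<close>

lemma sublinear_on_seminorm:
  assumes "seminorm_on scale X p"
  shows "sublinear_on p"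
  using assms by (auto simp: seminorm_on_def sublinear_on_def)

lemma seminorm_minus:
  assumes "seminorm_on scale X p" "x \<in> X" "y \<in> X"
  shows "p (x - y) = p (y - x)"
proof -
  have "p (scale (-1) (x - y)) = norm (-1::real) * p (x - y)"
    using assms unfolding seminorm_on_def by (meson X_diff)
  then show ?thesis by simp
qed

lemma norming_functional:
  assumes p: "sublinear_on p" and x: "x \<in> X"
  obtains \<phi> where "\<phi> \<in> dominated p" "\<phi> x = p x"
proof -
  have "convex_in scale {x}"
    by (simp add: convex_in_def flip: scale_left_distrib)
  then obtain \<phi> where "\<phi> \<in> dominated p" "p x \<le> \<phi> x"
    using separation[OF p, of "{x}" "p x"] x by auto
  then show ?thesis
    using x that by (force simp: dominated_def)
qed

lemma dominated_abs:
  assumes p: "seminorm_on scale X p" and \<phi>: "\<phi> \<in> dominated p" and x: "x \<in> X" "y \<in> X"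
  shows "\<bar>\<phi> x - \<phi> y\<bar> \<le> p (x - y)"
proof -
  have "\<phi> (x - y) \<le> p (x - y)" "\<phi> (y - x) \<le> p (y - x)"
    using \<phi> x by (auto simp: dominated_def)
  then show ?thesis
    using \<phi> x seminorm_minus[OF p x] by (simp add: dominated_def linear_onD abs_le_iff)
qed

text \<open>Since \<open>p\<close> is the supremum of its dominated functionals, it suffices to
  treat them one at a time, with auxiliary choices depending on the functional.\<close>

lemma seminorm_diff_leI:
  assumes p: "seminorm_on scale X p" and x: "x \<in> X" "y \<in> X"
    and le: "\<And>\<phi>. \<phi> \<in> dominated p \<Longrightarrow> \<phi> x - \<phi> y \<le> r"
  shows "p (x - y) \<le> r"
proof -
  obtain \<phi> where "\<phi> \<in> dominated p" "\<phi> (x - y) = p (x - y)"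
    using norming_functional[OF sublinear_on_seminorm[OF p], of "x - y"] x by auto
  then show ?thesis using le[of \<phi>] x by (simp add: dominated_def linear_onD)
qed

end

section \<open>Almost periodic functions and means\<close>

lemma complete_UNIV_bcontfun:
  "complete (UNIV :: ('a::topological_space \<Rightarrow>\<^sub>C 'b::complete_space) set)"
  unfolding complete_def
proof safe
  fix f :: "nat \<Rightarrow> ('a \<Rightarrow>\<^sub>C 'b)"
  assume "Cauchy f"
  then obtain g where "uniform_limit UNIV f g sequentially"
    using uniformly_convergent_eq_cauchy[of "\<lambda>_. True" f]
    unfolding Cauchy_def uniform_limit_sequentially_iff
    by (metis dist_fun_lt_imp_dist_val_lt)
  then obtain l where "f \<longlonglongrightarrow> l"
    by (elim uniform_limit_bcontfunE[OF _ sequentially_bot])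
  then show "\<exists>l\<in>UNIV. f \<longlonglongrightarrow> l" by blast
qed

lemma apply_bcontfun_continuous: "continuous_on UNIV (apply_bcontfun f)"
  using apply_bcontfun[of f] by (simp add: bcontfun_def)

lemma left_translate_left_translate [simp]:
  "left_translate t (left_translate s f) = left_translate (s * t) f"
  by (rule bcontfun_eqI) (simp add: mult.assoc)

lemma left_translate_add: "left_translate s (f + g) = left_translate s f + left_translate s g"
  by (rule bcontfun_eqI) simp

lemma left_translate_cscale: "left_translate s (cscale c f) = cscale c (left_translate s f)"
  by (rule bcontfun_eqI) simp

lemma norm_cscale [simp]: "norm (cscale c f) = cmod c * norm f"
proof -
  have le: "norm (cscale c f) \<le> cmod c * norm f" for c and f :: "'a \<Rightarrow>\<^sub>C complex"
    by (rule norm_bound) (simp add: norm_mult mult_left_mono norm_bounded)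
  show ?thesis
  proof (cases "c = 0")
    case True then show ?thesis using le[of c f] by simp
  next
    case False
    have "cscale (1/c) (cscale c f) = f"
      using False by (intro bcontfun_eqI) simp
    then have "norm f \<le> cmod (1/c) * norm (cscale c f)"
      using le[of "1/c" "cscale c f"] by simp
    then have "cmod c * norm f \<le> norm (cscale c f)"
      using False by (simp add: norm_divide field_simps)
    then show ?thesis using le[of c f] by simp
  qed
qed

text \<open>Translates of equal colour are uniformly close, so one translate per colour forms a
  finite net of the orbit. The colour type is free; in the application a colour is a table of
  integers.\<close>

lemma almost_periodicI:
  fixes f :: "'s::semitopological_semigroup \<Rightarrow>\<^sub>C complex"
  assumes "\<And>e. 0 < e \<Longrightarrow> \<exists>L :: 's \<Rightarrow> 'l. finite (range L) \<and>
     (\<forall>s s'. L s = L s' \<longrightarrow> (\<forall>t. cmod (apply_bcontfun f (s * t) - apply_bcontfun f (s' * t)) \<le> e))"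
  shows "f \<in> almost_periodic"
proof -
  let ?O = "range (\<lambda>s. left_translate s f)"
  have "\<exists>k. finite k \<and> closure ?O \<subseteq> (\<Union>x\<in>k. ball x e)" if e: "0 < e" for e
  proof -
    obtain L :: "'s \<Rightarrow> 'l" where L: "finite (range L)" "\<And>s s' t. L s = L s' \<Longrightarrow>
        cmod (apply_bcontfun f (s * t) - apply_bcontfun f (s' * t)) \<le> e / 2"
      using assms[of "e/2"] e by auto
    define k where "k = (\<lambda>l. left_translate (inv L l) f) ` range L"
    have "?O \<subseteq> (\<Union>x\<in>k. cball x (e/2))"
    proof safe
      fix s
      have "L (inv L (L s)) = L s" by (simp add: f_inv_into_f)
      then have "dist (left_translate (inv L (L s)) f) (left_translate s f) \<le> e / 2"
        using L(2) by (intro dist_bound) (simp add: dist_norm)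
      then show "left_translate s f \<in> (\<Union>x\<in>k. cball x (e/2))"
        by (auto simp: k_def)
    qed
    moreover have k: "finite k" using L(1) by (simp add: k_def)
    \<comment> \<open>Finitely many closed balls form a closed set, so the net survives the passage
      to the closure; the halved radius then leads back to open balls.\<close>
    ultimately have "closure ?O \<subseteq> (\<Union>x\<in>k. cball x (e/2))"
      by (intro closure_minimal) auto
    also have "\<dots> \<subseteq> (\<Union>x\<in>k. ball x e)"
      using e by fastforce
    finally show ?thesis using k by blast
  qed
  moreover have "complete (closure ?O)"
    using complete_closed_subset[OF closed_closure subset_UNIV complete_UNIV_bcontfun] .
  ultimately show ?thesis
    by (simp add: almost_periodic_def compact_eq_totally_bounded)
qed

text \<open>With an arbitrary compact superset of the orbit, stability under sums and scalars
  reduces to continuous images of compact sets.\<close>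

lemma almost_periodic_iff:
  "f \<in> almost_periodic \<longleftrightarrow> (\<exists>C. compact C \<and> (\<forall>s. left_translate s f \<in> C))"
proof
  assume "f \<in> almost_periodic"
  then show "\<exists>C. compact C \<and> (\<forall>s. left_translate s f \<in> C)"
    using closure_subset[of "range (\<lambda>s. left_translate s f)"]
    by (intro exI[of _ "closure (range (\<lambda>s. left_translate s f))"])
      (auto simp: almost_periodic_def)
next
  assume "\<exists>C. compact C \<and> (\<forall>s. left_translate s f \<in> C)"
  then obtain C where C: "compact C" "range (\<lambda>s. left_translate s f) \<subseteq> C" by auto
  then have "closure (range (\<lambda>s. left_translate s f)) \<subseteq> C"
    by (intro closure_minimal compact_imp_closed)
  then show "f \<in> almost_periodic"
    unfolding almost_periodic_def using compact_Int_closed[OF C(1) closed_closure, of "range (\<lambda>s. left_translate s f)"]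
    by (simp add: inf.absorb2)
qed

lemma almost_periodic_left_translate [simp]:
  "f \<in> almost_periodic \<Longrightarrow> left_translate s f \<in> almost_periodic"
  unfolding almost_periodic_iff by auto

lemma almost_periodic_add [simp]:
  assumes "f \<in> almost_periodic" "g \<in> almost_periodic"
  shows "f + g \<in> almost_periodic"
proof -
  obtain C D where "compact C" "compact D" "\<And>s. left_translate s f \<in> C" "\<And>s. left_translate s g \<in> D"
    using assms unfolding almost_periodic_iff by blast
  then show ?thesis
    unfolding almost_periodic_iff left_translate_add
    by (intro exI[of _ "{x + y |x y. x \<in> C \<and> y \<in> D}"]) (auto intro: compact_sums)
qed

lemma continuous_on_cscale: "continuous_on A (cscale c)"
proof (rule continuous_onI)
  fix f :: "'a \<Rightarrow>\<^sub>C complex" and e :: real assume e: "0 < e"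
  show "\<exists>d>0. \<forall>g\<in>A. dist g f < d \<longrightarrow> dist (cscale c g) (cscale c f) \<le> e"
  proof (intro exI conjI ballI impI)
    show "0 < e / (cmod c + 1)" using e by (simp add: add_nonneg_pos)
    fix g assume g: "dist g f < e / (cmod c + 1)"
    have "cscale c g - cscale c f = cscale c (g - f)"
      by (rule bcontfun_eqI) (simp add: algebra_simps)
    then have "dist (cscale c g) (cscale c f) = cmod c * dist g f"
      by (simp add: dist_norm)
    also have "\<dots> \<le> (cmod c + 1) * (e / (cmod c + 1))"
      using g by (intro mult_mono) auto
    also have "\<dots> = e"
      by (simp add: add_nonneg_pos less_imp_neq[symmetric])
    finally show "dist (cscale c g) (cscale c f) \<le> e" .
  qed
qed

lemma almost_periodic_cscale [simp]:
  assumes "f \<in> almost_periodic"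
  shows "cscale c f \<in> almost_periodic"
proof -
  obtain C where "compact C" "\<And>s. left_translate s f \<in> C"
    using assms unfolding almost_periodic_iff by blast
  then show ?thesis
    unfolding almost_periodic_iff left_translate_cscale
    by (intro exI[of _ "cscale c ` C"]) (auto intro: compact_continuous_image continuous_on_cscale)
qed

lemma left_translate_const [simp]: "left_translate s (const_bcontfun c) = const_bcontfun c"
  by (rule bcontfun_eqI) (simp add: const_bcontfun.rep_eq)

lemma almost_periodic_const [simp]: "const_bcontfun c \<in> almost_periodic"
  unfolding almost_periodic_iff by (intro exI[of _ "{const_bcontfun c}"]) auto

lemma almost_periodic_sum:
  fixes f :: "'i \<Rightarrow> ('s::semitopological_semigroup \<Rightarrow>\<^sub>C complex)"
  assumes "\<And>i. i \<in> A \<Longrightarrow> f i \<in> almost_periodic"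
  shows "(\<Sum>i\<in>A. f i) \<in> almost_periodic"
proof -
  have "(0 :: 's \<Rightarrow>\<^sub>C complex) = const_bcontfun 0"
    by (rule bcontfun_eqI) (simp add: const_bcontfun.rep_eq)
  then have "(0 :: 's \<Rightarrow>\<^sub>C complex) \<in> almost_periodic"
    using almost_periodic_const[of 0] by metis
  then show ?thesis
    using assms by (induction A rule: infinite_finite_induct) auto
qed

lemma continuous_on_apply_bcontfun: "continuous_on A (\<lambda>h. apply_bcontfun h t)"
proof (rule continuous_onI)
  fix h :: "'a \<Rightarrow>\<^sub>C 'b" and e :: real assume "0 < e"
  then show "\<exists>d>0. \<forall>g\<in>A. dist g h < d \<longrightarrow> dist (apply_bcontfun g t) (apply_bcontfun h t) \<le> e"
    by (intro exI[of _ e]) (auto intro: order_trans[OF dist_bounded])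
qed

text \<open>Separate continuity of multiplication gives only pointwise continuity in
  \<open>s\<close>. All translates lie in one compact set, however, and there finitely many
  evaluations control the norm distance from \<open>g\<close>.\<close>

lemma continuous_left_translate:
  assumes "f \<in> almost_periodic"
  shows "continuous_on UNIV (\<lambda>s. left_translate s f)"
  unfolding continuous_on_def
proof (intro ballI tendstoI)
  fix s0 :: 'a and e :: real assume e: "0 < e"
  obtain C where C: "compact C" "\<And>s. left_translate s f \<in> C"
    using assms unfolding almost_periodic_iff by auto
  define g where "g = left_translate s0 f"
  \<comment> \<open>\<open>O' (t, d)\<close> collects the functions told apart from \<open>g\<close>
    at \<open>t\<close> by more than \<open>d\<close>; such sets cover the part of \<open>C\<close>
    outside the ball.\<close>
  define O' where "O' = (\<lambda>(t, d). {h. d < cmod (apply_bcontfun h t - apply_bcontfun g t)})"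
  have "open (O' w)" for w
    unfolding O'_def by (cases w)
      (auto intro!: open_Collect_less continuous_intros continuous_on_apply_bcontfun)
  moreover have "C - ball g e \<subseteq> (\<Union>w\<in>UNIV \<times> {0<..}. O' w)"
  proof
    fix h assume "h \<in> C - ball g e"
    then have "h \<noteq> g" using e by auto
    then obtain t where "apply_bcontfun h t \<noteq> apply_bcontfun g t"
      by (metis bcontfun_eqI)
    then have "h \<in> O' (t, cmod (apply_bcontfun h t - apply_bcontfun g t) / 2)"
      "0 < cmod (apply_bcontfun h t - apply_bcontfun g t) / 2"
      by (auto simp: O'_def)
    then show "h \<in> (\<Union>w\<in>UNIV \<times> {0<..}. O' w)" by (intro UN_I) auto
  qed
  ultimately obtain D where D: "D \<subseteq> UNIV \<times> {0<..}" "finite D" "C - ball g e \<subseteq> (\<Union>w\<in>D. O' w)"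
    using compactE_image[OF compact_diff[OF C(1) open_ball]] by metis
  define N where
    "N = (\<Inter>w\<in>D. {s. cmod (apply_bcontfun f (s * fst w) - apply_bcontfun f (s0 * fst w)) < snd w})"
  have cont: "continuous_on UNIV (\<lambda>s. apply_bcontfun f (s * t))" for t
    using continuous_on_compose2[OF apply_bcontfun_continuous continuous_mult_right] by simp
  have "open N"
    unfolding N_def using D(2)
    by (intro open_INT ballI open_Collect_less continuous_intros cont)
  moreover have "s0 \<in> N" using D(1) by (auto simp: N_def)
  moreover have "dist (left_translate s f) g < e" if s: "s \<in> N" for s
  proof (rule ccontr)
    assume "\<not> ?thesis"
    then have "left_translate s f \<in> C - ball g e"
      using C(2) by (simp add: dist_commute)
    then obtain w where "w \<in> D" "left_translate s f \<in> O' w" using D(3) by blast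
    then show False using s by (auto simp: N_def O'_def g_def split: prod.splits)
  qed
  ultimately show "\<forall>\<^sub>F s in at s0 within UNIV. dist (left_translate s f) (left_translate s0 f) < e"
    unfolding eventually_at_topological g_def by blast
qed

lemma norm_left_translate_le: "norm (left_translate s f) \<le> norm f"
  by (rule norm_bound) (simp add: norm_bounded)

lemma almost_periodic_diff [simp]:
  assumes "f \<in> almost_periodic" "g \<in> almost_periodic"
  shows "f - g \<in> almost_periodic"
proof -
  have eq: "f - g = f + cscale (-1) g" by (rule bcontfun_eqI) simp
  show ?thesis unfolding eq by (intro almost_periodic_add almost_periodic_cscale assms)
qed

section \<open>Norm estimates for means\<close>

lemma mean_norm_le:
  assumes "left_invariant_mean Y \<mu>" "f \<in> Y" "\<And>c f. f \<in> Y \<Longrightarrow> cscale c f \<in> Y"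
  shows "cmod (\<mu> f) \<le> norm f"
proof -
  have \<mu>: "bounded_functional_on Y \<mu>" "dual_norm Y \<mu> = 1"
    using assms(1) by (auto simp: left_invariant_mean_def)
  obtain B where B: "\<And>f. f \<in> Y \<Longrightarrow> cmod (\<mu> f) \<le> B * norm f"
    using \<mu>(1) unfolding bounded_functional_on_def by blast
  have le1: "cmod (\<mu> g) \<le> 1" if "g \<in> Y" "norm g \<le> 1" for g
  proof -
    have "cmod (\<mu> h) \<le> \<bar>B\<bar>" if "h \<in> Y" "norm h \<le> 1" for h
      using B[OF that(1)] that(2) mult_mono[of B "\<bar>B\<bar>" "norm h" 1] by (simp, linarith)
    \<comment> \<open>A real \<open>SUP\<close> bounds its members only over a set that is bounded
      above; the bound \<open>B\<close> provides that.\<close>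
    then have "bdd_above ((\<lambda>f. cmod (\<mu> f)) ` {f \<in> Y. norm f \<le> 1})"
      by (intro bdd_aboveI2) auto
    then have "cmod (\<mu> g) \<le> dual_norm Y \<mu>"
      unfolding dual_norm_def using that by (intro cSUP_upper) auto
    then show ?thesis using \<mu>(2) by simp
  qed
  show ?thesis
  proof (cases "f = 0")
    case True
    then show ?thesis using B[OF assms(2)] by simp
  next
    case False
    let ?c = "complex_of_real (1 / norm f)"
    have "cmod (\<mu> (cscale ?c f)) \<le> 1"
      using False assms by (intro le1) (auto simp: norm_divide)
    moreover have "\<mu> (cscale ?c f) = ?c * \<mu> f"
      using \<mu>(1) assms(2) by (auto simp: bounded_functional_on_def)
    ultimately have "cmod (\<mu> f) / norm f \<le> 1"
      by (simp add: norm_divide)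
    then show ?thesis
      using False by (simp add: divide_le_eq)
  qed
qed

text \<open>The mean of a function with values in \<open>[\<eta>, M]\<close> has distance at most \<open>M - \<eta>\<close> from \<open>M\<close>.\<close>

lemma mean_nonzero:
  fixes f :: "'s::semitopological_semigroup \<Rightarrow>\<^sub>C complex"
  assumes \<mu>: "left_invariant_mean almost_periodic \<mu>" and f: "f \<in> almost_periodic"
    and h: "\<And>t. apply_bcontfun f t = complex_of_real (h t)" "\<And>t. \<eta> \<le> h t" and \<eta>: "0 < \<eta>"
  shows "\<mu> f \<noteq> 0"
proof
  assume 0: "\<mu> f = 0"
  have lin: "\<mu> (f + g) = \<mu> f + \<mu> g" "\<mu> (cscale c f) = c * \<mu> f"
    if "f \<in> almost_periodic" "g \<in> almost_periodic" for f g c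
    using \<mu> that by (auto simp: left_invariant_mean_def bounded_functional_on_def)
  have le: "cmod (\<mu> g) \<le> norm g" if "g \<in> almost_periodic" for g
    using mean_norm_le[OF \<mu> that] by simp
  define M where "M = norm f"
  let ?g = "cscale (of_real M) (const_bcontfun 1) + cscale (-1) f"
  have hM: "h t \<le> M" for t
    using norm_bounded[of f t] h(1)[of t] by (simp add: M_def)
  have "\<eta> \<le> M" using hM h(2) order_trans by blast
  have "norm ?g \<le> M - \<eta>"
  proof (rule norm_bound)
    fix t
    have "apply_bcontfun ?g t = complex_of_real (M - h t)"
      by (simp add: h(1) const_bcontfun.rep_eq)
    then have "cmod (apply_bcontfun ?g t) = \<bar>M - h t\<bar>"
      by (metis norm_of_real)
    then show "cmod (apply_bcontfun ?g t) \<le> M - \<eta>"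
      using hM[of t] h(2)[of t] by simp
  qed
  moreover have "\<mu> ?g = of_real M"
    using f 0 \<mu> by (simp add: lin left_invariant_mean_def)
  ultimately have "M \<le> M - \<eta>"
    using le[of ?g] f \<open>\<eta> \<le> M\<close> \<eta> by simp
  then show False using \<eta> by simp
qed

section \<open>Nonexpansive systems on weakly compact sets\<close>

text \<open>Zorn's lemma is applied to complements, so that chains are bounded by unions.
  Compactness keeps the intersection of a chain nonempty, which is why \<open>Int\<close> speaks of
  nonempty intersections only.\<close>

lemma minimal_closed_set:
  assumes T: "compact_space T" and ne: "\<A> \<noteq> {}"
    and cl: "\<And>C. C \<in> \<A> \<Longrightarrow> closedin T C \<and> C \<noteq> {}"
    and Int: "\<And>\<C>. \<C> \<subseteq> \<A> \<Longrightarrow> \<C> \<noteq> {} \<Longrightarrow> \<Inter>\<C> \<noteq> {} \<Longrightarrow> \<Inter>\<C> \<in> \<A>"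
  obtains M where "M \<in> \<A>" "\<And>C. C \<in> \<A> \<Longrightarrow> C \<subseteq> M \<Longrightarrow> C = M"
proof -
  have "\<Union>\<D> \<in> uminus ` \<A>" if \<D>: "\<D> \<noteq> {}" "subset.chain (uminus ` \<A>) \<D>" for \<D>
  proof -
    define \<C> where "\<C> = uminus ` \<D>"
    have \<C>: "\<C> \<subseteq> \<A>" "\<C> \<noteq> {}" "\<And>B C. B \<in> \<C> \<Longrightarrow> C \<in> \<C> \<Longrightarrow> B \<subseteq> C \<or> C \<subseteq> B"
      using \<D> by (auto simp: \<C>_def subset_chain_def)
    have "\<Inter>\<F> \<noteq> {}" if "finite \<F>" "\<F> \<subseteq> \<C>" for \<F>
    proof (cases "\<F> = {}")
      case False
      have "subset.chain \<C> \<F>"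
        using that \<C>(3) by (fastforce simp: subset_chain_def)
      then have "\<Inter>\<F> \<in> \<F>"
        using that False by (intro Inter_in_chain)
      then have "\<Inter>\<F> \<in> \<A>"
        using that \<C>(1) by auto
      then show ?thesis
        using cl by simp
    qed simp
    moreover have "\<forall>C\<in>\<C>. closedin T C"
      using \<C>(1) cl by auto
    ultimately have "\<Inter>\<C> \<noteq> {}"
      using T[unfolded compact_space_fip, rule_format, of \<C>] by auto
    then have "\<Inter>\<C> \<in> \<A>"
      using Int[OF \<C>(1,2)] by simp
    moreover have "\<Union>\<D> = - \<Inter>\<C>"
      by (auto simp: \<C>_def)
    ultimately show ?thesis by blast
  qed
  then have "\<exists>M\<in>uminus ` \<A>. \<forall>X\<in>uminus ` \<A>. M \<subseteq> X \<longrightarrow> X = M"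
    using ne by (intro subset_Zorn_nonempty) auto
  then obtain M where "M \<in> \<A>" "\<forall>C\<in>\<A>. - M \<subseteq> - C \<longrightarrow> - C = - M"
    by auto
  then show ?thesis
    using that[of M] by simp
qed

text \<open>In the application \<open>T\<close> is the relative weak topology on \<open>K\<close>.
  Functionals enter only as real-linear ones dominated by a member of \<open>Q\<close>, so real and
  complex spaces are treated at once.\<close>

locale nonexpansive_system = real_subspace scale X
  for scale :: "real \<Rightarrow> 'x::ab_group_add \<Rightarrow> 'x" and X +
  fixes Q :: "('x \<Rightarrow> real) set" and K :: "'x set" and T :: "'x topology"
    and act :: "'s::semitopological_semigroup \<Rightarrow> 'x \<Rightarrow> 'x"
  assumes seminorm: "p \<in> Q \<Longrightarrow> seminorm_on scale X p"
    and separated: "x \<in> X \<Longrightarrow> (\<And>p. p \<in> Q \<Longrightarrow> p x = 0) \<Longrightarrow> x = 0"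
    and K_subset: "K \<subseteq> X" and K_nonempty: "K \<noteq> {}" and K_convex: "convex_in scale K"
    and topspace_T [simp]: "topspace T = K" and compact_T: "compact_space T"
    and continuous_dominated: "p \<in> Q \<Longrightarrow> \<phi> \<in> dominated p \<Longrightarrow> continuous_map T euclideanreal \<phi>"
    and equicontinuous: "p \<in> Q \<Longrightarrow> \<phi> \<in> dominated p \<Longrightarrow> x \<in> K \<Longrightarrow> 0 < e \<Longrightarrow>
      \<exists>V. openin T V \<and> x \<in> V \<and> (\<forall>s. \<forall>y\<in>V. \<bar>\<phi> (act s y) - \<phi> (act s x)\<bar> < e)"
    and dynamical: "dynamical_system act T"
    and nonexpansive: "nonexpansive_action Q act K"
begin

definition weak_functionals :: "('x \<Rightarrow> real) set" where "weak_functionals = (\<Union>p\<in>Q. dominated p)"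

definition invariant :: "'x set \<Rightarrow> bool" where "invariant C \<longleftrightarrow> (\<forall>s. act s ` C \<subseteq> C)"

definition minimal_invariant :: "'x set \<Rightarrow> bool" where
  "minimal_invariant F \<longleftrightarrow> closedin T F \<and> F \<noteq> {} \<and> invariant F \<and>
     (\<forall>C. closedin T C \<longrightarrow> C \<noteq> {} \<longrightarrow> invariant C \<longrightarrow> C \<subseteq> F \<longrightarrow> C = F)"

lemma K_X [simp]: "x \<in> K \<Longrightarrow> x \<in> X"
  using K_subset by blast

lemma act_K [simp]: "x \<in> K \<Longrightarrow> act s x \<in> K"
  and act_act [simp]: "x \<in> K \<Longrightarrow> act s (act t x) = act (s * t) x"
  and continuous_orbit: "x \<in> K \<Longrightarrow> continuous_map euclidean T (\<lambda>s. act s x)"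
  and continuous_act: "continuous_map T T (act s)"
  using dynamical by (auto simp: dynamical_system_def)

lemma act_le: "p \<in> Q \<Longrightarrow> x \<in> K \<Longrightarrow> y \<in> K \<Longrightarrow> p (act s x - act s y) \<le> p (x - y)"
  using nonexpansive by (auto simp: nonexpansive_action_def)

lemma continuous_weak_functional: "\<phi> \<in> weak_functionals \<Longrightarrow> continuous_map T euclideanreal \<phi>"
  using continuous_dominated by (auto simp: weak_functionals_def)

lemma seminorm_triangle:
  assumes "p \<in> Q" "x \<in> X" "y \<in> X" "z \<in> X"
  shows "p (x - z) \<le> p (x - y) + p (y - z)"
proof -
  have "p ((x - y) + (y - z)) \<le> p (x - y) + p (y - z)"
    using seminorm[OF assms(1)] assms unfolding seminorm_on_def by (meson X_diff)
  moreover have "(x - y) + (y - z) = x - z" by (simp add: algebra_simps)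
  ultimately show ?thesis by simp
qed

lemma seminorm_nonneg: "p \<in> Q \<Longrightarrow> x \<in> X \<Longrightarrow> 0 \<le> p x"
  using seminorm[of p] by (auto simp: seminorm_on_def)

lemma seminorm_zero: "p \<in> Q \<Longrightarrow> p 0 = 0"
  using sublinear_onD(3)[OF sublinear_on_seminorm[OF seminorm]] .

lemma weak_functionals_separate:
  assumes "x \<in> K" "y \<in> K" "x \<noteq> y"
  shows "\<exists>\<phi>\<in>weak_functionals. \<phi> x \<noteq> \<phi> y"
proof -
  obtain p where p: "p \<in> Q" "p (x - y) \<noteq> 0"
    using separated[of "x - y"] assms by auto
  obtain \<phi> where \<phi>: "\<phi> \<in> dominated p" "\<phi> (x - y) = p (x - y)"
    using norming_functional[OF sublinear_on_seminorm[OF seminorm[OF p(1)]], of "x - y"] assms by auto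
  then have "\<phi> x \<noteq> \<phi> y"
    using p assms by (auto simp: dominated_def linear_onD)
  then show ?thesis using p \<phi> by (auto simp: weak_functionals_def)
qed

lemma closedin_le: "continuous_map T euclideanreal f \<Longrightarrow> closedin T {x \<in> K. f x \<le> c}"
  using closedin_continuous_map_preimage[of T euclideanreal f "{..c}"] by simp

lemma closedin_ge: "continuous_map T euclideanreal f \<Longrightarrow> closedin T {x \<in> K. c \<le> f x}"
  using closedin_continuous_map_preimage[of T euclideanreal f "{c..}"] by simp

lemma openin_less: "continuous_map T euclideanreal f \<Longrightarrow> openin T {x \<in> K. f x < c}"
  using openin_continuous_map_preimage[of T euclideanreal f "{..<c}"] by simp

lemma openin_greater: "continuous_map T euclideanreal f \<Longrightarrow> openin T {x \<in> K. c < f x}"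
  using openin_continuous_map_preimage[of T euclideanreal f "{c<..}"] by simp

lemma compact_image:
  assumes "continuous_map T euclideanreal f" "compactin T C"
  shows "compact (f ` C)"
  using image_compactin[OF assms(2,1)] by simp

lemma finite_subcover:
  assumes "compactin T C" "\<And>i. i \<in> I \<Longrightarrow> openin T (V i)" "C \<subseteq> (\<Union>i\<in>I. V i)"
  obtains J where "finite J" "J \<subseteq> I" "C \<subseteq> (\<Union>i\<in>J. V i)"
proof -
  obtain \<F> where "finite \<F>" "\<F> \<subseteq> V ` I" "C \<subseteq> \<Union>\<F>"
    using compactinD[OF assms(1), of "V ` I"] assms(2,3) by auto
  then show ?thesis
    using finite_subset_image[of \<F> V I] that by metis
qed

lemma compactin_K: "compactin T K"
  using compact_T by (simp add: compact_space_def)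

lemma closedin_subset_K: "closedin T C \<Longrightarrow> C \<subseteq> K"
  using closedin_subset by fastforce

section \<open>Minimal invariant sets and their translations\<close>

text \<open>The closure of the orbit of \<open>z\<close> is closed, nonempty, and invariant because
  \<open>s (t z) = (s t) z\<close>; minimality makes it all of \<open>F\<close>. The orbit itself
  need not contain \<open>z\<close>, there being no identity.\<close>

lemma minimal_orbit:
  assumes F: "minimal_invariant F" and V: "openin T V" "V \<inter> F \<noteq> {}" and z: "z \<in> F"
  shows "\<exists>t. act t z \<in> V"
proof -
  let ?O = "range (\<lambda>t. act t z)"
  let ?C = "T closure_of ?O"
  have FK: "F \<subseteq> K" and cl: "closedin T F" and inv: "invariant F"
    using F closedin_subset_K by (auto simp: minimal_invariant_def)
  have zK: "z \<in> K" using z FK by auto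
  have OF: "?O \<subseteq> F" using inv z by (auto simp: invariant_def)
  have "act s ` ?C \<subseteq> ?C" for s
  proof -
    have "act s ` ?C \<subseteq> T closure_of (act s ` ?O)"
      by (rule continuous_map_image_closure_subset[OF continuous_act])
    also have "\<dots> \<subseteq> ?C"
      using zK by (intro closure_of_mono) auto
    finally show ?thesis .
  qed
  moreover have "?O \<subseteq> ?C"
    using OF FK by (intro closure_of_subset) auto
  moreover have "?C \<subseteq> F"
    using OF cl by (rule closure_of_minimal)
  moreover have "closedin T ?C" by simp
  ultimately have "?C = F"
    using F unfolding minimal_invariant_def invariant_def by (metis UNIV_not_empty image_is_empty subset_empty)
  then obtain v where "v \<in> V" "v \<in> ?C" using V by auto
  then show ?thesis
    using V(1) unfolding in_closure_of by blast
qed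

text \<open>Compactness makes the density of orbits uniform in \<open>z\<close>. It serves twice:
  for a sum of translates bounded away from 0, and for finite nets.\<close>

lemma minimal_finite_cover:
  assumes F: "minimal_invariant F" and V: "openin T V" "V \<inter> F \<noteq> {}"
  obtains A where "finite A" "\<And>z. z \<in> F \<Longrightarrow> \<exists>t\<in>A. act t z \<in> V"
proof -
  have cl: "closedin T F" using F by (simp add: minimal_invariant_def)
  have "F \<subseteq> (\<Union>t. {z \<in> K. act t z \<in> V})"
    using minimal_orbit[OF F V] closedin_subset_K[OF cl] by auto
  moreover have "openin T {z \<in> K. act t z \<in> V}" for t
    using openin_continuous_map_preimage[OF continuous_act V(1), of t] by simp
  ultimately obtain A where "finite A" "F \<subseteq> (\<Union>t\<in>A. {z \<in> K. act t z \<in> V})"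
    using finite_subcover[OF closedin_compact_space[OF compact_T cl],
        of UNIV "\<lambda>t. {z \<in> K. act t z \<in> V}"] by auto
  then show ?thesis using that[of A] by auto
qed

text \<open>Total boundedness of the translations in the uniform topology (the easy half of
  Arzela--Ascoli), in terms of a finite colouring of the semigroup.\<close>

lemma finite_colouring:
  assumes I: "finite I" "I \<subseteq> weak_functionals" and e: "0 < e"
  obtains L :: "'s \<Rightarrow> 'x \<times> ('x \<Rightarrow> real) \<Rightarrow> int" where "finite (range L)"
    "\<And>s s' z \<phi>. L s = L s' \<Longrightarrow> z \<in> K \<Longrightarrow> \<phi> \<in> I \<Longrightarrow> \<bar>\<phi> (act s z) - \<phi> (act s' z)\<bar> \<le> 3 * e"
proof -
  have "\<exists>V. openin T V \<and> x \<in> V \<and> (\<forall>\<phi>\<in>I. \<forall>s. \<forall>y\<in>V. \<bar>\<phi> (act s y) - \<phi> (act s x)\<bar> < e)"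
    if x: "x \<in> K" for x
    using I
  proof (induction I rule: finite_induct)
    case empty
    then show ?case using x openin_topspace[of T] by auto
  next
    case (insert \<phi> I)
    then obtain V where V: "openin T V" "x \<in> V"
      "\<forall>\<phi>\<in>I. \<forall>s. \<forall>y\<in>V. \<bar>\<phi> (act s y) - \<phi> (act s x)\<bar> < e" by auto
    obtain p where "p \<in> Q" "\<phi> \<in> dominated p" using insert.prems by (auto simp: weak_functionals_def)
    then obtain W where W: "openin T W" "x \<in> W" "\<forall>s. \<forall>y\<in>W. \<bar>\<phi> (act s y) - \<phi> (act s x)\<bar> < e"
      using equicontinuous[OF _ _ x e] by blast
    show ?case
      using V W by (intro exI[of _ "V \<inter> W"]) auto
  qed
  then obtain V where V: "\<And>x. x \<in> K \<Longrightarrow> openin T (V x)" "\<And>x. x \<in> K \<Longrightarrow> x \<in> V x"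
    "\<And>x \<phi> s y. x \<in> K \<Longrightarrow> \<phi> \<in> I \<Longrightarrow> y \<in> V x \<Longrightarrow> \<bar>\<phi> (act s y) - \<phi> (act s x)\<bar> < e"
    by metis
  have "K \<subseteq> (\<Union>x\<in>K. V x)" using V(2) by auto
  from finite_subcover[OF compactin_K V(1) this]
  obtain J where J: "finite J" "J \<subseteq> K" "K \<subseteq> (\<Union>x\<in>J. V x)" .
  have "\<exists>M. \<forall>z\<in>K. \<bar>\<phi> z\<bar> \<le> M" if "\<phi> \<in> I" for \<phi>
    using compact_imp_bounded[OF compact_image[OF continuous_weak_functional compactin_K, of \<phi>]] that I
    by (auto simp: bounded_iff)
  then obtain M where M: "\<And>\<phi> z. \<phi> \<in> I \<Longrightarrow> z \<in> K \<Longrightarrow> \<bar>\<phi> z\<bar> \<le> M \<phi>" by metis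
  \<comment> \<open>A colour tabulates \<open>\<phi> (act s x) / e\<close>, rounded down, at
    finitely many centres \<open>x\<close>. Equal colours differ by less than \<open>e\<close> at a
    centre; replacing \<open>z\<close> by a centre costs \<open>e\<close> for each of
    \<open>s\<close> and \<open>s'\<close>, whence the factor 3.\<close>
  define L where "L = (\<lambda>s. restrict (\<lambda>(x, \<phi>). \<lfloor>\<phi> (act s x) / e\<rfloor>) (J \<times> I))"
  have "range L \<subseteq> (\<Pi>\<^sub>E (x, \<phi>) \<in> J \<times> I. {\<lfloor>- M \<phi> / e\<rfloor>..\<lfloor>M \<phi> / e\<rfloor>})"
  proof (clarsimp simp: L_def PiE_iff)
    fix s x \<phi> assume "x \<in> J" "\<phi> \<in> I"
    then have "- M \<phi> \<le> \<phi> (act s x)" "\<phi> (act s x) \<le> M \<phi>"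
      using M[of \<phi> "act s x"] J by (auto simp: abs_le_iff)
    then show "\<lfloor>- (M \<phi> / e)\<rfloor> \<le> \<lfloor>\<phi> (act s x) / e\<rfloor> \<and> \<lfloor>\<phi> (act s x) / e\<rfloor> \<le> \<lfloor>M \<phi> / e\<rfloor>"
      using e by (intro conjI floor_mono) (simp_all add: divide_simps)
  qed
  moreover have "finite (\<Pi>\<^sub>E (x, \<phi>) \<in> J \<times> I. {\<lfloor>- M \<phi> / e\<rfloor>..\<lfloor>M \<phi> / e\<rfloor>})"
    using J I by (intro finite_PiE) auto
  ultimately have "finite (range L)" by (rule finite_subset)
  moreover have "\<bar>\<phi> (act s z) - \<phi> (act s' z)\<bar> \<le> 3 * e"
    if L: "L s = L s'" and z: "z \<in> K" and \<phi>: "\<phi> \<in> I" for s s' z \<phi>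
  proof -
    obtain x where x: "x \<in> J" "z \<in> V x" using J z by auto
    have "\<lfloor>\<phi> (act s x) / e\<rfloor> = \<lfloor>\<phi> (act s' x) / e\<rfloor>"
      using fun_cong[OF L, of "(x, \<phi>)"] x \<phi> by (simp add: L_def)
    then have "\<bar>\<phi> (act s x) / e - \<phi> (act s' x) / e\<bar> < 1" by linarith
    then have "\<bar>\<phi> (act s x) - \<phi> (act s' x)\<bar> < e"
      using e by (simp add: abs_less_iff field_simps)
    moreover have "\<bar>\<phi> (act s z) - \<phi> (act s x)\<bar> < e" "\<bar>\<phi> (act s' z) - \<phi> (act s' x)\<bar> < e"
      using V(3) x \<phi> J by auto
    ultimately show ?thesis by linarith
  qed
  ultimately show ?thesis by (rule that)
qed

text \<open>If \<open>act s\<close> missed a point of \<open>F\<close>, a continuous function vanishing on \<open>act s ` F\<close> but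
  not on \<open>F\<close> would have mean \<open>0\<close> along an orbit, while by minimality finitely many of its
  translates sum to a function bounded away from \<open>0\<close>.\<close>

lemma minimal_invariant_surj:
  assumes \<mu>: "left_invariant_mean (almost_periodic :: ('s \<Rightarrow>\<^sub>C complex) set) \<mu>"
    and F: "minimal_invariant F"
  shows "act s ` F = F"
proof (rule ccontr)
  assume "act s ` F \<noteq> F"
  have cl: "closedin T F" and inv: "\<And>s x. x \<in> F \<Longrightarrow> act s x \<in> F"
    using F by (auto simp: minimal_invariant_def invariant_def)
  then obtain x where x: "x \<in> F" "x \<notin> act s ` F" using \<open>act s ` F \<noteq> F\<close> by auto
  have FK: "F \<subseteq> K" using closedin_subset_K[OF cl] .
  have FK' [simp]: "z \<in> K" if "z \<in> F" for z using FK that by auto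
  have cF: "compactin T F" using closedin_compact_space[OF compact_T cl] .
  have csF: "compactin T (act s ` F)" using image_compactin[OF cF continuous_act] .
  have "openin T {z \<in> K. \<phi> z \<noteq> \<phi> x}" if "\<phi> \<in> weak_functionals" for \<phi>
    using openin_continuous_map_preimage[OF continuous_weak_functional[OF that], of "- {\<phi> x}"]
    by (simp add: open_Compl)
  moreover have "act s ` F \<subseteq> (\<Union>\<phi>\<in>weak_functionals. {z \<in> K. \<phi> z \<noteq> \<phi> x})"
  proof
    fix z assume z: "z \<in> act s ` F"
    then have "z \<in> K" "z \<noteq> x" using x by auto
    then show "z \<in> (\<Union>\<phi>\<in>weak_functionals. {z \<in> K. \<phi> z \<noteq> \<phi> x})"
      using weak_functionals_separate[of z x] x by auto
  qed
  ultimately obtain I where I: "finite I" "I \<subseteq> weak_functionals" "act s ` F \<subseteq> (\<Union>\<phi>\<in>I. {z \<in> K. \<phi> z \<noteq> \<phi> x})"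
    using finite_subcover[OF csF, of weak_functionals "\<lambda>\<phi>. {z \<in> K. \<phi> z \<noteq> \<phi> x}"] by blast
  \<comment> \<open>\<open>G\<close> measures the distance from \<open>x\<close> in finitely many
    functionals, chosen so that it is positive on the whole image of \<open>F\<close> under
    \<open>act s\<close>.\<close>
  define G where "G = (\<lambda>z. \<Sum>\<phi>\<in>I. \<bar>\<phi> z - \<phi> x\<bar>)"
  have G_cont: "continuous_map T euclideanreal G"
    unfolding G_def using I
    by (intro continuous_map_sum continuous_map_real_abs continuous_map_diff)
      (use continuous_weak_functional in auto)
  have "compact (G ` act s ` F)" using compact_image[OF G_cont csF] .
  then obtain w where w: "w \<in> act s ` F" "\<And>z. z \<in> act s ` F \<Longrightarrow> G w \<le> G z"
    using compact_attains_inf[of "G ` act s ` F"] x by auto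
  define \<epsilon> where "\<epsilon> = G w"
  have \<epsilon>: "0 < \<epsilon>"
  proof -
    obtain \<phi> where "\<phi> \<in> I" "\<phi> w \<noteq> \<phi> x" using I(3) w(1) by blast
    then show ?thesis
      unfolding \<epsilon>_def G_def using I by (intro sum_pos2[of I \<phi>]) auto
  qed
  \<comment> \<open>A bump at \<open>x\<close>: it equals \<epsilon> there and vanishes where
    \<open>G \<ge> \<epsilon>\<close>, in particular on the image of \<open>F\<close>.\<close>
  define g where "g = (\<lambda>z. max 0 (\<epsilon> - G z))"
  have g_cont: "continuous_map T euclideanreal g"
    unfolding g_def using G_cont by (intro continuous_map_real_max continuous_map_diff) auto
  have g_ge: "0 \<le> g z" and g_le: "g z \<le> \<epsilon>" for z
    using \<epsilon> sum_nonneg[of I "\<lambda>\<phi>. \<bar>\<phi> z - \<phi> x\<bar>"] by (auto simp: g_def G_def)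
  have g_x: "g x = \<epsilon>" using \<epsilon> by (simp add: g_def G_def)
  have g_0: "g z = 0" if "z \<in> act s ` F" for z
    using w(2)[OF that] by (simp add: g_def \<epsilon>_def)
  have g_lip: "\<bar>g z - g z'\<bar> \<le> (\<Sum>\<phi>\<in>I. \<bar>\<phi> z - \<phi> z'\<bar>)" for z z'
  proof -
    have "\<bar>g z - g z'\<bar> \<le> \<bar>G z - G z'\<bar>" by (auto simp: g_def)
    also have "G z - G z' = (\<Sum>\<phi>\<in>I. \<bar>\<phi> z - \<phi> x\<bar> - \<bar>\<phi> z' - \<phi> x\<bar>)"
      by (simp add: G_def sum_subtractf)
    also have "\<bar>\<dots>\<bar> \<le> (\<Sum>\<phi>\<in>I. \<bar>\<bar>\<phi> z - \<phi> x\<bar> - \<bar>\<phi> z' - \<phi> x\<bar>\<bar>)" by (rule sum_abs)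
    also have "\<dots> \<le> (\<Sum>\<phi>\<in>I. \<bar>\<phi> z - \<phi> z'\<bar>)" by (intro sum_mono) auto
    finally show ?thesis .
  qed
  define H where "H = Bcontfun (\<lambda>t. complex_of_real (g (act t x)))"
  have H: "apply_bcontfun H t = complex_of_real (g (act t x))" for t
  proof -
    have "continuous_map euclidean euclideanreal (g \<circ> (\<lambda>t. act t x))"
      using continuous_orbit[of x] x g_cont by (intro continuous_map_compose[of _ T]) auto
    then have "continuous_on UNIV (\<lambda>t. complex_of_real (g (act t x)))"
      by (intro continuous_on_of_real) (simp add: o_def)
    moreover have "bounded (range (\<lambda>t. complex_of_real (g (act t x))))"
      using g_ge g_le by (intro boundedI[of _ \<epsilon>]) auto
    ultimately show ?thesis
      by (simp add: H_def Bcontfun_inverse bcontfun_def)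
  qed
  have H_ap: "H \<in> almost_periodic"
  proof (rule almost_periodicI)
    fix e :: real assume e: "0 < e"
    \<comment> \<open>Each functional contributes \<open>3 * e'\<close> to the bound from
      \<open>g_lip\<close>; the added 1 keeps the denominator positive.\<close>
    define e' where "e' = e / (3 * (real (card I) + 1))"
    have e': "0 < e'" using e by (simp add: e'_def)
    obtain L :: "'s \<Rightarrow> 'x \<times> ('x \<Rightarrow> real) \<Rightarrow> int" where L: "finite (range L)"
      "\<And>s s' z \<phi>. L s = L s' \<Longrightarrow> z \<in> K \<Longrightarrow> \<phi> \<in> I \<Longrightarrow> \<bar>\<phi> (act s z) - \<phi> (act s' z)\<bar> \<le> 3 * e'"
      using finite_colouring[OF I(1,2) e'] by blast
    have "cmod (apply_bcontfun H (s * t) - apply_bcontfun H (s' * t)) \<le> e" if "L s = L s'" for s s' t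
    proof -
      have "cmod (apply_bcontfun H (s * t) - apply_bcontfun H (s' * t))
          = \<bar>g (act s (act t x)) - g (act s' (act t x))\<bar>"
        using x by (simp add: H flip: of_real_diff)
      also have "\<dots> \<le> (\<Sum>\<phi>\<in>I. \<bar>\<phi> (act s (act t x)) - \<phi> (act s' (act t x))\<bar>)"
        by (rule g_lip)
      also have "\<dots> \<le> (\<Sum>\<phi>\<in>I. 3 * e')"
        using L(2)[OF that] x by (intro sum_mono) (auto simp del: act_act)
      also have "\<dots> \<le> e" using e by (simp add: e'_def field_simps)
      finally show ?thesis .
    qed
    with L(1) show "\<exists>L :: 's \<Rightarrow> 'x \<times> ('x \<Rightarrow> real) \<Rightarrow> int. finite (range L) \<and>
     (\<forall>s s'. L s = L s' \<longrightarrow> (\<forall>t. cmod (apply_bcontfun H (s * t) - apply_bcontfun H (s' * t)) \<le> e))"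
      by blast
  qed
  have lin: "\<mu> (f + g) = \<mu> f + \<mu> g" "\<mu> (cscale c f) = c * \<mu> f" "\<mu> (left_translate s f) = \<mu> f"
    if "f \<in> almost_periodic" "g \<in> almost_periodic" for f g c s
    using \<mu> that by (auto simp: left_invariant_mean_def bounded_functional_on_def)
  \<comment> \<open>The point \<open>s (t x)\<close> lies in the image of \<open>F\<close>, where
    \<open>g\<close> vanishes; left invariance then gives \<open>\<mu> H = 0\<close>.\<close>
  have "left_translate s H = cscale 0 H"
  proof (rule bcontfun_eqI)
    fix t
    have "act s (act t x) \<in> act s ` F" using inv x by blast
    from g_0[OF this] show "apply_bcontfun (left_translate s H) t = apply_bcontfun (cscale 0 H) t"
      using x by (simp add: H)
  qed
  then have \<mu>H: "\<mu> H = 0"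
    using lin(2,3)[OF H_ap H_ap] by (metis mult_zero_left)
  have "x \<in> {z \<in> K. 0 < g z} \<inter> F" using g_x x \<epsilon> by simp
  then have "openin T {z \<in> K. 0 < g z}" "{z \<in> K. 0 < g z} \<inter> F \<noteq> {}"
    using openin_greater[OF g_cont] by auto
  then obtain A where A: "finite A" "\<And>z. z \<in> F \<Longrightarrow> \<exists>t\<in>A. act t z \<in> {z \<in> K. 0 < g z}"
    using minimal_finite_cover[OF F] by blast
  \<comment> \<open>Every point of \<open>F\<close> is carried by some \<open>t\<close> in
    \<open>A\<close> to where \<open>g\<close> is positive, so \<open>h\<close> is positive on
    \<open>F\<close> and attains a positive minimum there.\<close>
  define h where "h = (\<lambda>z. \<Sum>t\<in>A. g (act t z))"
  have h_pos: "0 < h z" if "z \<in> F" for z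
    using A(2)[OF that] A(1) g_ge unfolding h_def by (auto intro: sum_pos2)
  have h_cont: "continuous_map T euclideanreal h"
    unfolding h_def using A continuous_map_compose[OF continuous_act g_cont]
    by (intro continuous_map_sum) (auto simp: o_def)
  have "compact (h ` F)" using compact_image[OF h_cont cF] .
  then obtain v where v: "v \<in> F" "\<And>z. z \<in> F \<Longrightarrow> h v \<le> h z"
    using compact_attains_inf[of "h ` F"] x by auto
  define f where "f = (\<Sum>t\<in>A. left_translate t H)"
  have f_ap: "f \<in> almost_periodic"
    unfolding f_def using H_ap by (intro almost_periodic_sum) auto
  have f_apply: "apply_bcontfun f u = complex_of_real (h (act u x))" for u
  proof -
    have "apply_bcontfun (\<Sum>t\<in>B. left_translate t H) u = (\<Sum>t\<in>B. complex_of_real (g (act (t * u) x)))"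
      if "finite B" for B
      using that by (induction B rule: finite_induct) (auto simp: H)
    then show ?thesis using A x by (simp add: f_def h_def)
  qed
  have "\<mu> f = 0"
  proof -
    have "\<mu> (\<Sum>t\<in>B. left_translate t H) = 0" if "finite B" for B
      using that
    proof (induction B rule: finite_induct)
      case empty
      have "cscale 0 H = 0" by (rule bcontfun_eqI) simp
      then show ?case using lin(2)[OF H_ap H_ap, of 0] by simp
    next
      case (insert t B)
      have "(\<Sum>t\<in>B. left_translate t H) \<in> almost_periodic"
        using H_ap by (intro almost_periodic_sum) auto
      then show ?case
        using insert lin H_ap \<mu>H by simp
    qed
    then show ?thesis using A by (simp add: f_def)
  qed
  moreover have "\<mu> f \<noteq> 0"
    using v h_pos x inv by (intro mean_nonzero[OF \<mu> f_ap f_apply, of "h v"]) auto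
  ultimately show False by simp
qed

text \<open>Some positive power of \<open>act t\<close> is uniformly close to the identity on \<open>F\<close>, and all powers
  are nonexpansive.\<close>

lemma act_isometry:
  assumes FK: "F \<subseteq> K" and surj: "\<And>s. act s ` F = F" and p: "p \<in> Q" and xy: "x \<in> F" "y \<in> F"
  shows "p (x - y) \<le> p (act t x - act t y)"
proof (rule seminorm_diff_leI[OF seminorm[OF p]])
  show "x \<in> X" "y \<in> X" using xy FK by auto
  fix \<phi> assume \<phi>: "\<phi> \<in> dominated p"
  have K [simp]: "z \<in> K" if "z \<in> F" for z using FK that by auto
  \<comment> \<open>\<open>pw n\<close> is the power of \<open>t\<close> with exponent
    \<open>n + 1\<close>; without an identity the powers start at \<open>t\<close>.\<close>
  define pw where "pw = rec_nat t (\<lambda>_ u. t * u)"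
  have pw [simp]: "pw 0 = t" "pw (Suc n) = t * pw n" for n by (simp_all add: pw_def)
  have pw_add: "pw (Suc (k + n)) = pw k * pw n" for k n
    by (induction k) (simp_all add: mult.assoc)
  have pw_le: "p (act (pw n) x - act (pw n) y) \<le> p (act t x - act t y)" for n
  proof (induction n)
    case (Suc n)
    have "p (act t (act (pw n) x) - act t (act (pw n) y)) \<le> p (act (pw n) x - act (pw n) y)"
      using xy by (intro act_le p) auto
    with Suc show ?case using xy by simp
  qed simp
  show "\<phi> x - \<phi> y \<le> p (act t x - act t y)"
  proof (rule field_le_epsilon)
    fix e :: real assume "0 < e"
    then have "0 < e / 6" by simp
    moreover have "{\<phi>} \<subseteq> weak_functionals" using \<phi> p by (auto simp: weak_functionals_def)
    ultimately obtain L :: "'s \<Rightarrow> 'x \<times> ('x \<Rightarrow> real) \<Rightarrow> int" where L: "finite (range L)"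
      "\<And>s s' z. L s = L s' \<Longrightarrow> z \<in> K \<Longrightarrow> \<bar>\<phi> (act s z) - \<phi> (act s' z)\<bar> \<le> 3 * (e / 6)"
      using finite_colouring[of "{\<phi>}" "e / 6"] by (metis finite.intros insertI1)
    \<comment> \<open>Pigeonhole on the colours: two different powers of \<open>t\<close> act nearly
      alike, as far as \<phi> can see.\<close>
    have "finite (range (\<lambda>n. L (pw n)))"
      using L(1) by (rule rev_finite_subset) auto
    then have "\<not> inj (\<lambda>n. L (pw n))"
      using finite_imageD infinite_UNIV_nat by blast
    then obtain n m where nm: "n < m" "L (pw n) = L (pw m)"
      unfolding inj_def by (metis nat_neq_iff)
    then obtain k where m: "m = Suc (k + n)"
      by (metis add.commute less_imp_Suc_add)
    have close: "\<bar>\<phi> w - \<phi> (act (pw k) w)\<bar> \<le> e / 2" if w: "w \<in> F" for w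
    proof -
      \<comment> \<open>Surjectivity writes \<open>w\<close> as the image of \<open>z\<close> under
        the lower power, so comparing the two powers at \<open>z\<close> compares \<open>w\<close>
        with \<open>act (pw k) w\<close>. The exponent depends on \<phi> and \<open>e\<close>, hence
        the reduction to a single functional.\<close>
      obtain z where z: "z \<in> F" "w = act (pw n) z" using surj w by blast
      show ?thesis
        using L(2)[OF nm(2), of z] z by (simp add: m pw_add del: pw)
    qed
    have "\<phi> (act (pw k) x) - \<phi> (act (pw k) y) \<le> p (act (pw k) x - act (pw k) y)"
      using dominated_abs[OF seminorm[OF p] \<phi>, of "act (pw k) x" "act (pw k) y"] xy by simp
    then show "\<phi> x - \<phi> y \<le> p (act t x - act t y) + e"
      using close[OF xy(1)] close[OF xy(2)] pw_le[of k] by linarith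
  qed
qed

text \<open>Otherwise a binary tree of open sets, separated
  by \<open>p\<close>-dominated functionals, has uncountably many branches whose limit points are
  \<open>e\<close>-separated but lie, by Hahn--Banach, in the \<open>p\<close>-separable span of countably many points.\<close>

lemma fragmented:
  assumes F: "closedin T F" "F \<noteq> {}" and p: "p \<in> Q" and e: "0 < e"
  shows "\<exists>V. openin T V \<and> V \<inter> F \<noteq> {} \<and> (\<forall>x\<in>V \<inter> F. \<forall>y\<in>V \<inter> F. p (x - y) \<le> e)"
proof (rule ccontr)
  assume not_frag: "\<not> ?thesis"
  have not_small: "\<exists>x y. x \<in> V \<inter> F \<and> y \<in> V \<inter> F \<and> e < p (x - y)"
    if "openin T V" "V \<inter> F \<noteq> {}" for V
    using that not_frag by (meson not_le)
  have FK [simp]: "z \<in> K" if "z \<in> F" for z using closedin_subset_K[OF F(1)] that by auto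
  define good where "good = (\<lambda>V. openin T V \<and> V \<inter> F \<noteq> {})"
  \<comment> \<open>One node of the tree: \<phi> differs by at least \<open>e\<close> between the
    two children, so it separates all that lies beyond the branching.\<close>
  define splits_into where "splits_into = (\<lambda>V W \<phi> c. (\<forall>b. good (W b) \<and> W b \<subseteq> V) \<and> \<phi> \<in> dominated p \<and>
      (\<forall>z\<in>W True. c + e \<le> \<phi> z) \<and> (\<forall>z\<in>W False. \<phi> z \<le> c))"
  have "\<exists>w. splits_into V (fst w) (fst (snd w)) (snd (snd w))" if V: "good V" for V
  proof -
    obtain x y where xy: "x \<in> V \<inter> F" "y \<in> V \<inter> F" "e < p (x - y)"
      using not_small[of V] V unfolding good_def by blast
    obtain \<phi> where \<phi>: "\<phi> \<in> dominated p" "\<phi> (x - y) = p (x - y)"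
      using norming_functional[OF sublinear_on_seminorm[OF seminorm[OF p]], of "x - y"] xy by auto
    have gap: "e < \<phi> x - \<phi> y"
      using \<phi> xy by (simp add: dominated_def linear_onD)
    \<comment> \<open>Half of the excess of the gap over \<open>e\<close>: after widening both
      half-spaces by it, a gap of exactly \<open>e\<close> remains.\<close>
    define \<eta> where "\<eta> = (\<phi> x - \<phi> y - e) / 2"
    have \<eta>: "0 < \<eta>" using gap by (simp add: \<eta>_def)
    define W where "W = (\<lambda>b. V \<inter> (if b then {z \<in> K. \<phi> x - \<eta> < \<phi> z} else {z \<in> K. \<phi> z < \<phi> y + \<eta>}))"
    have "good (W b)" for b
    proof -
      have "openin T (W b)"
        using V continuous_dominated[OF p \<phi>(1)]
        by (auto simp: W_def good_def openin_less openin_greater)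
      moreover have "(if b then x else y) \<in> W b \<inter> F"
        using xy \<eta> by (auto simp: W_def)
      ultimately show ?thesis by (auto simp: good_def)
    qed
    moreover have "\<phi> y + \<eta> + e = \<phi> x - \<eta>"
      by (simp add: \<eta>_def field_simps)
    ultimately show ?thesis
      using \<phi>(1) by (intro exI[of _ "(W, \<phi>, \<phi> y + \<eta>)"]) (auto simp: W_def splits_into_def)
  qed
  then have "\<forall>V\<in>Collect good. \<exists>w. splits_into V (fst w) (fst (snd w)) (snd (snd w))" by simp
  from bchoice[OF this] obtain \<omega>
    where \<omega>: "\<And>V. good V \<Longrightarrow> splits_into V (fst (\<omega> V)) (fst (snd (\<omega> V))) (snd (snd (\<omega> V)))" by auto
  define W \<phi> c where "W = (\<lambda>V. fst (\<omega> V))" and "\<phi> = (\<lambda>V. fst (snd (\<omega> V)))"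
    and "c = (\<lambda>V. snd (snd (\<omega> V)))"
  have W: "\<And>V b. good V \<Longrightarrow> good (W V b)" "\<And>V b. good V \<Longrightarrow> W V b \<subseteq> V"
    and \<phi>: "\<And>V. good V \<Longrightarrow> \<phi> V \<in> dominated p"
    and sep: "\<And>V z. good V \<Longrightarrow> z \<in> W V True \<Longrightarrow> c V + e \<le> \<phi> V z"
      "\<And>V z. good V \<Longrightarrow> z \<in> W V False \<Longrightarrow> \<phi> V z \<le> c V"
    using \<omega> by (auto simp: splits_into_def W_def \<phi>_def c_def)
  \<comment> \<open>Node lists carry the latest choice at the head, which explains the
    \<open>rev\<close> in \<open>pre\<close>.\<close>
  define U where "U = (\<lambda>\<sigma>. foldr (\<lambda>b V. W V b) \<sigma> K)"
  have U [simp]: "U [] = K" "U (b # \<sigma>) = W (U \<sigma>) b" for b \<sigma> by (simp_all add: U_def)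
  have good_U: "good (U \<sigma>)" for \<sigma>
  proof (induction \<sigma>)
    case Nil
    have "K \<inter> F = F" using closedin_subset_K[OF F(1)] by blast
    then show ?case using F openin_topspace[of T] by (simp add: good_def)
  qed (simp add: W)
  then have "\<exists>x. x \<in> U \<sigma> \<inter> F" for \<sigma> by (auto simp: good_def)
  then obtain x where x: "\<And>\<sigma>. x \<sigma> \<in> U \<sigma> \<inter> F" by metis
  have xX [simp]: "x \<sigma> \<in> X" for \<sigma> using x[of \<sigma>] by simp

  define pre :: "(nat \<Rightarrow> bool) \<Rightarrow> nat \<Rightarrow> bool list" where "pre = (\<lambda>\<beta> n. rev (map \<beta> [0..<n]))"
  have pre_Suc: "pre \<beta> (Suc n) = \<beta> n # pre \<beta> n" for \<beta> n by (simp add: pre_def)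
  have U_mono: "U (pre \<beta> m) \<subseteq> U (pre \<beta> n)" if "n \<le> m" for \<beta> n m
    using that
  proof (induction m rule: dec_induct)
    case (step m)
    then show ?case using W(2)[OF good_U] by (auto simp: pre_Suc)
  qed simp
  let ?tail = "\<lambda>\<beta> n. T closure_of ((\<lambda>m. x (pre \<beta> m)) ` {n..})"
  \<comment> \<open>The limit of a branch is a cluster point of its chosen points; closed conditions
    that hold on a tail pass to it.\<close>
  have "\<exists>z. z \<in> F \<and> (\<forall>n. z \<in> ?tail \<beta> n)" for \<beta>
  proof -
    have sub: "(\<lambda>m. x (pre \<beta> m)) ` {n..} \<subseteq> F" for n using x by auto
    have "?tail \<beta> n \<noteq> {}" for n
    proof -
      have "(\<lambda>m. x (pre \<beta> m)) ` {n..} \<subseteq> ?tail \<beta> n"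
        using sub[of n] closedin_subset_K[OF F(1)] by (intro closure_of_subset) auto
      then show ?thesis by auto
    qed
    moreover have "decseq (?tail \<beta>)"
      by (intro decseq_SucI closure_of_mono) auto
    ultimately have "(\<Inter>n. ?tail \<beta> n) \<noteq> {}"
      by (intro compact_space_imp_nest[OF compact_T]) auto
    then obtain z where "\<forall>n. z \<in> ?tail \<beta> n" by auto
    moreover have "?tail \<beta> 0 \<subseteq> F"
      using sub F(1) by (rule closure_of_minimal)
    ultimately show ?thesis by blast
  qed
  then obtain z where zF: "\<And>\<beta>. z \<beta> \<in> F" and z_tail: "\<And>\<beta> n. z \<beta> \<in> ?tail \<beta> n" by metis
  have zX [simp]: "z \<beta> \<in> X" for \<beta> using zF[of \<beta>] by simp
  have z_closed: "z \<beta> \<in> C" if "closedin T C" "\<And>m. n \<le> m \<Longrightarrow> x (pre \<beta> m) \<in> C" for \<beta> n C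
    using z_tail[of \<beta> n] closure_of_minimal[OF _ that(1), of "(\<lambda>m. x (pre \<beta> m)) ` {n..}"] that(2)
    by auto
  have far: "e \<le> p (z \<beta> - z \<beta>')"
    if n: "\<And>i. i < n \<Longrightarrow> \<beta> i = \<beta>' i" "\<beta> n" "\<not> \<beta>' n" for \<beta> \<beta>' n
  proof -
    define V where "V = U (pre \<beta> n)"
    have pre_eq: "pre \<beta>' n = pre \<beta> n" using n(1) by (simp add: pre_def)
    have V: "good V" using good_U by (simp add: V_def)
    have cont: "continuous_map T euclideanreal (\<phi> V)"
      using continuous_dominated[OF p \<phi>[OF V]] .
    have "z \<beta> \<in> {y \<in> K. c V + e \<le> \<phi> V y}"
    proof (rule z_closed[OF closedin_ge[OF cont]])
      fix m assume "Suc n \<le> m"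
      then have "x (pre \<beta> m) \<in> W V True"
        using x U_mono[of "Suc n" m \<beta>] n(2) by (auto simp: pre_Suc V_def)
      then show "x (pre \<beta> m) \<in> {y \<in> K. c V + e \<le> \<phi> V y}"
        using sep(1)[OF V] x by auto
    qed
    moreover have "z \<beta>' \<in> {y \<in> K. \<phi> V y \<le> c V}"
    proof (rule z_closed[OF closedin_le[OF cont]])
      fix m assume "Suc n \<le> m"
      then have "x (pre \<beta>' m) \<in> W V False"
        using x U_mono[of "Suc n" m \<beta>'] n(3) by (auto simp: pre_Suc pre_eq V_def)
      then show "x (pre \<beta>' m) \<in> {y \<in> K. \<phi> V y \<le> c V}"
        using sep(2)[OF V] x by auto
    qed
    ultimately have "c V + e \<le> \<phi> V (z \<beta>)" "\<phi> V (z \<beta>') \<le> c V" by auto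
    then show ?thesis
      using dominated_abs[OF seminorm[OF p] \<phi>[OF V] zX zX, of \<beta> \<beta>'] by linarith
  qed
  have z_far: "\<beta> = \<beta>'" if "p (z \<beta> - z \<beta>') < e" for \<beta> \<beta>'
  proof (rule ccontr)
    assume "\<beta> \<noteq> \<beta>'"
    then have ex: "\<exists>n. \<beta> n \<noteq> \<beta>' n" by (simp add: fun_eq_iff)
    define n where "n = (LEAST n. \<beta> n \<noteq> \<beta>' n)"
    have n: "\<beta> n \<noteq> \<beta>' n" "\<And>i. i < n \<Longrightarrow> \<beta> i = \<beta>' i"
      unfolding n_def using LeastI_ex[OF ex] by (simp, blast dest: not_less_Least)
    have "p (z \<beta> - z \<beta>') = p (z \<beta>' - z \<beta>)"
      using seminorm_minus[OF seminorm[OF p] zX zX] .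
    then show False
      using far[of n \<beta> \<beta>'] far[of n \<beta>' \<beta>] n that by (cases "\<beta> n") auto
  qed

  \<comment> \<open>Linear combinations are coded as lists of coefficients and nodes, so that those
    with rational coefficients form a countable type.\<close>
  define comb :: "(real \<times> bool list) list \<Rightarrow> 'x"
    where "comb = (\<lambda>l. \<Sum>(a, \<sigma>)\<leftarrow>l. scale a (x \<sigma>))"
  have comb [simp]: "comb [] = 0" "comb ((a, \<sigma>) # l) = scale a (x \<sigma>) + comb l"
    "comb (l @ l') = comb l + comb l'" for a \<sigma> l l'
    by (simp_all add: comb_def)
  have comb_scale: "scale u (comb l) = comb (map (\<lambda>(a, \<sigma>). (u * a, \<sigma>)) l)" for u l
    by (induction l) (auto simp: scale_right_distrib)
  have comb_X [simp]: "comb l \<in> X" for l by (induction l) auto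
  \<comment> \<open>Mazur's argument: if \<open>z \<beta>\<close> had distance at least
    \<open>e / 4\<close> from all combinations, some dominated functional would be smaller by
    \<open>e / 4\<close> at every \<open>x \<sigma>\<close> than at \<open>z \<beta>\<close>, a
    cluster point of such points.\<close>
  have near: "\<exists>l. p (z \<beta> - comb l) < e / 4" for \<beta>
  proof (rule ccontr)
    assume "\<not> ?thesis"
    then have ge: "e / 4 \<le> p (z \<beta> - comb l)" for l by (simp add: not_less)
    define V where "V = range (\<lambda>l. z \<beta> - comb l)"
    have "convex_in scale V"
      unfolding convex_in_def
    proof (intro ballI)
      fix v w and u :: real assume "v \<in> V" "w \<in> V"
      then obtain l l' where l: "v = z \<beta> - comb l" "w = z \<beta> - comb l'" by (auto simp: V_def)
      have "scale (1 - u) v + scale u w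
          = z \<beta> - comb (map (\<lambda>(a, \<sigma>). ((1 - u) * a, \<sigma>)) l @ map (\<lambda>(a, \<sigma>). (u * a, \<sigma>)) l')"
        by (simp only: comb(3) comb_scale[symmetric] l) (simp add: algebra_simps)
      then show "scale (of_real (1 - u)) v + scale (of_real u) w \<in> V"
        unfolding V_def of_real_eq_id id_def by blast
    qed
    moreover have "V \<subseteq> X" "V \<noteq> {}" by (auto simp: V_def)
    ultimately obtain \<psi> where \<psi>: "\<psi> \<in> dominated p" "\<And>v. v \<in> V \<Longrightarrow> e / 4 \<le> \<psi> v"
      using separation[OF sublinear_on_seminorm[OF seminorm[OF p]], of V "e / 4"] ge
      by (auto simp: V_def)
    have "\<psi> (x \<sigma>) \<le> \<psi> (z \<beta>) - e / 4" for \<sigma>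
    proof -
      have "z \<beta> - comb [(1, \<sigma>)] \<in> V" unfolding V_def by blast
      then have "e / 4 \<le> \<psi> (z \<beta> - x \<sigma>)" using \<psi>(2) by fastforce
      then show ?thesis using \<psi>(1) by (simp add: dominated_def linear_onD)
    qed
    then have "z \<beta> \<in> {y \<in> K. \<psi> y \<le> \<psi> (z \<beta>) - e / 4}"
      using x by (intro z_closed[OF closedin_le[OF continuous_dominated[OF p \<psi>(1)]], of 0]) auto
    then show False using e by simp
  qed
  define rat :: "(rat \<times> bool list) list \<Rightarrow> (real \<times> bool list) list"
    where "rat = map (\<lambda>(q, \<sigma>). (of_rat q, \<sigma>))"
  have rat: "\<exists>r. p (comb l - comb (rat r)) < d" if "0 < d" for l d
    using that
  proof (induction l arbitrary: d)
    case Nil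
    then show ?case using seminorm_zero[OF p] by (intro exI[of _ "[]"]) (simp add: rat_def)
  next
    case (Cons a\<sigma> l)
    obtain a \<sigma> where a\<sigma>: "a\<sigma> = (a, \<sigma>)" by force
    obtain r where r: "p (comb l - comb (rat r)) < d / 2"
      using Cons.IH[of "d / 2"] Cons.prems by auto
    let ?P = "p (x \<sigma>) + 1"
    have P: "0 < ?P" using seminorm_nonneg[OF p, of "x \<sigma>"] by simp
    obtain q :: rat where q: "a < of_rat q" "of_rat q < a + d / 2 / ?P"
      using of_rat_dense[of a "a + d / 2 / ?P"] P Cons.prems by auto
    have eq: "comb (a\<sigma> # l) - comb (rat ((q, \<sigma>) # r))
        = scale (a - of_rat q) (x \<sigma>) + (comb l - comb (rat r))"
      by (simp add: a\<sigma> rat_def algebra_simps)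
    have "p (scale (a - of_rat q) (x \<sigma>) + (comb l - comb (rat r)))
        \<le> \<bar>a - of_rat q\<bar> * p (x \<sigma>) + p (comb l - comb (rat r))"
      using seminorm[OF p] unfolding seminorm_on_def
      by (metis X_diff X_scale comb_X real_norm_def xX)
    moreover have "\<bar>a - of_rat q\<bar> * p (x \<sigma>) \<le> d / 2 / ?P * ?P"
      using q P seminorm_nonneg[OF p, of "x \<sigma>"] Cons.prems by (intro mult_mono) auto
    moreover have "d / 2 / ?P * ?P = d / 2"
    proof -
      have "b \<noteq> 0 \<Longrightarrow> d / 2 / b * b = d / 2" for b :: real by simp
      then show ?thesis using P by (metis less_irrefl)
    qed
    ultimately have "p (comb (a\<sigma> # l) - comb (rat ((q, \<sigma>) # r))) < d"
      unfolding eq using r by linarith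
    then show ?case by blast
  qed
  have "\<exists>r. p (z \<beta> - comb (rat r)) < e / 2" for \<beta>
  proof -
    obtain l where l: "p (z \<beta> - comb l) < e / 4" using near by blast
    obtain r where "p (comb l - comb (rat r)) < e / 4" using rat[of "e / 4" l] e by auto
    then show ?thesis
      using l seminorm_triangle[OF p, of "z \<beta>" "comb l" "comb (rat r)"]
      by (intro exI[of _ r]) simp
  qed
  then obtain r where r: "\<And>\<beta>. p (z \<beta> - comb (rat (r \<beta>))) < e / 2" by metis
  \<comment> \<open>A common approximant puts two limit points less than \<open>e\<close> apart, so
    their branches agree. Sets of naturals, read as branches, thus embed into a countable type,
    against Cantor.\<close>
  have "inj r"
  proof (rule injI)
    fix \<beta> \<beta>' assume eq: "r \<beta> = r \<beta>'"
    have "p (comb (rat (r \<beta>)) - z \<beta>') < e / 2"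
      using r[of \<beta>'] seminorm_minus[OF seminorm[OF p], of "z \<beta>'" "comb (rat (r \<beta>))"] eq by simp
    then have "p (z \<beta> - z \<beta>') < e"
      using r[of \<beta>] seminorm_triangle[OF p, of "z \<beta>" "comb (rat (r \<beta>))" "z \<beta>'"] by simp
    then show "\<beta> = \<beta>'" by (rule z_far)
  qed
  then have inj: "inj (\<lambda>A. to_nat (r (\<lambda>n. n \<in> A)))"
    by (auto simp: inj_def fun_eq_iff)
  have "range (inv (\<lambda>A. to_nat (r (\<lambda>n. n \<in> A)))) = Pow (UNIV :: nat set)"
    using inj_imp_surj_inv[OF inj] by simp
  then show False using Cantors_theorem by blast
qed

section \<open>Finite nets and averaging\<close>

lemma seminorm_sum_le:
  assumes "p \<in> Q" "finite N" "\<And>i. i \<in> N \<Longrightarrow> f i \<in> X"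
  shows "(\<Sum>i\<in>N. f i) \<in> X \<and> p (\<Sum>i\<in>N. f i) \<le> (\<Sum>i\<in>N. p (f i))"
  using assms(2,3)
proof (induction N rule: finite_induct)
  case empty
  then show ?case using seminorm_zero[OF assms(1)] by simp
next
  case (insert i N)
  then have "p (f i + (\<Sum>i\<in>N. f i)) \<le> p (f i) + p (\<Sum>i\<in>N. f i)"
    using seminorm[OF assms(1)] by (auto simp: seminorm_on_def)
  then show ?case using insert by auto
qed

lemma convex_average:
  assumes C: "convex_in scale C" and N: "finite N" "N \<noteq> {}" "N \<subseteq> C"
  shows "scale (1 / real (card N)) (\<Sum>N) \<in> C"
  using N
proof (induction N rule: finite_ne_induct)
  case (insert a N)
  define n where "n = real (card N)"
  define u where "u = n / (n + 1)"
  have n: "0 < n" using insert by (simp add: n_def card_gt_0_iff)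
  have "u \<in> {0..1}" using n by (simp add: u_def)
  then have "scale (1 - u) a + scale u (scale (1 / n) (\<Sum>N)) \<in> C"
    using C insert unfolding convex_in_def of_real_eq_id id_def n_def by blast
  moreover have "1 - u = 1 / (n + 1)" "u * (1 / n) = 1 / (n + 1)"
    using n by (simp_all add: u_def field_simps)
  ultimately have "scale (1 / (n + 1)) (a + \<Sum>N) \<in> C"
    by (simp only: scale_scale scale_right_distrib)
  then show ?case using insert by (simp add: n_def add.commute)
qed simp

text \<open>The preimages of a small part \<open>V\<close> under finitely many translations cover
  \<open>F\<close>. They are as small as \<open>V\<close> because translations do not contract
  distances in \<open>F\<close>; nonexpansiveness alone bounds in the wrong direction.\<close>

lemma finite_net:
  assumes F: "minimal_invariant F" and surj: "\<And>s. act s ` F = F" and p: "p \<in> Q" and e: "0 < e"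
  obtains N where "finite N" "N \<noteq> {}" "N \<subseteq> F" "\<And>y. y \<in> F \<Longrightarrow> \<exists>x\<in>N. p (x - y) \<le> e"
proof -
  have cl: "closedin T F" "F \<noteq> {}" using F by (auto simp: minimal_invariant_def)
  obtain V where V: "openin T V" "V \<inter> F \<noteq> {}" "\<And>x y. x \<in> V \<inter> F \<Longrightarrow> y \<in> V \<inter> F \<Longrightarrow> p (x - y) \<le> e"
    using fragmented[OF cl p e] by blast
  obtain A where A: "finite A" "\<And>z. z \<in> F \<Longrightarrow> \<exists>t\<in>A. act t z \<in> V"
    using minimal_finite_cover[OF F V(1,2)] by blast
  \<comment> \<open>Only translations that carry some point of \<open>F\<close> into
    \<open>V\<close> have a representative to put into the net.\<close>
  define B where "B = {t \<in> A. \<exists>z\<in>F. act t z \<in> V}"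
  have "\<forall>t\<in>B. \<exists>z. z \<in> F \<and> act t z \<in> V" by (auto simp: B_def)
  from bchoice[OF this] obtain x where x: "\<And>t. t \<in> B \<Longrightarrow> x t \<in> F \<and> act t (x t) \<in> V" by auto
  have net: "\<exists>w\<in>x ` B. p (w - y) \<le> e" if y: "y \<in> F" for y
  proof -
    obtain t where t: "t \<in> A" "act t y \<in> V" using A y by blast
    then have tB: "t \<in> B" using y by (auto simp: B_def)
    have "p (x t - y) \<le> p (act t (x t) - act t y)"
      using act_isometry[OF closedin_subset_K[OF cl(1)] surj p] x[OF tB] y by blast
    also have "\<dots> \<le> e"
      using V(3)[of "act t (x t)" "act t y"] x[OF tB] t y surj by blast
    finally show ?thesis using tB by blast
  qed
  show ?thesis
  proof (rule that[of "x ` B"])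
    show "x ` B \<noteq> {}" using net cl by blast
  qed (use A x net in \<open>auto simp: B_def\<close>)
qed

text \<open>DeMarr's argument: the average of a finite net of \<open>F\<close> has \<open>p\<close>-distance from the points of
  \<open>F\<close> bounded by some \<open>r\<close> less than the \<open>p\<close>-diameter.\<close>

lemma diameter_zero:
  assumes F: "minimal_invariant F" and surj: "\<And>s. act s ` F = F"
    and K0: "closedin T K0" "convex_in scale K0" "invariant K0" "F \<subseteq> K0"
    and min: "\<And>C. closedin T C \<Longrightarrow> C \<noteq> {} \<Longrightarrow> convex_in scale C \<Longrightarrow> invariant C \<Longrightarrow> C \<subseteq> K0 \<Longrightarrow> C = K0"
    and p: "p \<in> Q" and xy: "x \<in> F" "y \<in> F"
  shows "p (x - y) = 0"
proof (rule ccontr)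
  assume ne: "p (x - y) \<noteq> 0"
  have cl: "closedin T F" using F by (auto simp: minimal_invariant_def)
  have [simp]: "z \<in> K" if "z \<in> K0" for z using closedin_subset_K[OF K0(1)] that by auto
  have FK [simp]: "z \<in> K" if "z \<in> F" for z using K0(4) that by auto
  let ?dist = "\<lambda>(x, y). p (x - y)"
  define d where "d = (SUP w\<in>F \<times> F. ?dist w)"
  \<comment> \<open>A finite net of mesh 1 makes the diameter finite, which gives the real
    \<open>SUP\<close> in \<open>d\<close> its meaning.\<close>
  have bdd: "bdd_above (?dist ` (F \<times> F))"
  proof -
    obtain N where N: "finite N" "N \<noteq> {}" "N \<subseteq> F" "\<And>y. y \<in> F \<Longrightarrow> \<exists>x\<in>N. p (x - y) \<le> 1"
      using finite_net[OF F surj p, of 1] by auto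
    define B where "B = (\<Sum>w\<in>N. p (w - x))"
    have le: "p (v - x) \<le> 1 + B" if v: "v \<in> F" for v
    proof -
      obtain w where w: "w \<in> N" "p (w - v) \<le> 1" using N(4) v by blast
      have "p (w - x) \<le> B"
        unfolding B_def using w N xy by (intro member_le_sum) (auto intro!: seminorm_nonneg[OF p])
      then show ?thesis
        using seminorm_triangle[OF p, of v w x] seminorm_minus[OF seminorm[OF p], of v w] w v N xy
        by auto
    qed
    have "p (v - w) \<le> 2 * (1 + B)" if vw: "v \<in> F" "w \<in> F" for v w
      using seminorm_triangle[OF p, of v x w] seminorm_minus[OF seminorm[OF p], of x w]
        le[OF vw(1)] le[OF vw(2)] vw xy by auto
    then show ?thesis by (intro bdd_aboveI2[of _ _ "2 * (1 + B)"]) auto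
  qed
  have le_d: "p (v - w) \<le> d" if "v \<in> F" "w \<in> F" for v w
    unfolding d_def using that cSUP_upper[OF _ bdd, of "(v, w)"] by auto
  have d: "0 < d"
    using ne seminorm_nonneg[OF p, of "x - y"] le_d[OF xy] xy by auto
  then obtain N where N: "finite N" "N \<noteq> {}" "N \<subseteq> F" "\<And>y. y \<in> F \<Longrightarrow> \<exists>x\<in>N. p (x - y) \<le> d / 2"
    using finite_net[OF F surj p, of "d / 2"] by auto
  define n where "n = real (card N)"
  have n: "1 \<le> n" using N by (simp add: n_def Suc_leI card_gt_0_iff)
  define u where "u = scale (1 / n) (\<Sum>N)"
  \<comment> \<open>One point of the net is within \<open>d / 2\<close> of a given \<open>w\<close>,
    the other \<open>n - 1\<close> within \<open>d\<close>; the average is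
    \<open>(d / 2 + (n - 1) d) / n = d - d / (2 n)\<close>.\<close>
  define r where "r = d - d / (2 * n)"
  have r: "r < d" using n d by (simp add: r_def)
  have u: "u \<in> K0"
    unfolding u_def n_def using N K0 by (intro convex_average) auto
  have u_le: "p (u - w) \<le> r" if w: "w \<in> F" for w
  proof -
    have "u - w = scale (1 / n) (\<Sum>v\<in>N. v - w)"
      using n by (simp add: u_def sum_subtractf scale_right_diff_distrib sum_constant_scale n_def[symmetric])
    moreover have NX: "\<And>v. v \<in> N \<Longrightarrow> v - w \<in> X" using N w by auto
    ultimately have "p (u - w) = (1 / n) * p (\<Sum>v\<in>N. v - w)"
      using seminorm[OF p] seminorm_sum_le[OF p N(1), of "\<lambda>v. v - w"] n
      by (simp add: seminorm_on_def)
    also have "\<dots> \<le> (1 / n) * (\<Sum>v\<in>N. p (v - w))"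
      using seminorm_sum_le[OF p N(1), of "\<lambda>v. v - w"] NX n by (intro mult_left_mono) auto
    also have "\<dots> \<le> (1 / n) * (d / 2 + (n - 1) * d)"
    proof (intro mult_left_mono)
      obtain v where v: "v \<in> N" "p (v - w) \<le> d / 2" using N(4) w by blast
      have "(\<Sum>v\<in>N. p (v - w)) = p (v - w) + (\<Sum>v\<in>N - {v}. p (v - w))"
        using v N by (intro sum.remove)
      also have "(\<Sum>v\<in>N - {v}. p (v - w)) \<le> (\<Sum>v\<in>N - {v}. d)"
        using N w le_d by (intro sum_mono) auto
      also have "\<dots> = (n - 1) * d"
        using v N n by (simp add: n_def of_nat_diff)
      finally show "(\<Sum>v\<in>N. p (v - w)) \<le> d / 2 + (n - 1) * d" using v by simp
    qed (use n in auto)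
    also have "\<dots> = r" using n by (simp add: r_def field_simps)
    finally show ?thesis .
  qed
  define K1 where "K1 = {v \<in> K0. \<forall>w\<in>F. p (v - w) \<le> r}"
  \<comment> \<open>Expressing \<open>p\<close> through its dominated functionals exhibits
    \<open>K1\<close> as an intersection of \<open>K0\<close> with weakly closed
    half-spaces.\<close>
  have "K1 = \<Inter>(insert K0 ((\<lambda>(\<phi>, w). {v \<in> K. \<phi> v \<le> r + \<phi> w}) ` (dominated p \<times> F)))" (is "_ = \<Inter>?\<C>")
  proof (intro subset_antisym subsetI)
    fix v assume v: "v \<in> K1"
    have "\<phi> v \<le> r + \<phi> w" if "\<phi> \<in> dominated p" "w \<in> F" for \<phi> w
      using dominated_abs[OF seminorm[OF p] that(1), of v w] v that by (auto simp: K1_def)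
    then show "v \<in> \<Inter>?\<C>" using v by (auto simp: K1_def)
  next
    fix v assume v: "v \<in> \<Inter>?\<C>"
    have "p (v - w) \<le> r" if "w \<in> F" for w
    proof (rule seminorm_diff_leI[OF seminorm[OF p]])
      show "v \<in> X" "w \<in> X" using v that by auto
      fix \<phi> assume "\<phi> \<in> dominated p"
      then have "\<phi> v \<le> r + \<phi> w" using v that by auto
      then show "\<phi> v - \<phi> w \<le> r" by linarith
    qed
    then show "v \<in> K1" using v by (auto simp: K1_def)
  qed
  moreover have "closedin T (\<Inter>?\<C>)"
    using K0 closedin_le continuous_dominated[OF p] by (intro closedin_Inter) auto
  ultimately have "closedin T K1" by simp
  moreover have "K1 \<noteq> {}" using u u_le by (auto simp: K1_def)
  moreover have "convex_in scale K1"
    unfolding convex_in_def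
  proof (intro ballI)
    fix v w and t :: real assume vw: "v \<in> K1" "w \<in> K1" and t: "t \<in> {0..1}"
    have "p (scale (1 - t) v + scale t w - q) \<le> r" if q: "q \<in> F" for q
    proof -
      have "scale (1 - t) v + scale t w - q = scale (1 - t) (v - q) + scale t (w - q)"
        by (simp add: algebra_simps)
      moreover have "p (scale (1 - t) (v - q) + scale t (w - q)) \<le> (1 - t) * p (v - q) + t * p (w - q)"
      proof -
        have X: "v - q \<in> X" "w - q \<in> X" using vw q by (auto simp: K1_def)
        then have "p (scale (1 - t) (v - q) + scale t (w - q))
            \<le> p (scale (1 - t) (v - q)) + p (scale t (w - q))"
          using seminorm[OF p] unfolding seminorm_on_def by (meson X_scale)
        then show ?thesis using seminorm[OF p] t X by (simp add: seminorm_on_def)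
      qed
      moreover have "(1 - t) * p (v - q) + t * p (w - q) \<le> (1 - t) * r + t * r"
        using t vw q by (intro add_mono mult_left_mono) (auto simp: K1_def)
      ultimately show ?thesis by (simp add: algebra_simps)
    qed
    then show "scale (of_real (1 - t)) v + scale (of_real t) w \<in> K1"
      using K0(2) vw t by (auto simp: K1_def convex_in_def)
  qed
  moreover have "invariant K1"
    unfolding invariant_def
  proof (intro allI subsetI)
    fix s v assume "v \<in> act s ` K1"
    then obtain v' where v': "v = act s v'" "v' \<in> K1" by blast
    have "p (v - w) \<le> r" if w: "w \<in> F" for w
    proof -
      \<comment> \<open>Nonexpansiveness bounds distances to points of the image of \<open>F\<close>
        only; surjectivity makes \<open>w\<close> such a point.\<close>
      obtain w' where w': "w = act s w'" "w' \<in> F" using surj w by blast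
      have "p (act s v' - act s w') \<le> p (v' - w')"
        using v' w' by (intro act_le p) (auto simp: K1_def)
      then show ?thesis using v' w' by (fastforce simp: K1_def)
    qed
    then show "v \<in> K1" using v' K0(3) by (auto simp: K1_def invariant_def)
  qed
  moreover have "K1 \<subseteq> K0" by (auto simp: K1_def)
  \<comment> \<open>Now \<open>F\<close> lies in \<open>K1\<close>, so its diameter is at most
    \<open>r\<close>, which is less than \<open>d\<close>.\<close>
  ultimately have "K1 = K0" by (rule min)
  then have "d \<le> r"
    unfolding d_def using K0(4) xy by (intro cSUP_least) (auto simp: K1_def)
  then show False using r by simp
qed

section \<open>Existence of minimal sets and the fixed point\<close>

lemma convex_in_Inter: "(\<And>C. C \<in> \<C> \<Longrightarrow> convex_in scale C) \<Longrightarrow> convex_in scale (\<Inter>\<C>)"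
  by (simp add: convex_in_def)

lemma invariant_Inter: "(\<And>C. C \<in> \<C> \<Longrightarrow> invariant C) \<Longrightarrow> invariant (\<Inter>\<C>)"
  by (auto simp: invariant_def image_subset_iff)

theorem fixed_point:
  assumes \<mu>: "left_invariant_mean (almost_periodic :: ('s \<Rightarrow>\<^sub>C complex) set) \<mu>"
  shows "\<exists>x\<in>K. \<forall>s. act s x = x"
proof -
  let ?\<A> = "{C. closedin T C \<and> C \<noteq> {} \<and> convex_in scale C \<and> invariant C}"
  have "K \<in> ?\<A>"
    using closedin_topspace[of T] K_nonempty K_convex by (auto simp: invariant_def)
  obtain K0 where K0: "K0 \<in> ?\<A>" "\<And>C. C \<in> ?\<A> \<Longrightarrow> C \<subseteq> K0 \<Longrightarrow> C = K0"
  proof (rule minimal_closed_set[OF compact_T, of ?\<A>])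
    show "?\<A> \<noteq> {}" using \<open>K \<in> ?\<A>\<close> by blast
    show "\<Inter>\<C> \<in> ?\<A>" if \<C>: "\<C> \<subseteq> ?\<A>" "\<C> \<noteq> {}" "\<Inter>\<C> \<noteq> {}" for \<C>
    proof -
      have "closedin T (\<Inter>\<C>)" using \<C> by (intro closedin_Inter) auto
      moreover have "convex_in scale (\<Inter>\<C>)"
        using \<C> by (intro convex_in_Inter) auto
      moreover have "invariant (\<Inter>\<C>)"
        using \<C> by (intro invariant_Inter) auto
      ultimately show ?thesis using \<C> by simp
    qed
  qed simp_all
  let ?\<B> = "{C. closedin T C \<and> C \<noteq> {} \<and> invariant C \<and> C \<subseteq> K0}"
  have "K0 \<in> ?\<B>" using K0 by auto
  obtain F where F: "F \<in> ?\<B>" "\<And>C. C \<in> ?\<B> \<Longrightarrow> C \<subseteq> F \<Longrightarrow> C = F"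
  proof (rule minimal_closed_set[OF compact_T, of ?\<B>])
    show "?\<B> \<noteq> {}" using \<open>K0 \<in> ?\<B>\<close> by blast
    show "\<Inter>\<C> \<in> ?\<B>" if \<C>: "\<C> \<subseteq> ?\<B>" "\<C> \<noteq> {}" "\<Inter>\<C> \<noteq> {}" for \<C>
    proof -
      have "closedin T (\<Inter>\<C>)" using \<C> by (intro closedin_Inter) auto
      moreover have "invariant (\<Inter>\<C>)"
        using \<C> by (intro invariant_Inter) auto
      moreover have "\<Inter>\<C> \<subseteq> K0" using \<C> by auto
      ultimately show ?thesis using \<C> by simp
    qed
  qed simp_all
  \<comment> \<open>Minimality within \<open>K0\<close> is minimality outright, since every subset
    of \<open>F\<close> lies in \<open>K0\<close>.\<close>
  have minF: "minimal_invariant F"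
    using F unfolding minimal_invariant_def by auto
  have surj: "act s ` F = F" for s
    using minimal_invariant_surj[OF \<mu> minF] .
  obtain x where x: "x \<in> F" using F by auto
  have FK: "F \<subseteq> K" using F closedin_subset_K by auto
  have "act s x = x" for s
  proof -
    have y: "act s x \<in> F" using surj x by blast
    have "p (act s x - x) = 0" if "p \<in> Q" for p
      using K0 F by (intro diameter_zero[OF minF surj _ _ _ _ _ that y x, of K0]) auto
    then have "act s x - x = 0"
      using x y FK by (intro separated) auto
    then show ?thesis by simp
  qed
  then show ?thesis using x FK by auto
qed

end

section \<open>Seminormed spaces and their weak topologies\<close>

locale seminormed_space = vector_space smul
  for smul :: "'k::real_normed_field \<Rightarrow> 'x::ab_group_add \<Rightarrow> 'x" +
  fixes X :: "'x set" and Q :: "('x \<Rightarrow> real) set"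
  assumes subspace_X: "subspace X"
    and seminorm: "p \<in> Q \<Longrightarrow> seminorm_on smul X p"
begin

lemma X_zero [simp]: "0 \<in> X" and X_add [simp]: "x \<in> X \<Longrightarrow> y \<in> X \<Longrightarrow> x + y \<in> X"
  and X_scale [simp]: "x \<in> X \<Longrightarrow> smul c x \<in> X"
  and X_diff [simp]: "x \<in> X \<Longrightarrow> y \<in> X \<Longrightarrow> x - y \<in> X"
  using subspace_0[OF subspace_X] subspace_add[OF subspace_X] subspace_scale[OF subspace_X]
    subspace_diff[OF subspace_X] by auto

abbreviation \<tau> :: "'x topology" where "\<tau> \<equiv> seminorm_topology X Q"
abbreviation \<omega> :: "'x topology" where "\<omega> \<equiv> weak_topology smul X Q"

section \<open>Neighbourhoods and continuous functionals\<close>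

lemma seminorm_nonneg: "p \<in> Q \<Longrightarrow> x \<in> X \<Longrightarrow> 0 \<le> p x"
  and seminorm_add: "p \<in> Q \<Longrightarrow> x \<in> X \<Longrightarrow> y \<in> X \<Longrightarrow> p (x + y) \<le> p x + p y"
  and seminorm_scale: "p \<in> Q \<Longrightarrow> x \<in> X \<Longrightarrow> p (smul c x) = norm c * p x"
  using seminorm[of p] by (auto simp: seminorm_on_def)

lemma seminorm_zero: "p \<in> Q \<Longrightarrow> p 0 = 0"
  using seminorm_scale[of p 0 0] by simp

lemma seminorm_triangle:
  assumes "p \<in> Q" "x \<in> X" "y \<in> X" "z \<in> X"
  shows "p (x - z) \<le> p (x - y) + p (y - z)"
  using seminorm_add[of p "x - y" "y - z"] assms by simp

lemma topspace_seminorm [simp]: "topspace \<tau> = X"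
  by (auto simp: seminorm_topology_def)

lemma openin_ball: "p \<in> Q \<Longrightarrow> x \<in> X \<Longrightarrow> 0 < r \<Longrightarrow> openin \<tau> {y \<in> X. p (y - x) < r}"
  unfolding seminorm_topology_def by (rule topology_generated_by_Basis) blast

text \<open>Subbasic balls have arbitrary centres; the triangle inequality recentres them at
  \<open>x\<close>. The whole space corresponds to an empty \<open>P\<close>.\<close>

lemma openin_seminorm_nhd:
  assumes "openin \<tau> U" "x \<in> U"
  shows "\<exists>P e. finite P \<and> P \<subseteq> Q \<and> 0 < e \<and> {y \<in> X. \<forall>p\<in>P. p (y - x) < e} \<subseteq> U"
proof -
  have "generate_topology_on
      (insert X {{y \<in> X. p (y - x) < r} | p x r. p \<in> Q \<and> x \<in> X \<and> 0 < r}) U"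
    using assms(1) unfolding seminorm_topology_def openin_topology_generated_by_iff .
  then show ?thesis
    using assms(2)
  proof (induction U rule: generate_topology_on.induct)
    case (Int U V)
    then obtain P e P' e' where
      P: "finite P" "P \<subseteq> Q" "0 < e" "{y \<in> X. \<forall>p\<in>P. p (y - x) < e} \<subseteq> U" and
      P': "finite P'" "P' \<subseteq> Q" "0 < e'" "{y \<in> X. \<forall>p\<in>P'. p (y - x) < e'} \<subseteq> V"
      by auto
    have "{y \<in> X. \<forall>p\<in>P \<union> P'. p (y - x) < min e e'} \<subseteq> U \<inter> V"
    proof
      fix y assume y: "y \<in> {y \<in> X. \<forall>p\<in>P \<union> P'. p (y - x) < min e e'}"
      then have "y \<in> {y \<in> X. \<forall>p\<in>P. p (y - x) < e}" "y \<in> {y \<in> X. \<forall>p\<in>P'. p (y - x) < e'}"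
        by auto
      then show "y \<in> U \<inter> V" using P(4) P'(4) by blast
    qed
    then show ?case
      using P P' by (intro exI[of _ "P \<union> P'"] exI[of _ "min e e'"]) auto
  next
    case (UN \<U>)
    then obtain U where U: "U \<in> \<U>" "x \<in> U" by blast
    from UN.IH[OF U] obtain P e
      where "finite P" "P \<subseteq> Q" "0 < e" "{y \<in> X. \<forall>p\<in>P. p (y - x) < e} \<subseteq> U"
      by (elim exE conjE)
    then show ?case using U by (intro exI[of _ P] exI[of _ e]) auto
  next
    case (Basis U)
    then consider "U = X" | p z r where "U = {y \<in> X. p (y - z) < r}" "p \<in> Q" "z \<in> X" "0 < r"
      by blast
    then show ?case
    proof cases
      case 1
      then show ?thesis by (intro exI[of _ "{}"] exI[of _ 1]) auto
    next
      case 2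
      then have x: "x \<in> X" "p (x - z) < r" using Basis by auto
      have "{y \<in> X. \<forall>p\<in>{p}. p (y - x) < r - p (x - z)} \<subseteq> U"
      proof
        fix y assume "y \<in> {y \<in> X. \<forall>p\<in>{p}. p (y - x) < r - p (x - z)}"
        then have "y \<in> X" "p (y - x) < r - p (x - z)" by auto
        then show "y \<in> U"
          using seminorm_triangle[OF 2(2) _ x(1) 2(3), of y] by (simp add: 2(1))
      qed
      then show ?thesis
        using 2 x by (intro exI[of _ "{p}"] exI[of _ "r - p (x - z)"]) auto
    qed
  qed auto
qed

lemma Hausdorff_iff_separated:
  "Hausdorff_space \<tau> \<longleftrightarrow> (\<forall>x\<in>X. (\<forall>p\<in>Q. p x = 0) \<longrightarrow> x = 0)"
proof
  assume H: "Hausdorff_space \<tau>"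
  show "\<forall>x\<in>X. (\<forall>p\<in>Q. p x = 0) \<longrightarrow> x = 0"
  proof (intro ballI impI, rule ccontr)
    fix x assume x: "x \<in> X" "\<forall>p\<in>Q. p x = 0" "x \<noteq> 0"
    then obtain U V where UV: "openin \<tau> U" "openin \<tau> V" "0 \<in> U" "x \<in> V" "disjnt U V"
      using H unfolding Hausdorff_space_def by (metis X_zero topspace_seminorm)
    from openin_seminorm_nhd[OF UV(1,3)]
    obtain P e where "P \<subseteq> Q" "0 < e" "{y \<in> X. \<forall>p\<in>P. p (y - 0) < e} \<subseteq> U"
      by (elim exE conjE)
    moreover have "p (x - 0) < e" if "p \<in> P" for p
    proof -
      have "p x = 0" using x(2) subsetD[OF \<open>P \<subseteq> Q\<close> that] by blast
      then show ?thesis using \<open>0 < e\<close> by simp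
    qed
    then have "x \<in> {y \<in> X. \<forall>p\<in>P. p (y - 0) < e}"
      using x(1) by blast
    ultimately have "x \<in> U" by blast
    then show False using UV by (auto simp: disjnt_def)
  qed
next
  assume sep: "\<forall>x\<in>X. (\<forall>p\<in>Q. p x = 0) \<longrightarrow> x = 0"
  show "Hausdorff_space \<tau>"
    unfolding Hausdorff_space_def topspace_seminorm
  proof (intro allI impI, elim conjE)
    fix x y assume xy: "x \<in> X" "y \<in> X" "x \<noteq> y"
    then obtain p where p: "p \<in> Q" "p (x - y) \<noteq> 0"
      using sep by (metis X_diff eq_iff_diff_eq_0)
    define r where "r = p (x - y) / 2"
    have r: "0 < r" using p xy seminorm_nonneg[of p "x - y"] by (simp add: r_def)
    have sym: "p (x - z) = p (z - x)" if "z \<in> X" for z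
      using seminorm_scale[OF p(1), of "z - x" "-1"] xy that by simp
    have "disjnt {z \<in> X. p (z - x) < r} {z \<in> X. p (z - y) < r}"
    proof (unfold disjnt_iff, intro allI notI, elim conjE)
      fix z assume "z \<in> {z \<in> X. p (z - x) < r}" "z \<in> {z \<in> X. p (z - y) < r}"
      then have "z \<in> X" "p (z - x) + p (z - y) < p (x - y)" by (auto simp: r_def)
      then show False
        using seminorm_triangle[OF p(1), of x z y] sym[of z] xy by simp
    qed
    then show "\<exists>U V. openin \<tau> U \<and> openin \<tau> V \<and> x \<in> U \<and> y \<in> V \<and> disjnt U V"
      using openin_ball[OF p(1) xy(1) r] openin_ball[OF p(1) xy(2) r] seminorm_zero[OF p(1)] xy r
      by (metis (mono_tags, lifting) diff_self mem_Collect_eq)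
  qed
qed

lemma continuous_dualI:
  assumes add: "\<And>x y. x \<in> X \<Longrightarrow> y \<in> X \<Longrightarrow> \<phi> (x + y) = \<phi> x + \<phi> y"
    and scale: "\<And>c x. x \<in> X \<Longrightarrow> \<phi> (smul c x) = c * \<phi> x"
    and p: "p \<in> Q" and bound: "\<And>x. x \<in> X \<Longrightarrow> norm (\<phi> x) \<le> C * p x"
  shows "\<phi> \<in> continuous_dual smul X Q"
proof -
  have diff: "\<phi> y - \<phi> x = \<phi> (y - x)" if "x \<in> X" "y \<in> X" for x y
    using add[of "y - x" x] that by simp
  \<comment> \<open>\<open>C\<close> may be zero or negative; the radius \<open>e / B\<close> below
    calls for a positive constant.\<close>
  define B where "B = \<bar>C\<bar> + 1"
  have B: "0 < B" by (simp add: B_def)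
  have bound': "norm (\<phi> x) \<le> B * p x" if "x \<in> X" for x
  proof -
    have "C * p x \<le> B * p x"
      using seminorm_nonneg[OF p that] by (intro mult_right_mono) (auto simp: B_def)
    then show ?thesis using bound[OF that] by linarith
  qed
  have "openin \<tau> {x \<in> X. \<phi> x \<in> U}" if U: "open U" for U
  proof (subst openin_subopen, intro ballI)
    fix x assume "x \<in> {x \<in> X. \<phi> x \<in> U}"
    then have x: "x \<in> X" "\<phi> x \<in> U" by auto
    then obtain e where e: "0 < e" "ball (\<phi> x) e \<subseteq> U"
      using U open_contains_ball by blast
    have "{y \<in> X. p (y - x) < e / B} \<subseteq> {x \<in> X. \<phi> x \<in> U}"
    proof safe
      fix y assume y: "y \<in> X" "p (y - x) < e / B"
      have "norm (\<phi> y - \<phi> x) \<le> B * p (y - x)"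
        using bound'[of "y - x"] diff x y by simp
      also have "\<dots> < e" using y B by (simp add: field_simps)
      finally show "\<phi> y \<in> U" using e by (auto simp: dist_norm norm_minus_commute)
    qed
    then show "\<exists>V. openin \<tau> V \<and> x \<in> V \<and> V \<subseteq> {x \<in> X. \<phi> x \<in> U}"
      using openin_ball[OF p x(1), of "e / B"] e B x seminorm_zero[OF p]
      by (intro exI[of _ "{y \<in> X. p (y - x) < e / B}"]) simp
  qed
  then have "continuous_map \<tau> euclidean \<phi>"
    by (simp add: continuous_map_def)
  then show ?thesis using add scale by (simp add: continuous_dual_def)
qed

lemma openin_weak: "\<psi> \<in> continuous_dual smul X Q \<Longrightarrow> open U \<Longrightarrow> openin \<omega> {x \<in> X. \<psi> x \<in> U}"
  unfolding weak_topology_def by (rule topology_generated_by_Basis) blast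

lemma topspace_weak [simp]: "topspace \<omega> = X"
proof
  show "topspace \<omega> \<subseteq> X" by (auto simp: weak_topology_def)
  have "(\<lambda>_. 0) \<in> continuous_dual smul X Q" by (simp add: continuous_dual_def)
  from openin_weak[OF this open_UNIV] show "X \<subseteq> topspace \<omega>"
    using openin_subset by fastforce
qed

lemma continuous_map_dual: "\<psi> \<in> continuous_dual smul X Q \<Longrightarrow> continuous_map \<omega> euclidean \<psi>"
  using openin_weak by (simp add: continuous_map_def)

lemma openin_weak_seminorm:
  assumes "openin \<omega> U"
  shows "openin \<tau> U"
proof -
  have "generate_topology_on {{x \<in> X. \<phi> x \<in> U} | \<phi> U. \<phi> \<in> continuous_dual smul X Q \<and> open U} U"
    using assms unfolding weak_topology_def openin_topology_generated_by_iff .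
  then show ?thesis
  proof (induction U rule: generate_topology_on.induct)
    case (Basis U)
    then obtain \<phi> V where "U = {x \<in> X. \<phi> x \<in> V}" "\<phi> \<in> continuous_dual smul X Q" "open V" by blast
    then show ?case
      using openin_continuous_map_preimage[of \<tau> euclidean \<phi> V] by (simp add: continuous_dual_def)
  qed auto
qed

text \<open>Restriction of scalars: over the reals the space falls under the Hahn-Banach results,
  whatever \<open>'k\<close> is.\<close>

sublocale re: real_subspace "\<lambda>r. smul (of_real r)" X
proof -
  interpret r: vector_space "\<lambda>r. smul (of_real r)"
    by unfold_locales (simp_all add: scale_right_distrib scale_left_distrib)
  show "real_subspace (\<lambda>r. smul (of_real r)) X"
    by unfold_locales (simp add: r.subspace_def)
qed

lemma seminorm_re: "p \<in> Q \<Longrightarrow> seminorm_on (\<lambda>r. smul (of_real r)) X p"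
  using seminorm[of p] by (simp add: seminorm_on_def)

text \<open>The map \<open>\<rho>\<close> is the identity for real and the real part for complex scalars.\<close>

lemma fixed_point_of_mean:
  fixes act :: "'s::semitopological_semigroup \<Rightarrow> 'x \<Rightarrow> 'x" and \<rho> :: "'k \<Rightarrow> real"
  assumes \<mu>: "left_invariant_mean (almost_periodic :: ('s \<Rightarrow>\<^sub>C complex) set) \<mu>"
    and \<rho>: "continuous_on UNIV \<rho>" "\<rho> 0 = 0"
    and extend: "\<And>p \<phi>. p \<in> Q \<Longrightarrow> \<phi> \<in> re.dominated p \<Longrightarrow>
      \<exists>\<psi>\<in>continuous_dual smul X Q. \<forall>x\<in>X. \<phi> x = \<rho> (\<psi> x)"
    and H: "Hausdorff_space \<tau>"
    and K: "K \<noteq> {}" "K \<subseteq> X" "convex_in smul K" "compactin \<omega> K"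
    and act: "dynamical_system act (subtopology \<omega> K)" "nonexpansive_action Q act K"
      "equicontinuous_action \<omega> act K"
  shows "\<exists>x\<in>K. \<forall>s. act s x = x"
proof -
  have top: "topspace (subtopology \<omega> K) = K" using K by auto
  have actK: "act s x \<in> K" if "x \<in> K" for s x
    using act(1) that unfolding dynamical_system_def top by blast
  interpret nonexpansive_system "\<lambda>r. smul (of_real r)" X Q K "subtopology \<omega> K" act
  proof unfold_locales
    show "seminorm_on (\<lambda>r. smul (of_real r)) X p" if "p \<in> Q" for p
      using seminorm_re[OF that] .
    show "x = 0" if "x \<in> X" "\<And>p. p \<in> Q \<Longrightarrow> p x = 0" for x
      using H that unfolding Hausdorff_iff_separated by blast
    show "convex_in (\<lambda>r. smul (of_real r)) K"
      using K(3) by (simp add: convex_in_def)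
    show "compact_space (subtopology \<omega> K)"
      using K(4) by (rule compact_space_subtopology)
  next
    fix p \<phi> assume p: "p \<in> Q" "\<phi> \<in> re.dominated p"
    then obtain \<psi> where \<psi>: "\<psi> \<in> continuous_dual smul X Q" "\<And>x. x \<in> X \<Longrightarrow> \<phi> x = \<rho> (\<psi> x)"
      using extend by blast
    have "continuous_map \<omega> euclideanreal (\<rho> \<circ> \<psi>)"
      using \<psi>(1) \<rho>(1) by (intro continuous_map_compose[OF continuous_map_dual]) auto
    then have "continuous_map \<omega> euclideanreal \<phi>"
      by (rule continuous_map_eq) (simp add: \<psi>)
    then show "continuous_map (subtopology \<omega> K) euclideanreal \<phi>"
      by (rule continuous_map_from_subtopology)
    fix x e assume x: "x \<in> K" and e: "0 < (e::real)"
    have "\<psi> (smul 0 0) = 0 * \<psi> 0"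
      using \<psi>(1) X_zero unfolding continuous_dual_def by blast
    then have "\<psi> 0 = 0" by simp
    then have "0 \<in> {y \<in> X. \<psi> y \<in> \<rho> -` ball 0 e}" using \<rho>(2) e by simp
    moreover have "open (\<rho> -` ball 0 e)"
      using \<rho>(1) by (intro open_vimage) auto
    note openin_weak[OF \<psi>(1) this]
    \<comment> \<open>Equicontinuity is applied to the weak neighbourhood of 0 cut out by \<psi>;
      additivity of \<phi> converts it into a bound on the change of \<phi>.\<close>
    ultimately have "openin \<omega> {y \<in> X. \<psi> y \<in> \<rho> -` ball 0 e} \<and> 0 \<in> {y \<in> X. \<psi> y \<in> \<rho> -` ball 0 e}"
      by blast
    from act(3)[unfolded equicontinuous_action_def, rule_format, OF x this]
    obtain V where V: "openin \<omega> V" "x \<in> V"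
      "\<forall>s. \<forall>y\<in>V \<inter> K. act s y - act s x \<in> {y \<in> X. \<psi> y \<in> \<rho> -` ball 0 e}"
      by (elim exE conjE)
    have "\<bar>\<phi> (act s y) - \<phi> (act s x)\<bar> < e" if y: "y \<in> V \<inter> K" for s y
    proof -
      have "act s y \<in> X" "act s x \<in> X" using actK x y K by auto
      then have "\<phi> (act s y) - \<phi> (act s x) = \<rho> (\<psi> (act s y - act s x))"
        using p(2) \<psi>(2)[of "act s y - act s x"] by (simp add: re.dominated_def re.linear_onD)
      then show ?thesis using V(3)[rule_format, OF y, of s] by simp
    qed
    then show "\<exists>V. openin (subtopology \<omega> K) V \<and> x \<in> V \<and> (\<forall>s. \<forall>y\<in>V. \<bar>\<phi> (act s y) - \<phi> (act s x)\<bar> < e)"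
      using V x by (intro exI[of _ "V \<inter> K"]) (auto simp: openin_subtopology)
  qed (use K act top in auto)
  show ?thesis using fixed_point[OF \<mu>] .
qed

end

lemma seminormed_space_of_locally_convex:
  assumes "locally_convex_space smul X Q"
  shows "seminormed_space smul X Q"
proof -
  interpret vector_space smul using assms by (simp add: locally_convex_space_def)
  show ?thesis using assms by unfold_locales (auto simp: locally_convex_space_def)
qed

lemma fixed_point_property_real:
  assumes \<mu>: "left_invariant_mean (almost_periodic :: ('s::semitopological_semigroup \<Rightarrow>\<^sub>C complex) set) \<mu>"
  shows "fixed_point_property_E TYPE('s) TYPE(real) TYPE('x::ab_group_add)"
  unfolding fixed_point_property_E_def
proof (intro allI impI, elim conjE)
  fix smul :: "real \<Rightarrow> 'x \<Rightarrow> 'x" and X Q K and act :: "'s \<Rightarrow> 'x \<Rightarrow> 'x"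
  assume lcs: "locally_convex_space smul X Q"
    and K: "K \<noteq> {}" "K \<subseteq> X" "convex_in smul K" "compactin (weak_topology smul X Q) K"
    and act: "dynamical_system act (subtopology (weak_topology smul X Q) K)"
      "nonexpansive_action Q act K" "equicontinuous_action (weak_topology smul X Q) act K"
  interpret seminormed_space smul X Q using seminormed_space_of_locally_convex[OF lcs] .
  show "\<exists>x\<in>K. \<forall>s. act s x = x"
  proof (rule fixed_point_of_mean[OF \<mu>, of "\<lambda>r. r"])
    fix p \<phi> assume p: "p \<in> Q" and \<phi>: "\<phi> \<in> re.dominated p"
    have lin: "re.linear_on \<phi>" using \<phi> unfolding re.dominated_def by blast
    have "\<bar>\<phi> x\<bar> \<le> 1 * p x" if "x \<in> X" for x
      using re.dominated_abs[OF seminorm_re[OF p] \<phi> that X_zero] re.linear_onD(3)[OF lin] by simp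
    then have "\<phi> \<in> continuous_dual smul X Q"
      using lin[unfolded re.linear_on_def] by (intro continuous_dualI[OF _ _ p, of _ 1]) auto
    then show "\<exists>\<psi>\<in>continuous_dual smul X Q. \<forall>x\<in>X. \<phi> x = \<psi> x" by blast
  qed (use lcs K act in \<open>auto simp: locally_convex_space_def\<close>)
qed

text \<open>A complex-linear functional is recovered from its real part \<open>\<phi>\<close> as \<open>\<phi> x - \<i> \<phi> (\<i> x)\<close>.\<close>

lemma fixed_point_property_complex:
  assumes \<mu>: "left_invariant_mean (almost_periodic :: ('s::semitopological_semigroup \<Rightarrow>\<^sub>C complex) set) \<mu>"
  shows "fixed_point_property_E TYPE('s) TYPE(complex) TYPE('x::ab_group_add)"
  unfolding fixed_point_property_E_def
proof (intro allI impI, elim conjE)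
  fix smul :: "complex \<Rightarrow> 'x \<Rightarrow> 'x" and X Q K and act :: "'s \<Rightarrow> 'x \<Rightarrow> 'x"
  assume lcs: "locally_convex_space smul X Q"
    and K: "K \<noteq> {}" "K \<subseteq> X" "convex_in smul K" "compactin (weak_topology smul X Q) K"
    and act: "dynamical_system act (subtopology (weak_topology smul X Q) K)"
      "nonexpansive_action Q act K" "equicontinuous_action (weak_topology smul X Q) act K"
  interpret seminormed_space smul X Q using seminormed_space_of_locally_convex[OF lcs] .
  show "\<exists>x\<in>K. \<forall>s. act s x = x"
  proof (rule fixed_point_of_mean[OF \<mu>, of Re])
    fix p \<phi> assume p: "p \<in> Q" and \<phi>: "\<phi> \<in> re.dominated p"
    have lin: "re.linear_on \<phi>" using \<phi> unfolding re.dominated_def by blast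
    define \<psi> where "\<psi> = (\<lambda>x. complex_of_real (\<phi> x) - \<i> * complex_of_real (\<phi> (smul \<i> x)))"
    have add: "\<phi> (x + y) = \<phi> x + \<phi> y" and scale: "\<phi> (smul (of_real r) x) = r * \<phi> x"
      if "x \<in> X" "y \<in> X" for x y r
      using lin that unfolding re.linear_on_def by auto
    have abs: "\<bar>\<phi> x\<bar> \<le> p x" if "x \<in> X" for x
      using re.dominated_abs[OF seminorm_re[OF p] \<phi> that X_zero] re.linear_onD(3)[OF lin] by simp
    have "\<psi> \<in> continuous_dual smul X Q"
    proof (rule continuous_dualI[OF _ _ p, of _ 2])
      fix x y assume xy: "x \<in> X" "y \<in> X"
      show "\<psi> (x + y) = \<psi> x + \<psi> y"
        using xy by (simp add: \<psi>_def add scale_right_distrib algebra_simps)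
    next
      fix c x assume x: "x \<in> X"
      have c: "c = of_real (Re c) + of_real (Im c) * \<i>" by (simp add: complex_eq_iff)
      have "smul c x = smul (of_real (Re c)) x + smul (of_real (Im c)) (smul \<i> x)"
        by (subst c) (simp add: scale_left_distrib)
      then have 1: "\<phi> (smul c x) = Re c * \<phi> x + Im c * \<phi> (smul \<i> x)"
        using x by (simp only: add scale X_scale)
      have "\<i> * c = of_real (Re c) * \<i> + of_real (- Im c)" by (simp add: complex_eq_iff)
      then have "smul \<i> (smul c x) = smul (of_real (Re c)) (smul \<i> x) + smul (of_real (- Im c)) x"
        by (simp only: scale_scale scale_left_distrib)
      then have 2: "\<phi> (smul \<i> (smul c x)) = Re c * \<phi> (smul \<i> x) + (- Im c) * \<phi> x"
        using x by (simp only: add scale X_scale)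
      show "\<psi> (smul c x) = c * \<psi> x"
        unfolding \<psi>_def 1 2 by (simp add: complex_eq_iff)
    next
      fix x assume x: "x \<in> X"
      have "norm (\<psi> x) \<le> \<bar>\<phi> x\<bar> + \<bar>\<phi> (smul \<i> x)\<bar>"
        unfolding \<psi>_def by (rule norm_triangle_ineq4[THEN order_trans]) (simp add: norm_mult)
      \<comment> \<open>Multiplication by \<i> preserves \<open>p\<close>, so \<phi> contributes at
        most \<open>p x\<close> at each of the points \<open>x\<close> and
        \<open>\<i> x\<close>.\<close>
      also have "\<dots> \<le> 2 * p x"
        using abs[OF x] abs[of "smul \<i> x"] seminorm_scale[OF p x, of \<i>] x by simp
      finally show "norm (\<psi> x) \<le> 2 * p x" .
    qed
    then show "\<exists>\<psi>\<in>continuous_dual smul X Q. \<forall>x\<in>X. \<phi> x = Re (\<psi> x)"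
      by (intro bexI[of _ \<psi>]) (simp_all add: \<psi>_def)
  qed (use lcs K act in \<open>auto simp: locally_convex_space_def intro: continuous_intros\<close>)
qed

section \<open>The space of means\<close>

text \<open>Without an identity \<open>f\<close> need not be among its own translates; inserting it
  makes the orbit seminorm dominate the evaluation at \<open>f\<close>.\<close>

definition orbit :: "('s::semitopological_semigroup \<Rightarrow>\<^sub>C complex) \<Rightarrow> ('s \<Rightarrow>\<^sub>C complex) set" where
  "orbit f = insert f (range (\<lambda>s. left_translate s f))"

definition orbit_seminorm ::
  "('s::semitopological_semigroup \<Rightarrow>\<^sub>C complex) \<Rightarrow> 's functional \<Rightarrow> real" where
  "orbit_seminorm f \<phi> = (SUP g\<in>orbit f. cmod (\<phi> g))"

text \<open>Boundedness keeps the orbit suprema finite. Vanishing off \<open>almost_periodic\<close>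
  makes an element determined by its values there, as the Hausdorff property requires. Linearity is
  imposed on the means only.\<close>

definition dual_space :: "'s::semitopological_semigroup functional set" where
  "dual_space = {\<phi>. (\<forall>f. f \<notin> almost_periodic \<longrightarrow> \<phi> f = 0) \<and>
     (\<exists>B. \<forall>f\<in>almost_periodic. cmod (\<phi> f) \<le> B * norm f)}"

definition orbit_seminorms :: "('s::semitopological_semigroup functional \<Rightarrow> real) set" where
  "orbit_seminorms = orbit_seminorm ` almost_periodic"

text \<open>The bound covers every \<open>f\<close>, with radius 0 off
  \<open>almost_periodic\<close>, so that the means sit inside a product of discs.\<close>

definition means :: "'s::semitopological_semigroup functional set" where
  "means = {\<phi>. (\<forall>f. cmod (\<phi> f) \<le> (if f \<in> almost_periodic then norm f else 0)) \<and>
     (\<forall>f\<in>almost_periodic. \<forall>g\<in>almost_periodic. \<phi> (f + g) = \<phi> f + \<phi> g) \<and>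
     (\<forall>c. \<forall>f\<in>almost_periodic. \<phi> (cscale c f) = c * \<phi> f) \<and>
     \<phi> (const_bcontfun 1) = 1}"

text \<open>Left translations compose in reverse order; passing to the dual restores a left
  action.\<close>

definition dual_act ::
  "'s::semitopological_semigroup \<Rightarrow> 's functional \<Rightarrow> 's functional" where
  "dual_act s \<phi> = (\<lambda>f. if f \<in> almost_periodic then \<phi> (left_translate s f) else 0)"

section \<open>Orbit seminorms and the compact set of means\<close>

lemma orbit_almost_periodic: "f \<in> almost_periodic \<Longrightarrow> g \<in> orbit f \<Longrightarrow> g \<in> almost_periodic"
  by (auto simp: orbit_def)

lemma norm_orbit_le: "g \<in> orbit f \<Longrightarrow> norm g \<le> norm f"
  by (auto simp: orbit_def norm_left_translate_le)

lemma left_translate_orbit: "g \<in> orbit f \<Longrightarrow> left_translate s g \<in> orbit f"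
  by (auto simp: orbit_def)

lemma self_orbit: "f \<in> orbit f"
  by (simp add: orbit_def)

lemma orbit_seminorm_bdd:
  assumes "\<phi> \<in> dual_space" "f \<in> almost_periodic"
  shows "bdd_above ((\<lambda>g. cmod (\<phi> g)) ` orbit f)"
proof -
  obtain B where B: "\<And>g. g \<in> almost_periodic \<Longrightarrow> cmod (\<phi> g) \<le> B * norm g"
    using assms(1) by (auto simp: dual_space_def)
  have "cmod (\<phi> g) \<le> \<bar>B\<bar> * norm f" if g: "g \<in> orbit f" for g
  proof -
    have "cmod (\<phi> g) \<le> B * norm g" using B orbit_almost_periodic[OF assms(2) g] .
    also have "\<dots> \<le> \<bar>B\<bar> * norm f" using norm_orbit_le[OF g] by (intro mult_mono) auto
    finally show ?thesis .
  qed
  then show ?thesis by (intro bdd_aboveI2)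
qed

lemma orbit_seminorm_upper:
  "\<phi> \<in> dual_space \<Longrightarrow> f \<in> almost_periodic \<Longrightarrow> g \<in> orbit f \<Longrightarrow> cmod (\<phi> g) \<le> orbit_seminorm f \<phi>"
  unfolding orbit_seminorm_def by (intro cSUP_upper orbit_seminorm_bdd)

lemma orbit_seminorm_least: "(\<And>g. g \<in> orbit f \<Longrightarrow> cmod (\<phi> g) \<le> r) \<Longrightarrow> orbit_seminorm f \<phi> \<le> r"
  unfolding orbit_seminorm_def using self_orbit by (intro cSUP_least) auto

lemma dual_space_add:
  assumes "\<phi> \<in> dual_space" "\<psi> \<in> dual_space"
  shows "\<phi> + \<psi> \<in> dual_space"
proof -
  obtain B C where "\<forall>g\<in>almost_periodic. cmod (\<phi> g) \<le> B * norm g"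
    "\<forall>g\<in>almost_periodic. cmod (\<psi> g) \<le> C * norm g"
    using assms by (auto simp: dual_space_def)
  then have "\<forall>g\<in>almost_periodic. cmod ((\<phi> + \<psi>) g) \<le> (B + C) * norm g"
    by (auto simp: distrib_right intro: norm_triangle_mono)
  moreover have "\<forall>g. g \<notin> almost_periodic \<longrightarrow> (\<phi> + \<psi>) g = 0"
    using assms by (simp add: dual_space_def)
  ultimately show ?thesis unfolding dual_space_def by blast
qed

lemma dual_space_scale:
  assumes "\<phi> \<in> dual_space"
  shows "(\<lambda>f. c * \<phi> f) \<in> dual_space"
proof -
  obtain B where "\<forall>g\<in>almost_periodic. cmod (\<phi> g) \<le> B * norm g"
    using assms by (auto simp: dual_space_def)
  then have "\<forall>g\<in>almost_periodic. cmod (c * \<phi> g) \<le> (cmod c * B) * norm g"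
    by (simp add: norm_mult mult.assoc mult_left_mono)
  moreover have "\<forall>g. g \<notin> almost_periodic \<longrightarrow> c * \<phi> g = 0"
    using assms by (simp add: dual_space_def)
  ultimately show ?thesis unfolding dual_space_def by blast
qed

lemma means_dual_space: "\<phi> \<in> means \<Longrightarrow> \<phi> \<in> dual_space"
  unfolding means_def dual_space_def
  by (auto intro!: exI[of _ 1] split: if_splits)

lemma means_norm_le:
  assumes "\<phi> \<in> means" "f \<in> almost_periodic"
  shows "cmod (\<phi> f) \<le> norm f"
proof -
  have "cmod (\<phi> f) \<le> (if f \<in> almost_periodic then norm f else 0)"
    using assms(1) unfolding means_def by simp
  then show ?thesis using assms(2) by simp
qed

lemma means_lipschitz:
  assumes "\<phi> \<in> means" "f \<in> almost_periodic" "g \<in> almost_periodic"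
  shows "cmod (\<phi> f - \<phi> g) \<le> norm (f - g)"
proof -
  have "\<phi> ((f - g) + g) = \<phi> (f - g) + \<phi> g"
    using assms almost_periodic_diff unfolding means_def by blast
  then have "\<phi> f - \<phi> g = \<phi> (f - g)" by simp
  then show ?thesis using means_norm_le[OF assms(1)] assms by simp
qed

lemma dual_act_means:
  assumes "\<phi> \<in> means"
  shows "dual_act s \<phi> \<in> means"
proof -
  have "cmod (dual_act s \<phi> f) \<le> norm f" if "f \<in> almost_periodic" for f
  proof -
    have "cmod (\<phi> (left_translate s f)) \<le> norm (left_translate s f)"
      using means_norm_le[OF assms] that by simp
    then show ?thesis using norm_left_translate_le[of s f] that by (simp add: dual_act_def)
  qed
  then show ?thesis
    using assms by (auto simp: means_def dual_act_def left_translate_add left_translate_cscale)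
qed

lemma means_nonempty: "means \<noteq> {}"
proof -
  fix t :: 'a
  have "(\<lambda>f. if f \<in> almost_periodic then apply_bcontfun f t else 0) \<in> means"
    by (auto simp: means_def const_bcontfun.rep_eq norm_bounded)
  then show ?thesis by auto
qed

lemma continuous_on_coordinate: "continuous_on A (\<lambda>\<phi>. \<phi> f)"
  using continuous_on_subset[OF continuous_on_product_coordinates subset_UNIV] .

text \<open>As for Banach-Alaoglu: the remaining conditions involve finitely many coordinates each
  and are closed, and the product of discs is compact by Tychonoff.\<close>

lemma compact_means: "compact means"
proof -
  define P :: "'a functional set"
    where "P = (\<Pi>\<^sub>E f\<in>UNIV. cball 0 (if f \<in> almost_periodic then norm f else 0))"
  have "compactin (product_topology (\<lambda>_. euclidean) UNIV) P"
    unfolding P_def by (subst compactin_PiE) auto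
  then have P: "compact P" by (simp add: euclidean_product_topology)
  define C :: "'a functional set" where "C =
     (\<Inter>f\<in>almost_periodic. \<Inter>g\<in>almost_periodic. {\<phi>. \<phi> (f + g) = \<phi> f + \<phi> g}) \<inter>
     (\<Inter>c. \<Inter>f\<in>almost_periodic. {\<phi>. \<phi> (cscale c f) = c * \<phi> f}) \<inter> {\<phi>. \<phi> (const_bcontfun 1) = 1}"
  have "closed C"
    unfolding C_def
    by (intro closed_Int closed_INT ballI closed_Collect_eq continuous_intros continuous_on_coordinate)
  moreover have P_iff: "\<phi> \<in> P \<longleftrightarrow> (\<forall>f. cmod (\<phi> f) \<le> (if f \<in> almost_periodic then norm f else 0))" for \<phi>
    by (simp add: P_def PiE_iff)
  have "means = P \<inter> C"
    unfolding set_eq_iff means_def C_def Int_iff P_iff mem_Collect_eq INT_iff by blast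
  ultimately show ?thesis using compact_Int_closed[OF P] by metis
qed

text \<open>On the means the topology of uniform convergence on orbits, which are relatively compact,
  agrees with pointwise convergence.\<close>

lemma orbit_seminorm_continuous:
  assumes f: "f \<in> almost_periodic" and y: "y \<in> means" and r: "0 < r"
  shows "\<exists>U. open U \<and> y \<in> U \<and> (\<forall>z\<in>means. z \<in> U \<longrightarrow> orbit_seminorm f (z - y) < r)"
proof -
  have "compact (closure (orbit f))"
    using f by (simp add: orbit_def closure_insert almost_periodic_def)
  moreover have "closure (orbit f) \<subseteq> (\<Union>g\<in>orbit f. ball g (r/4))"
  proof
    fix h assume "h \<in> closure (orbit f)"
    moreover have "0 < r/4" using r by simp
    ultimately have "\<exists>g\<in>orbit f. dist g h < r/4" unfolding closure_approachable by blast
    then show "h \<in> (\<Union>g\<in>orbit f. ball g (r/4))" by simp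
  qed
  ultimately obtain D where D: "D \<subseteq> orbit f" "finite D" "closure (orbit f) \<subseteq> (\<Union>g\<in>D. ball g (r/4))"
    using compactE_image[of "closure (orbit f)" "orbit f" "\<lambda>g. ball g (r/4)"] by auto
  \<comment> \<open>Closeness on a finite \<open>r / 4\<close>-net of the orbit suffices: means are
    1-Lipschitz, so moving from \<open>h\<close> to the net costs \<open>r / 4\<close> for each of
    \<open>z\<close> and \<open>y\<close>.\<close>
  define U :: "'a functional set" where "U = (\<Inter>g\<in>D. {z. cmod (z g - y g) < r/4})"
  show ?thesis
  proof (intro exI conjI ballI impI)
    show "open U"
      unfolding U_def using D(2)
      by (intro open_INT ballI open_Collect_less continuous_intros continuous_on_coordinate)
    show "y \<in> U" using r by (simp add: U_def)
    fix z assume z: "z \<in> means" "z \<in> U"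
    have "orbit_seminorm f (z - y) \<le> 3 * (r/4)"
    proof (rule orbit_seminorm_least)
      fix h assume h: "h \<in> orbit f"
      then obtain g where g: "g \<in> D" "dist g h < r/4"
        using D(3) closure_subset[of "orbit f"] by auto
      have ap: "g \<in> almost_periodic" "h \<in> almost_periodic"
        using D(1) g h orbit_almost_periodic[OF f] by auto
      have "cmod (z h - z g) < r/4" "cmod (y g - y h) < r/4"
        using means_lipschitz[OF z(1) ap(2,1)] means_lipschitz[OF y ap] g(2)
        by (auto simp: dist_norm norm_minus_commute)
      moreover have "cmod (z g - y g) < r/4" using z(2) g by (auto simp: U_def)
      moreover have "cmod (z h - y h) \<le> cmod (z h - z g) + cmod (z g - y g) + cmod (y g - y h)"
        using norm_triangle_ineq[of "z h - z g" "z g - y g"]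
          norm_triangle_ineq[of "z h - y g" "y g - y h"] by simp
      ultimately show "cmod ((z - y) h) \<le> 3 * (r/4)" by simp
    qed
    then show "orbit_seminorm f (z - y) < r" using r by simp
  qed
qed

text \<open>\<open>emb\<close> will be the identity of the complex numbers or the embedding of the
  reals, so one argument serves both scalar fields.\<close>

lemma dual_space_seminormed:
  fixes emb :: "'k::real_normed_field \<Rightarrow> complex"
  assumes emb: "\<And>a b. emb (a + b) = emb a + emb b" "\<And>a b. emb (a * b) = emb a * emb b" "emb 1 = 1"
    and norm_emb: "\<And>a. cmod (emb a) = norm a"
  shows "seminormed_space (\<lambda>c \<phi> f. emb c * \<phi> f)
    (dual_space :: 's::semitopological_semigroup functional set) orbit_seminorms"
proof -
  interpret vector_space "\<lambda>c (\<phi> :: 's functional) f. emb c * \<phi> f"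
    by unfold_locales (auto simp: fun_eq_iff emb algebra_simps)
  show ?thesis
  proof unfold_locales
    have "(0 :: 's functional) \<in> dual_space"
      by (auto simp: dual_space_def intro: exI[of _ 0])
    then show "subspace (dual_space :: 's functional set)"
      by (auto simp: subspace_def dual_space_add dual_space_scale)
    fix p :: "'s functional \<Rightarrow> real" assume "p \<in> orbit_seminorms"
    then obtain f where f: "f \<in> almost_periodic" "p = orbit_seminorm f"
      by (auto simp: orbit_seminorms_def)
    have up: "cmod (\<phi> g) \<le> p \<phi>" if "\<phi> \<in> dual_space" "g \<in> orbit f" for \<phi> g
      using orbit_seminorm_upper f that by auto
    have least: "p \<phi> \<le> r" if "\<And>g. g \<in> orbit f \<Longrightarrow> cmod (\<phi> g) \<le> r" for \<phi> r
      unfolding f(2) using that by (rule orbit_seminorm_least)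
    have scale_le: "p (\<lambda>f. c * \<phi> f) \<le> cmod c * p \<phi>" if "\<phi> \<in> dual_space" for c \<phi>
      using up[OF that] by (intro least) (simp add: norm_mult mult_left_mono)
    show "seminorm_on (\<lambda>c \<phi> f. emb c * \<phi> f) dual_space p"
      unfolding seminorm_on_def
    proof (intro conjI ballI allI)
      fix \<phi> :: "'s functional" assume \<phi>: "\<phi> \<in> dual_space"
      show "0 \<le> p \<phi>" using up[OF \<phi> self_orbit] norm_ge_zero order_trans by blast
      show "p (\<phi> + \<psi>) \<le> p \<phi> + p \<psi>" if \<psi>: "\<psi> \<in> dual_space" for \<psi>
        using up[OF \<phi>] up[OF \<psi>] by (intro least) (auto intro: norm_triangle_mono)
      fix c :: 'k
      show "p (\<lambda>f. emb c * \<phi> f) = norm c * p \<phi>"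
      proof (rule antisym)
        show "p (\<lambda>f. emb c * \<phi> f) \<le> norm c * p \<phi>"
          using scale_le[OF \<phi>, of "emb c"] norm_emb by simp
        show "norm c * p \<phi> \<le> p (\<lambda>f. emb c * \<phi> f)"
        proof (cases "c = 0")
          case True
          then show ?thesis
            using up[OF dual_space_scale[OF \<phi>] self_orbit, of "emb c"] norm_ge_zero order_trans
            by (metis mult_zero_left norm_zero)
        next
          case False
          then have c: "emb c \<noteq> 0" using norm_emb[of c] by auto
          \<comment> \<open>The reverse inequality is the same estimate for the inverse
            scalar.\<close>
          have "p (\<lambda>f. inverse (emb c) * (emb c * \<phi> f))
              \<le> cmod (inverse (emb c)) * p (\<lambda>f. emb c * \<phi> f)"
            by (rule scale_le[OF dual_space_scale[OF \<phi>]])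
          moreover have "(\<lambda>f. inverse (emb c) * (emb c * \<phi> f)) = \<phi>"
            using c by (simp flip: mult.assoc)
          ultimately have "p \<phi> \<le> p (\<lambda>f. emb c * \<phi> f) / norm c"
            by (simp add: norm_inverse norm_emb divide_inverse mult.commute)
          then show ?thesis
            using False by (simp add: pos_le_divide_eq mult.commute)
        qed
      qed
    qed
  qed
qed

section \<open>Left invariant means as fixed points\<close>

lemma left_invariant_mean_of_fixed:
  assumes \<phi>: "\<phi> \<in> means" and fixed: "\<And>s. dual_act s \<phi> = \<phi>"
  shows "left_invariant_mean (almost_periodic :: ('s::semitopological_semigroup \<Rightarrow>\<^sub>C complex) set) \<phi>"
proof -
  have le: "cmod (\<phi> f) \<le> norm f" if "f \<in> almost_periodic" for f
    using means_norm_le[OF \<phi> that] .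
  have one: "\<phi> (const_bcontfun 1) = 1" using \<phi> by (simp add: means_def)
  have "norm (const_bcontfun 1 :: 's \<Rightarrow>\<^sub>C complex) \<le> 1"
    by (rule norm_bound) (simp add: const_bcontfun.rep_eq)
  then have mem: "const_bcontfun 1 \<in> {f \<in> almost_periodic. norm (f :: 's \<Rightarrow>\<^sub>C complex) \<le> 1}" by simp
  have "dual_norm almost_periodic \<phi> = 1"
    unfolding dual_norm_def
  proof (rule antisym)
    have le1: "cmod (\<phi> f) \<le> 1" if "f \<in> {f \<in> almost_periodic. norm f \<le> 1}" for f
      using le[of f] that by simp
    show "(SUP f\<in>{f \<in> almost_periodic. norm f \<le> 1}. cmod (\<phi> f)) \<le> 1"
    proof (rule cSUP_least)
      show "{f \<in> almost_periodic. norm (f :: 's \<Rightarrow>\<^sub>C complex) \<le> 1} \<noteq> {}" using mem by blast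
    qed (rule le1)
    have "bdd_above ((\<lambda>f. cmod (\<phi> f)) ` {f \<in> almost_periodic. norm f \<le> 1})"
      using le1 by (rule bdd_aboveI2)
    from cSUP_upper[OF mem this]
    show "1 \<le> (SUP f\<in>{f \<in> almost_periodic. norm f \<le> 1}. cmod (\<phi> f))" by (simp add: one)
  qed
  moreover have "\<phi> (left_translate s f) = \<phi> f" if "f \<in> almost_periodic" for s f
    using fun_cong[OF fixed[of s], of f] that by (simp add: dual_act_def)
  moreover have "bounded_functional_on almost_periodic \<phi>"
    using \<phi> le unfolding bounded_functional_on_def means_def by (auto intro!: exI[of _ 1])
  ultimately show ?thesis using one by (simp add: left_invariant_mean_def)
qed

text \<open>Evaluations belong to the complex dual but, being complex valued, not to the real one.
  Their weak continuity is therefore the assumption \<open>eval\<close>, discharged separately for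
  each scalar field.\<close>

lemma mean_of_fixed_point_property:
  fixes emb :: "'k::real_normed_field \<Rightarrow> complex"
  defines "smul \<equiv> \<lambda>c (\<phi> :: 's::semitopological_semigroup functional) f. emb c * \<phi> f"
  assumes emb: "\<And>a b. emb (a + b) = emb a + emb b" "\<And>a b. emb (a * b) = emb a * emb b"
      "\<And>r. emb (of_real r) = of_real r"
    and norm_emb: "\<And>a. cmod (emb a) = norm a"
    and eval: "\<And>f. f \<in> almost_periodic \<Longrightarrow>
      continuous_map (weak_topology smul dual_space orbit_seminorms) euclidean (\<lambda>\<phi>. \<phi> f)"
    and fpp: "fixed_point_property_E TYPE('s) TYPE('k) TYPE('s functional)"
  shows "\<exists>\<mu>. left_invariant_mean (almost_periodic :: ('s \<Rightarrow>\<^sub>C complex) set) \<mu>"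
proof -
  have "emb 1 = 1" using emb(3)[of 1] by simp
  then interpret seminormed_space smul dual_space orbit_seminorms
    unfolding smul_def using dual_space_seminormed[OF emb(1,2) _ norm_emb] by blast
  let ?M = "means :: 's functional set"
  have M_sub: "?M \<subseteq> dual_space" using means_dual_space by auto

  have lcs: "locally_convex_space smul dual_space orbit_seminorms"
    unfolding locally_convex_space_def Hausdorff_iff_separated
  proof (intro conjI ballI impI)
    fix \<phi> :: "'s functional" assume \<phi>: "\<phi> \<in> dual_space" "\<forall>p\<in>orbit_seminorms. p \<phi> = 0"
    show "\<phi> = 0"
    proof
      fix f show "\<phi> f = 0 f"
        using \<phi> orbit_seminorm_upper[OF \<phi>(1) _ self_orbit, of f]
        by (cases "f \<in> almost_periodic") (auto simp: dual_space_def orbit_seminorms_def)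
    qed
  qed (use vector_space_axioms subspace_X seminorm in auto)

  have coarser: "openin (top_of_set ?M) {z \<in> ?M. z \<in> U}" if U: "openin \<tau> U" for U
  proof (subst openin_subopen, intro ballI)
    fix y assume y: "y \<in> {z \<in> ?M. z \<in> U}"
    then have "y \<in> U" by simp
    from openin_seminorm_nhd[OF U this] obtain P e
      where P: "finite P" "P \<subseteq> orbit_seminorms" "0 < e" "{z \<in> dual_space. \<forall>p\<in>P. p (z - y) < e} \<subseteq> U"
      by (elim exE conjE)
    have "\<exists>V. open V \<and> y \<in> V \<and> (\<forall>z\<in>?M. z \<in> V \<longrightarrow> p (z - y) < e)" if "p \<in> P" for p
    proof -
      have "p \<in> orbit_seminorm ` almost_periodic"
        using P(2) that by (auto simp: orbit_seminorms_def)
      then obtain f where f: "f \<in> almost_periodic" "p = orbit_seminorm f" by auto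
      have "y \<in> ?M" using y by simp
      from orbit_seminorm_continuous[OF f(1) this P(3)] show ?thesis unfolding f(2) .
    qed
    then have "\<forall>p\<in>P. \<exists>V. open V \<and> y \<in> V \<and> (\<forall>z\<in>?M. z \<in> V \<longrightarrow> p (z - y) < e)" by (rule ballI)
    from bchoice[OF this] obtain V
      where "\<forall>p\<in>P. open (V p) \<and> y \<in> V p \<and> (\<forall>z\<in>?M. z \<in> V p \<longrightarrow> p (z - y) < e)" by (elim exE)
    then have V: "\<And>p. p \<in> P \<Longrightarrow> open (V p)" "\<And>p. p \<in> P \<Longrightarrow> y \<in> V p"
      "\<And>p z. p \<in> P \<Longrightarrow> z \<in> ?M \<Longrightarrow> z \<in> V p \<Longrightarrow> p (z - y) < e"
      by simp_all
    have "?M \<inter> (\<Inter>p\<in>P. V p) \<subseteq> {z \<in> ?M. z \<in> U}"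
    proof
      fix z assume z: "z \<in> ?M \<inter> (\<Inter>p\<in>P. V p)"
      then have "z \<in> {z \<in> dual_space. \<forall>p\<in>P. p (z - y) < e}" using V(3) M_sub by auto
      then show "z \<in> {z \<in> ?M. z \<in> U}" using z P(4) by auto
    qed
    moreover have "openin (top_of_set ?M) (?M \<inter> (\<Inter>p\<in>P. V p))"
      using P(1) V(1) by (intro openin_open_Int open_INT) auto
    ultimately show "\<exists>W. openin (top_of_set ?M) W \<and> y \<in> W \<and> W \<subseteq> {z \<in> ?M. z \<in> U}"
      using y V(2) by (intro exI[of _ "?M \<inter> (\<Inter>p\<in>P. V p)"]) auto
  qed

  have "continuous_map (subtopology \<omega> ?M) euclidean (\<lambda>\<phi>. \<phi> f)" for f
  proof (cases "f \<in> almost_periodic")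
    case True
    then show ?thesis using eval continuous_map_from_subtopology by blast
  next
    case False
    show ?thesis
      by (rule continuous_map_eq[of _ _ "\<lambda>_. 0"]) (use False M_sub in \<open>auto simp: dual_space_def\<close>)
  qed
  then have "continuous_map (subtopology \<omega> ?M) euclidean (\<lambda>\<phi>. \<phi>)"
    unfolding euclidean_product_topology[symmetric] continuous_map_componentwise_UNIV by simp
  then have finer: "openin (subtopology \<omega> ?M) {z \<in> ?M. z \<in> U}" if "open U" for U
    using openin_continuous_map_preimage[of "subtopology \<omega> ?M" euclidean "\<lambda>\<phi>. \<phi>" U] that M_sub
    by (simp add: inf.absorb2 Int_commute)

  \<comment> \<open>A sandwich on the means: weak is coarser than the seminorm topology, which is
    coarser than the product topology by total boundedness of orbits, which by \<open>eval\<close>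
    is coarser than weak.\<close>
  have top: "subtopology \<omega> ?M = top_of_set ?M"
    unfolding topology_eq
  proof (intro allI iffI)
    fix U assume "openin (subtopology \<omega> ?M) U"
    then obtain V where V: "openin \<omega> V" "U = V \<inter> ?M" by (auto simp: openin_subtopology)
    then have "U = {z \<in> ?M. z \<in> V}" by auto
    then show "openin (top_of_set ?M) U"
      using coarser[OF openin_weak_seminorm[OF V(1)]] by simp
  next
    fix U assume "openin (top_of_set ?M) U"
    then obtain V where V: "open V" "U = ?M \<inter> V" by (auto simp: openin_open)
    then have "U = {z \<in> ?M. z \<in> V}" by auto
    then show "openin (subtopology \<omega> ?M) U" using finer[OF V(1)] by simp
  qed

  have compact: "compactin \<omega> ?M"
  proof -
    have "compactin (subtopology \<omega> ?M) ?M"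
      unfolding top using compact_means by (simp add: compactin_subtopology)
    then show ?thesis by (simp add: compactin_subtopology)
  qed

  have convex: "convex_in smul ?M"
    unfolding convex_in_def
  proof (intro ballI)
    fix \<phi> \<psi> :: "'s functional" and t :: real assume \<phi>\<psi>: "\<phi> \<in> means" "\<psi> \<in> means" and t: "t \<in> {0..1}"
    let ?c = "smul (of_real (1 - t)) \<phi> + smul (of_real t) \<psi>"
    have c: "?c f = of_real (1 - t) * \<phi> f + of_real t * \<psi> f" for f
      by (simp add: smul_def emb del: of_real_diff)
    have "cmod (?c f) \<le> b" if "cmod (\<phi> f) \<le> b" "cmod (\<psi> f) \<le> b" for f b
    proof -
      have "cmod (?c f) \<le> (1 - t) * cmod (\<phi> f) + t * cmod (\<psi> f)"
        unfolding c using t by (intro norm_triangle_le) (simp add: norm_mult del: of_real_diff)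
      also have "\<dots> \<le> (1 - t) * b + t * b"
        using t that by (intro add_mono mult_left_mono) auto
      finally show ?thesis by (simp add: algebra_simps)
    qed
    then show "?c \<in> means"
      using \<phi>\<psi> unfolding means_def mem_Collect_eq c by (auto simp: algebra_simps)
  qed

  have act_act: "dual_act s (dual_act t \<phi>) = dual_act (s * t) \<phi>" for s t and \<phi> :: "'s functional"
    by (auto simp: dual_act_def)
  have cont_mean: "continuous_on almost_periodic \<phi>" if "\<phi> \<in> ?M" for \<phi>
  proof (rule continuous_onI)
    fix f :: "'s \<Rightarrow>\<^sub>C complex" and e :: real assume f: "f \<in> almost_periodic" and e: "0 < e"
    have "dist (\<phi> g) (\<phi> f) \<le> e" if "g \<in> almost_periodic" "dist g f < e" for g
      using means_lipschitz[OF \<open>\<phi> \<in> means\<close> that(1) f] that(2) by (simp add: dist_norm)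
    then show "\<exists>d>0. \<forall>g\<in>almost_periodic. dist g f < d \<longrightarrow> dist (\<phi> g) (\<phi> f) \<le> e"
      using e by blast
  qed
  have dyn: "dynamical_system dual_act (subtopology \<omega> ?M)"
    unfolding top dynamical_system_def
  proof (intro conjI allI ballI)
    fix \<phi> :: "'s functional" assume "\<phi> \<in> topspace (top_of_set means)"
    then have \<phi>: "\<phi> \<in> means" by simp
    have "continuous_on UNIV (\<lambda>s. dual_act s \<phi>)"
    proof (rule continuous_on_coordinatewise_then_product)
      fix f
      show "continuous_on UNIV (\<lambda>s. dual_act s \<phi> f)"
        using continuous_on_compose2[OF cont_mean[OF \<phi>] continuous_left_translate, of f]
        by (cases "f \<in> almost_periodic") (auto simp: dual_act_def image_subset_iff)
    qed
    then show "continuous_map euclidean (top_of_set means) (\<lambda>s. dual_act s \<phi>)"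
      using dual_act_means[OF \<phi>] by (auto simp: continuous_map_in_subtopology)
    show "dual_act s \<phi> \<in> topspace (top_of_set means)" for s using dual_act_means[OF \<phi>] by simp
  next
    fix s :: 's
    have "continuous_on means (dual_act s)"
    proof (rule continuous_on_coordinatewise_then_product)
      show "continuous_on means (\<lambda>\<phi>. dual_act s \<phi> f)" for f
        by (cases "f \<in> almost_periodic") (simp_all add: dual_act_def continuous_on_coordinate)
    qed
    then show "continuous_map (top_of_set means) (top_of_set means) (dual_act s)"
      using dual_act_means by (auto simp: continuous_map_in_subtopology)
  qed (rule act_act)

  \<comment> \<open>A translate of a member of the orbit stays in the orbit, so the supremum cannot
    grow.\<close>
  have nonexp: "nonexpansive_action orbit_seminorms dual_act ?M"
    unfolding nonexpansive_action_def orbit_seminorms_def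
  proof (intro ballI allI, elim imageE, simp only:, rule orbit_seminorm_least)
    fix s :: 's and \<phi> \<psi> :: "'s functional" and f g :: "'s \<Rightarrow>\<^sub>C complex"
    assume \<phi>\<psi>: "\<phi> \<in> means" "\<psi> \<in> means" and f: "f \<in> almost_periodic" and g: "g \<in> orbit f"
    have "\<phi> - \<psi> \<in> dual_space" using \<phi>\<psi> M_sub by (intro X_diff) auto
    then have "cmod ((\<phi> - \<psi>) (left_translate s g)) \<le> orbit_seminorm f (\<phi> - \<psi>)"
      using f g by (intro orbit_seminorm_upper left_translate_orbit)
    then show "cmod ((dual_act s \<phi> - dual_act s \<psi>) g) \<le> orbit_seminorm f (\<phi> - \<psi>)"
      using orbit_almost_periodic[OF f g] by (simp add: dual_act_def)
  qed

  have equi: "equicontinuous_action \<omega> dual_act ?M"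
    unfolding equicontinuous_action_def
  proof (intro ballI allI impI, elim conjE)
    fix \<phi> :: "'s functional" and U assume \<phi>: "\<phi> \<in> means" and U: "openin \<omega> U" "0 \<in> U"
    from openin_seminorm_nhd[OF openin_weak_seminorm[OF U(1)] U(2)] obtain P e
      where P: "finite P" "P \<subseteq> orbit_seminorms" "0 < e" "{z \<in> dual_space. \<forall>p\<in>P. p (z - 0) < e} \<subseteq> U"
      by (elim exE conjE)
    \<comment> \<open>A seminorm ball about \<phi>. Relative to the means it is weakly open, so
      nonexpansiveness becomes weak equicontinuity. The inserted \<open>dual_space\<close> covers an
      empty \<open>P\<close>.\<close>
    define B where "B = \<Inter>(insert dual_space ((\<lambda>p. {z \<in> dual_space. p (z - \<phi>) < e}) ` P))"
    have \<phi>X: "\<phi> \<in> dual_space" using \<phi> M_sub by auto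
    have "openin \<tau> B"
      unfolding B_def using P openin_ball[OF _ \<phi>X P(3)] openin_topspace[of \<tau>]
      by (intro openin_Inter) (auto simp: subset_iff)
    then have "openin (subtopology \<omega> ?M) {z \<in> ?M. z \<in> B}"
      unfolding top by (rule coarser)
    then obtain V where V: "openin \<omega> V" "{z \<in> ?M. z \<in> B} = V \<inter> ?M"
      by (auto simp: openin_subtopology)
    have "p (\<phi> - \<phi>) < e" if "p \<in> P" for p
      using seminorm_zero[of p] subsetD[OF P(2) that] P(3) by simp
    then have "\<phi> \<in> B"
      using \<phi>X by (simp add: B_def)
    then have "\<phi> \<in> V" using V(2) \<phi> by blast
    moreover have "dual_act s \<psi> - dual_act s \<phi> \<in> U" if "\<psi> \<in> V \<inter> ?M" for s \<psi>
    proof -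
      have \<psi>: "\<psi> \<in> means" "\<psi> \<in> B" using that V(2) by auto
      have "p (dual_act s \<psi> - dual_act s \<phi>) < e" if "p \<in> P" for p
      proof -
        have "p (dual_act s \<psi> - dual_act s \<phi>) \<le> p (\<psi> - \<phi>)"
          using nonexp \<psi>(1) \<phi> P(2) that unfolding nonexpansive_action_def by blast
        also have "\<dots> < e" using \<psi>(2) that by (auto simp: B_def)
        finally show ?thesis .
      qed
      moreover have "dual_act s \<psi> - dual_act s \<phi> \<in> dual_space"
        using dual_act_means[OF \<psi>(1)] dual_act_means[OF \<phi>] M_sub by (intro X_diff) auto
      ultimately show ?thesis using P(4) by auto
    qed
    ultimately show "\<exists>V. openin \<omega> V \<and> \<phi> \<in> V \<and>
        (\<forall>s. \<forall>\<psi>\<in>V \<inter> ?M. dual_act s \<psi> - dual_act s \<phi> \<in> U)"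
      using V(1) by blast
  qed

  have "\<exists>\<phi>\<in>?M. \<forall>s. dual_act s \<phi> = \<phi>"
    using fpp[unfolded fixed_point_property_E_def, rule_format,
        of smul dual_space orbit_seminorms ?M dual_act]
      lcs means_nonempty M_sub convex compact dyn nonexp equi by simp
  then show ?thesis using left_invariant_mean_of_fixed by blast
qed

lemma mean_of_fixed_point_property_complex:
  assumes fpp: "fixed_point_property_E TYPE('s::semitopological_semigroup) TYPE(complex) TYPE('s functional)"
  shows "\<exists>\<mu>. left_invariant_mean (almost_periodic :: ('s \<Rightarrow>\<^sub>C complex) set) \<mu>"
proof (rule mean_of_fixed_point_property[of "\<lambda>c. c", OF _ _ _ _ _ fpp])
  interpret seminormed_space "\<lambda>c (\<phi> :: 's functional) f. c * \<phi> f" dual_space orbit_seminorms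
    by (rule dual_space_seminormed) auto
  fix f :: "'s \<Rightarrow>\<^sub>C complex" assume f: "f \<in> almost_periodic"
  have "(\<lambda>\<phi>. \<phi> f) \<in> continuous_dual (\<lambda>c (\<phi> :: 's functional) f. c * \<phi> f) dual_space orbit_seminorms"
    by (rule continuous_dualI[of _ "orbit_seminorm f" 1])
      (use f orbit_seminorm_upper[OF _ f self_orbit] in \<open>auto simp: orbit_seminorms_def\<close>)
  then show "continuous_map \<omega> euclidean (\<lambda>\<phi>. \<phi> f)" by (rule continuous_map_dual)
qed auto

text \<open>The real and imaginary parts of an evaluation are real functionals; their weak
  continuity is recombined into that of the evaluation.\<close>

lemma mean_of_fixed_point_property_real:
  assumes fpp: "fixed_point_property_E TYPE('s::semitopological_semigroup) TYPE(real) TYPE('s functional)"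
  shows "\<exists>\<mu>. left_invariant_mean (almost_periodic :: ('s \<Rightarrow>\<^sub>C complex) set) \<mu>"
proof (rule mean_of_fixed_point_property[of complex_of_real, OF _ _ _ _ _ fpp])
  interpret seminormed_space "\<lambda>c (\<phi> :: 's functional) f. complex_of_real c * \<phi> f" dual_space orbit_seminorms
    by (rule dual_space_seminormed) auto
  fix f :: "'s \<Rightarrow>\<^sub>C complex" assume f: "f \<in> almost_periodic"
  have "(\<lambda>\<phi>. h (\<phi> f)) \<in> continuous_dual (\<lambda>c (\<phi> :: 's functional) f. complex_of_real c * \<phi> f)
      dual_space orbit_seminorms"
    if "\<And>z w. h (z + w) = h z + h w" "\<And>c z. h (complex_of_real c * z) = c * h z"
      "\<And>z. \<bar>h z\<bar> \<le> cmod z" for h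
    by (rule continuous_dualI[of _ "orbit_seminorm f" 1])
      (use that f order_trans[OF that(3) orbit_seminorm_upper[OF _ f self_orbit]]
        in \<open>auto simp: orbit_seminorms_def\<close>)
  from continuous_map_dual[OF this, of Re] continuous_map_dual[OF this, of Im]
  have "continuous_map \<omega> euclideanreal (\<lambda>\<phi>. Re (\<phi> f))" "continuous_map \<omega> euclideanreal (\<lambda>\<phi>. Im (\<phi> f))"
    by (simp_all add: abs_Re_le_cmod abs_Im_le_cmod)
  moreover have "continuous_map euclideanreal euclidean complex_of_real"
    "continuous_map euclideanreal euclidean (\<lambda>r. \<i> * complex_of_real r)"
    by (auto intro!: continuous_intros)
  ultimately have "continuous_map \<omega> euclidean (complex_of_real \<circ> (\<lambda>\<phi>. Re (\<phi> f)))"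
    "continuous_map \<omega> euclidean ((\<lambda>r. \<i> * complex_of_real r) \<circ> (\<lambda>\<phi>. Im (\<phi> f)))"
    by (auto intro: continuous_map_compose)
  from continuous_map_add[OF this] show "continuous_map \<omega> euclidean (\<lambda>\<phi>. \<phi> f)"
    by (simp add: complex_eq[symmetric])
qed (auto simp: norm_mult)

text \<open>A mean yields the property over every type \<open>'x\<close> of points, while the
  converse tests it only on the type that holds the means.\<close>

theorem theorem3p8:
  shows "((\<exists>\<mu>. left_invariant_mean (almost_periodic :: ('s::semitopological_semigroup \<Rightarrow>\<^sub>C complex) set) \<mu>)
            \<longleftrightarrow> fixed_point_property_E TYPE('s) TYPE(real) TYPE('s functional)) \<and>
         ((\<exists>\<mu>. left_invariant_mean (almost_periodic :: ('s \<Rightarrow>\<^sub>C complex) set) \<mu>)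
            \<longleftrightarrow> fixed_point_property_E TYPE('s) TYPE(complex) TYPE('s functional)) \<and>
         ((\<exists>\<mu>. left_invariant_mean (almost_periodic :: ('s \<Rightarrow>\<^sub>C complex) set) \<mu>)
            \<longrightarrow> fixed_point_property_E TYPE('s) TYPE(real) TYPE('x::ab_group_add) \<and>
                fixed_point_property_E TYPE('s) TYPE(complex) TYPE('x))"
  by (intro conjI iffI impI; (elim exE)?;
    erule fixed_point_property_real fixed_point_property_complex
      mean_of_fixed_point_property_real mean_of_fixed_point_property_complex)

end
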